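(* Let $A=(V,E)$ be a noncrossing arc diagram with $n$ marked boundary points and compass labeling $\phi$. Perform the following construction, where $\mathrm{Sub}$ is the recursive procedure described in the context. (i) If $A$ is acyclic, let $m=\min_i\phi(v_i)$, cut the annulus open between the boundary points with compass labels $m+n-1$ and $m$ to obtain the cut-open diagram, let $\mathcal{W}_{\mathrm{wax}}$ be the output of $\mathrm{Sub}$ on it, and return the TITO with window notation $[\mathcal{W}_{\mathrm{wax}}]$ (a single waxing block). (ii) If $A$ has a cycle $C$, let $\mathcal{W}_{\mathrm{wan}}$ be the list of compass labels of the boundary points of $C$ in decreasing order. For each walker $W_i\in\mathsf{W}(A)$ (where $i$ denotes the minimum compass label in the walker), let $\mathcal{W}_i=\mathrm{Sub}(W_i)$, and let $\mathcal{W}_{\mathrm{wax}}$ be the concatenation, from left to right, of the $\mathcal{W}_i$ in increasing order of $i$. Return the TITO with window notation $[\mathcal{W}_{\mathrm{wax}}][\underline{\mathcal{W}_{\mathrm{wan}}}]$ (with the waxing block omitted if $\mathcal{W}_{\mathrm{wax}}$ is empty). Then the returned object is a well-defined $n$-TITO $\preceq$, it avoids the pattern $312$, and its arc diagram is $\mathcal{A}(\preceq)=A$. Thus the construction computes the inverse of the map $\mathcal{A}$ from $312$-avoiding $n$-TITOs to noncrossing arc diagrams with $n$ marked points.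
   Context: **TITOs.** Fix a positive integer $n$. An $n$-TITO is a total order $\preceq$ of $\mathbb{Z}$ with $a\preceq b\iff a+n\preceq b+n$. It avoids $312$ if there are no integers $a<b<c$ with $c\preceq a\preceq b$. A block of $\preceq$ is a nonempty order-convex subset $I\subseteq\mathbb{Z}$ having no $\preceq$-minimal or $\preceq$-maximal element and such that all intervals $\{b\in I: a\preceq b\preceq c\}$ with $a,c\in I$ are finite. Its size is the number of residue classes mod $n$ appearing in it. It is waxing if $x\preceq x+n$ for all $x\in I$ and waning if $x+n\prec x$ for all $x\in I$; every block is one or the other. A window of a block of size $k$ is a list of $k$ consecutive elements of it under $\preceq$, written $[a_1,\dots,a_k]$ if waxing and $[\underline{a_1,\dots,a_k}]$ if waning. A window notation for $\preceq$ lists a window for each block in the order in which the blocks appear, and it determines $\preceq$. **Arcs.** A reflection index is a pair $(a,b)$ of integers with $a<b$, up to simultaneous translation by multiples of $n$, represented with $a\in[n]$. Consider an annulus whose outer boundary has $n$ marked points $v_1,\dots,v_n$ in clockwise order (indices mod $n$). An arc is a simple curve inside the annulus, directed clockwise around the puncture, from a marked point to a marked point (possibly the same), up to isotopy. Arcs correspond bijectively to reflection indices $(a,b)$ with $a<b\le a+n$, $a\in[n]$; the arc of $(a,b)$ is denoted $\gamma_{a,b}$ if $b\le n$ and $\gamma_{a,b-n}$ if $b>n$. A noncrossing arc diagram is a collection of arcs that can be drawn so that they do not intersect in their interiors and such that each marked point has at most one incoming and at most one outgoing arc. Paths and cycles are directed paths and directed cycles of arcs (a loop $\gamma_{a,a}$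 is a cycle). A noncrossing arc diagram has at most one cycle, and the cycle surrounds the puncture. **Arc diagram of a TITO.** A wall of $\preceq$ is a reflection index $(a,b)$ such that one of $a,b$ covers the other in $\preceq$; it is a lower wall if $b\preceq a$. For a $312$-avoiding $n$-TITO, $\mathcal{A}(\preceq)$ has vertices $v_1,\dots,v_n$ and arcs $\{\gamma_{a,b}: a,b\in[n],\ (a,b)\text{ or }(a,b+n)\text{ is a lower wall}\}$. **Walkers.** If $A$ contains a cycle $C$, let $C^\circ$ be $C$ with its interior (the region bounded by $C$ containing the puncture). The walker set $\mathsf{W}(A)$ is the set of connected components of the annulus minus $C^\circ$ that contain at least one marked point, each equipped with the marked points and arcs it contains. The elements of $\mathsf{W}(A)$ are called walkers. **Compass labeling.** A labeling is a map $\rho:V\to\mathbb{Z}$ with $\rho(v_i)\equiv i\pmod n$. If $A$ contains a cycle $C$, the compass labeling $\phi$ is the unique labeling such that (1) $\phi(v_a)<\phi(v_b)$ for all arcs $\gamma_{a,b}$ not in $C$; (2) $\phi(v_i)>0$ for all $i$; (3) for each walker $W$, the set of labels of its marked points is an integer interval; (4) for each walker $W$, the sum of the labels of its marked points is minimized (subject to the previous conditions), and $\phi(v_i)=i$ for every $v_i$ on $C$. If $A$ has no cycle, $\phi$ is the unique labeling such that $\phi(v_a)<\phi(v_b)$ for all arcs $\gamma_{a,b}$, all labels are positive, the set of all labels is an integer interval, and the sum of all labels is minimized. **Cut-open diagram.** For acyclic $A$, cut the annulus along a simple curve that starts on the boundary segment running clockwise from the marked point of maximum compass label to the one of minimum compass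 label, ends on the inner boundary, and is disjoint from all arcs. The marked points then lie on a boundary segment in increasing order of compass label; arcs and labels are retained. **Procedure $\mathrm{Sub}$.** Input: a walker, a cut-open diagram, or a subwalker (see below), with marked points listed clockwise; their compass labels are consecutive increasing integers $c,c+1,\dots,d$, and every arc goes from a smaller to a larger label. Output: a finite list of integers. 1. If there are no arcs, return $[c,c+1,\dots,d]$. 2. Otherwise, let $P=(u_1,\dots,u_{k+1})$ be the subcompass path: $u_1$ is the point of smallest compass label among those having an outgoing arc, and $P$ is the longest path starting at $u_1$. Let $a_t=\phi(u_t)$. Start with the list $[a_{k+1},a_k,\dots,a_1]$. 3. Form the subwalkers: for each nonempty interval among $[c,a_1-1]$, $[a_t+1,a_{t+1}-1]$ for $1\le t\le k$, and $[a_{k+1}+1,d]$, the subwalker consists of the marked points with labels in that interval, together with the arcs among them and the inherited labels. 4. Process the subwalkers with labels smaller than $a_{k+1}$ in decreasing order of minimum label, applying $\mathrm{Sub}$ to each and concatenating the result to the left of the current list. Then process the subwalkers with labels larger than $a_{k+1}$ in increasing order of minimum label, applying $\mathrm{Sub}$ and concatenating the result to the right. Return the list. *)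

theory Defs
  imports "HOL-Analysis.Analysis"
begin

section \<open>TITOs\<close>

text \<open>A relation \<open>R\<close> is read as \<open>(a, b) \<in> R\<close> iff \<open>a \<preceq> b\<close>.\<close>

definition is_tito :: "int \<Rightarrow> (int \<times> int) set \<Rightarrow> bool" where
  "is_tito n R \<longleftrightarrow> linear_order R \<and> (\<forall>a b. (a, b) \<in> R \<longleftrightarrow> (a + n, b + n) \<in> R)"

definition avoids_312 :: "(int \<times> int) set \<Rightarrow> bool" where
  "avoids_312 R \<longleftrightarrow> \<not> (\<exists>a b c. a < b \<and> b < c \<and> (c, a) \<in> R \<and> (a, b) \<in> R)"

definition covered_by :: "(int \<times> int) set \<Rightarrow> int \<Rightarrow> int \<Rightarrow> bool" where
  "covered_by R x y \<longleftrightarrow> (x, y) \<in> R \<and> x \<noteq> y \<and> (\<forall>z. (x, z) \<in> R \<and> (z, y) \<in> R \<longrightarrow> z = x \<or> z = y)"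

definition is_block :: "(int \<times> int) set \<Rightarrow> int set \<Rightarrow> bool" where
  "is_block R I \<longleftrightarrow> I \<noteq> {} \<and>
     (\<forall>a\<in>I. \<forall>c\<in>I. \<forall>b. (a, b) \<in> R \<and> (b, c) \<in> R \<longrightarrow> b \<in> I) \<and>
     \<not> (\<exists>a\<in>I. \<forall>x\<in>I. (a, x) \<in> R) \<and>
     \<not> (\<exists>a\<in>I. \<forall>x\<in>I. (x, a) \<in> R) \<and>
     (\<forall>a\<in>I. \<forall>c\<in>I. finite {b \<in> I. (a, b) \<in> R \<and> (b, c) \<in> R})"

definition block_size :: "int \<Rightarrow> int set \<Rightarrow> nat" where
  "block_size n I = card ((\<lambda>x. x mod n) ` I)"

definition waxing :: "int \<Rightarrow> (int \<times> int) set \<Rightarrow> int set \<Rightarrow> bool" where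
  "waxing n R I \<longleftrightarrow> (\<forall>x\<in>I. (x, x + n) \<in> R)"

definition waning :: "int \<Rightarrow> (int \<times> int) set \<Rightarrow> int set \<Rightarrow> bool" where
  "waning n R I \<longleftrightarrow> (\<forall>x\<in>I. (x + n, x) \<in> R \<and> x + n \<noteq> x)"

datatype window = Wax "int list" | Wan "int list"

fun window_list :: "window \<Rightarrow> int list" where
  "window_list (Wax w) = w"
| "window_list (Wan w) = w"

definition is_window :: "int \<Rightarrow> (int \<times> int) set \<Rightarrow> int set \<Rightarrow> window \<Rightarrow> bool" where
  "is_window n R I w \<longleftrightarrow>
     length (window_list w) = block_size n I \<and>
     set (window_list w) \<subseteq> I \<and>
     successively (covered_by R) (window_list w) \<and>
     (case w of Wax _ \<Rightarrow> waxing n R I | Wan _ \<Rightarrow> waning n R I)"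

definition window_notation :: "int \<Rightarrow> (int \<times> int) set \<Rightarrow> window list \<Rightarrow> bool" where
  "window_notation n R ws \<longleftrightarrow>
     (\<exists>Is. set Is = {I. is_block R I} \<and>
           sorted_wrt (\<lambda>I J. \<forall>x\<in>I. \<forall>y\<in>J. (x, y) \<in> R \<and> x \<noteq> y) Is \<and>
           list_all2 (is_window n R) Is ws)"


section \<open>Arcs and noncrossing arc diagrams\<close>

text \<open>
  The annulus is realised in the complex plane, with the puncture at the origin.
  The marked point \<open>v\<^sub>i\<close> depends on \<open>i\<close> modulo \<open>n\<close> only, and the negative angle makes
  the order clockwise.
\<close>

definition annulus :: "complex set" where
  "annulus = {z. 1/2 \<le> norm z \<and> norm z \<le> 1}"

definition marked :: "int \<Rightarrow> int \<Rightarrow> complex" where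
  "marked n i = cis (- (2 * pi * of_int i / of_int n))"

text \<open>
  For \<open>a, b \<in> {1..n}\<close> the pair \<open>(a, b)\<close> stands for the isotopy class \<open>\<gamma>\<^sub>a\<^sub>,\<^sub>b\<close>, whose
  reflection index is \<open>(a, arc_end n a b)\<close>.  The curve \<open>model_arc n a b\<close> represents this
  class: it turns clockwise around the puncture from the angular position of \<open>a\<close> to that
  of \<open>arc_end n a b\<close>, by at most one full turn.
\<close>

definition arc_end :: "int \<Rightarrow> int \<Rightarrow> int \<Rightarrow> int" where
  "arc_end n a b = (if a < b then b else b + n)"

definition model_arc :: "int \<Rightarrow> int \<Rightarrow> int \<Rightarrow> real \<Rightarrow> complex" where
  "model_arc n a b t =
     of_real (1 - t * (1 - t)) *
     cis (- (2 * pi * (of_int a + t * of_int (arc_end n a b - a)) / of_int n))"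

definition simple_curve :: "int \<Rightarrow> int \<Rightarrow> int \<Rightarrow> (real \<Rightarrow> complex) \<Rightarrow> bool" where
  "simple_curve n a b g \<longleftrightarrow>
     simple_path g \<and> pathstart g = marked n a \<and> pathfinish g = marked n b \<and>
     g ` {0<..<1} \<subseteq> {z. 1/2 < norm z \<and> norm z < 1}"

text \<open>Isotopy is a homotopy all of whose stages are simple curves with the given endpoints.\<close>

definition represents_arc :: "int \<Rightarrow> int \<times> int \<Rightarrow> (real \<Rightarrow> complex) \<Rightarrow> bool" where
  "represents_arc n e g \<longleftrightarrow>
     (case e of (a, b) \<Rightarrow>
        homotopic_with_canon (simple_curve n a b) {0..1} annulus (model_arc n a b) g)"

definition is_drawing ::
    "int \<Rightarrow> (int \<times> int) set \<Rightarrow> (int \<times> int \<Rightarrow> real \<Rightarrow> complex) \<Rightarrow> bool" where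
  "is_drawing n E D \<longleftrightarrow>
     (\<forall>e\<in>E. represents_arc n e (D e)) \<and>
     (\<forall>e\<in>E. \<forall>f\<in>E. e \<noteq> f \<longrightarrow> D e ` {0<..<1} \<inter> D f ` {0<..<1} = {})"

text \<open>\<open>single_valued E\<close>: at most one outgoing arc; \<open>single_valued (E\<inverse>)\<close>: at most one incoming.\<close>

definition noncrossing_arc_diagram :: "int \<Rightarrow> (int \<times> int) set \<Rightarrow> bool" where
  "noncrossing_arc_diagram n E \<longleftrightarrow>
     E \<subseteq> {1..n} \<times> {1..n} \<and> (\<exists>D. is_drawing n E D) \<and>
     single_valued E \<and> single_valued (E\<inverse>)"

definition lower_wall :: "(int \<times> int) set \<Rightarrow> int \<Rightarrow> int \<Rightarrow> bool" where
  "lower_wall R a b \<longleftrightarrow> a < b \<and> (covered_by R a b \<or> covered_by R b a) \<and> (b, a) \<in> R"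

definition arc_diagram :: "int \<Rightarrow> (int \<times> int) set \<Rightarrow> (int \<times> int) set" where
  "arc_diagram n R =
     {(a, b). a \<in> {1..n} \<and> b \<in> {1..n} \<and> (lower_wall R a b \<or> lower_wall R a (b + n))}"


section \<open>Cycles and walkers\<close>

text \<open>A cycle is given by its set of arcs; \<open>p\<close> lists its vertices in order.\<close>

definition is_cycle :: "(int \<times> int) set \<Rightarrow> (int \<times> int) set \<Rightarrow> bool" where
  "is_cycle E C \<longleftrightarrow>
     C \<subseteq> E \<and> (\<exists>p. p \<noteq> [] \<and> distinct p \<and> C = set (zip p (rotate1 p)))"

definition has_cycle :: "(int \<times> int) set \<Rightarrow> bool" where
  "has_cycle E \<longleftrightarrow> (\<exists>C. is_cycle E C)"

definition cycle_of :: "(int \<times> int) set \<Rightarrow> (int \<times> int) set" where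
  "cycle_of E = (THE C. is_cycle E C)"

definition cycle_curve ::
    "(int \<times> int) set \<Rightarrow> (int \<times> int \<Rightarrow> real \<Rightarrow> complex) \<Rightarrow> complex set" where
  "cycle_curve E D = (\<Union>e\<in>cycle_of E. path_image (D e))"

text \<open>Walkers are the topological components themselves, in a given drawing \<open>D\<close> of the diagram.\<close>

definition walkers ::
    "int \<Rightarrow> (int \<times> int) set \<Rightarrow> (int \<times> int \<Rightarrow> real \<Rightarrow> complex) \<Rightarrow> complex set set" where
  "walkers n E D =
     {W \<in> components (annulus - (cycle_curve E D \<union> inside (cycle_curve E D))).
        \<exists>i\<in>{1..n}. marked n i \<in> W}"

definition walker_points :: "int \<Rightarrow> complex set \<Rightarrow> int set" where
  "walker_points n W = {i \<in> {1..n}. marked n i \<in> W}"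

definition walker_arcs ::
    "(int \<times> int) set \<Rightarrow> (int \<times> int \<Rightarrow> real \<Rightarrow> complex) \<Rightarrow> complex set \<Rightarrow> (int \<times> int) set" where
  "walker_arcs E D W = {e \<in> E. path_image (D e) \<subseteq> W}"


section \<open>Compass labelings\<close>

text \<open>A labeling maps the index \<open>i \<in> {1..n}\<close> of \<open>v\<^sub>i\<close> to the label of \<open>v\<^sub>i\<close>.\<close>

definition is_labeling :: "int \<Rightarrow> (int \<Rightarrow> int) \<Rightarrow> bool" where
  "is_labeling n \<phi> \<longleftrightarrow> \<phi> \<in> extensional {1..n} \<and> (\<forall>i\<in>{1..n}. \<phi> i mod n = i mod n)"

definition admissible_cyclic ::
    "int \<Rightarrow> (int \<times> int) set \<Rightarrow> (int \<times> int \<Rightarrow> real \<Rightarrow> complex) \<Rightarrow> (int \<Rightarrow> int) \<Rightarrow> bool" where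
  "admissible_cyclic n E D \<phi> \<longleftrightarrow> is_labeling n \<phi> \<and>
     (\<forall>(a, b)\<in>E - cycle_of E. \<phi> a < \<phi> b) \<and>
     (\<forall>i\<in>{1..n}. \<phi> i > 0) \<and>
     (\<forall>W\<in>walkers n E D. \<exists>l u. \<phi> ` walker_points n W = {l..u})"

definition admissible_acyclic :: "int \<Rightarrow> (int \<times> int) set \<Rightarrow> (int \<Rightarrow> int) \<Rightarrow> bool" where
  "admissible_acyclic n E \<phi> \<longleftrightarrow> is_labeling n \<phi> \<and>
     (\<forall>(a, b)\<in>E. \<phi> a < \<phi> b) \<and>
     (\<forall>i\<in>{1..n}. \<phi> i > 0) \<and>
     (\<exists>l u. \<phi> ` {1..n} = {l..u})"

definition is_compass_labeling ::
    "int \<Rightarrow> (int \<times> int) set \<Rightarrow> (int \<times> int \<Rightarrow> real \<Rightarrow> complex) \<Rightarrow> (int \<Rightarrow> int) \<Rightarrow> bool" where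
  "is_compass_labeling n E D \<phi> \<longleftrightarrow>
     (if has_cycle E then
        admissible_cyclic n E D \<phi> \<and>
        (\<forall>\<rho>. admissible_cyclic n E D \<rho> \<longrightarrow>
           (\<forall>W\<in>walkers n E D. (\<Sum>i\<in>walker_points n W. \<phi> i) \<le> (\<Sum>i\<in>walker_points n W. \<rho> i))) \<and>
        (\<forall>i\<in>Field (cycle_of E). \<phi> i = i)
      else
        admissible_acyclic n E \<phi> \<and>
        (\<forall>\<rho>. admissible_acyclic n E \<rho> \<longrightarrow> (\<Sum>i\<in>{1..n}. \<phi> i) \<le> (\<Sum>i\<in>{1..n}. \<rho> i)))"

definition compass ::
    "int \<Rightarrow> (int \<times> int) set \<Rightarrow> (int \<times> int \<Rightarrow> real \<Rightarrow> complex) \<Rightarrow> int \<Rightarrow> int" where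
  "compass n E D = (THE \<phi>. is_compass_labeling n E D \<phi>)"

text \<open>
  A cut for an acyclic diagram whose minimum compass label is \<open>m\<close>: it starts on the open
  boundary segment running clockwise from the point labelled \<open>m + n - 1\<close> to the one
  labelled \<open>m\<close>.
\<close>

definition is_cut ::
    "int \<Rightarrow> (int \<times> int) set \<Rightarrow> (int \<times> int \<Rightarrow> real \<Rightarrow> complex) \<Rightarrow> int \<Rightarrow> (real \<Rightarrow> complex) \<Rightarrow> bool"
  where
  "is_cut n E D m h \<longleftrightarrow> arc h \<and>
     (\<exists>x::real. of_int (m + n - 1) < x \<and> x < of_int (m + n) \<and>
                pathstart h = cis (- (2 * pi * x / of_int n))) \<and>
     norm (pathfinish h) = 1/2 \<and>
     h ` {0<..<1} \<subseteq> {z. 1/2 < norm z \<and> norm z < 1} \<and>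
     (\<forall>e\<in>E. path_image h \<inter> path_image (D e) = {})"


section \<open>The procedure Sub\<close>

text \<open>
  Labels are pairwise distinct, so a walker, cut-open diagram or subwalker is handed to the
  procedure by naming its marked points by their compass labels: \<open>c\<close> and \<open>d\<close> are the extreme
  labels, and \<open>F\<close> is the set of pairs of labels of the tail and head of its arcs.
\<close>

definition is_input :: "int \<Rightarrow> int \<Rightarrow> (int \<times> int) set \<Rightarrow> bool" where
  "is_input c d F \<longleftrightarrow> (\<forall>(a, b)\<in>F. c \<le> a \<and> a < b \<and> b \<le> d)"

definition path_from :: "(int \<times> int) set \<Rightarrow> int \<Rightarrow> int list \<Rightarrow> bool" where
  "path_from F u p \<longleftrightarrow> p \<noteq> [] \<and> hd p = u \<and> successively (\<lambda>x y. (x, y) \<in> F) p"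

definition subcompass_path :: "(int \<times> int) set \<Rightarrow> int list" where
  "subcompass_path F = (ARG_MAX length p. path_from F (Min (Domain F)) p)"

definition restrict_arcs :: "(int \<times> int) set \<Rightarrow> int \<Rightarrow> int \<Rightarrow> (int \<times> int) set" where
  "restrict_arcs F lo hi = F \<inter> {lo..hi} \<times> {lo..hi}"

text \<open>The nonempty intervals \<open>[c, a\<^sub>1 - 1]\<close> and \<open>[a\<^sub>t + 1, a\<^sub>t\<^sub>+\<^sub>1 - 1]\<close>, in increasing order.\<close>

definition lower_intervals :: "int \<Rightarrow> int list \<Rightarrow> (int \<times> int) list" where
  "lower_intervals c P =
     filter (\<lambda>(lo, hi). lo \<le> hi) (map (\<lambda>(x, y). (x + 1, y - 1)) (zip ((c - 1) # P) P))"

lemma is_input_path_sorted: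
  assumes "is_input c d F" "successively (\<lambda>x y. (x, y) \<in> F) p"
  shows "sorted_wrt (<) p"
proof -
  have "successively (<) p"
    using assms(2) by (rule successively_mono) (use assms(1) in \<open>auto simp: is_input_def\<close>)
  then show ?thesis by (simp add: successively_conv_sorted_wrt)
qed

lemma is_input_path_range:
  assumes "is_input c d F" "successively (\<lambda>x y. (x, y) \<in> F) p" "p \<noteq> []" "hd p \<in> {c..d}"
  shows "set p \<subseteq> {c..d}"
  using assms(2-4)
proof (induction p rule: induct_list012)
  case (3 x y zs)
  then have xy: "(x, y) \<in> F" "successively (\<lambda>x y. (x, y) \<in> F) (y # zs)" "x \<in> {c..d}" by auto
  then have y: "y \<in> {c..d}" using assms(1) by (fastforce simp: is_input_def)
  then have "set (y # zs) \<subseteq> {c..d}" using 3(2)[OF xy(2)] by simp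
  then show ?case using xy(3) by simp
qed auto

lemma subcompass_path:
  assumes "is_input c d F" "F \<noteq> {}"
  shows "path_from F (Min (Domain F)) (subcompass_path F)"
    and "path_from F (Min (Domain F)) p \<Longrightarrow> length p \<le> length (subcompass_path F)"
    and "set (subcompass_path F) \<subseteq> {c..d}"
proof -
  let ?u = "Min (Domain F)"
  have sub: "Domain F \<subseteq> {c..d}" using assms(1) by (fastforce simp: is_input_def)
  then have "finite (Domain F)" by (rule finite_subset) simp
  then have "?u \<in> Domain F" using assms(2) by (intro Min_in) auto
  then have u: "?u \<in> {c..d}" using sub by blast
  have rng: "set p \<subseteq> {c..d}" if "path_from F ?u p" for p
    using is_input_path_range[OF assms(1)] that u by (auto simp: path_from_def)
  have len: "length p < Suc (card {c..d})" if p: "path_from F ?u p" for p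
  proof -
    have "distinct p"
      using is_input_path_sorted[OF assms(1)] p by (auto simp: path_from_def strict_sorted_iff)
    then show ?thesis
      using card_mono[OF _ rng[OF p]] by (simp add: distinct_card)
  qed
  have "path_from F ?u [?u]" by (simp add: path_from_def)
  note am = arg_max_nat_lemma[of "path_from F ?u" "[?u]" length "Suc (card {c..d})", OF this]
  show 1: "path_from F ?u (subcompass_path F)"
    using am len unfolding subcompass_path_def by blast
  show "length p \<le> length (subcompass_path F)" if "path_from F ?u p"
    using am len that unfolding subcompass_path_def by blast
  show "set (subcompass_path F) \<subseteq> {c..d}" using rng[OF 1] .
qed

text \<open>
  The subwalkers below the end of the path are processed in decreasing order and each result
  is put to the left, so the results end up in increasing order.  Arguments violating
  \<open>is_input\<close> are outside the domain of the procedure; the value there is immaterial.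
\<close>

function Sub :: "int \<Rightarrow> int \<Rightarrow> (int \<times> int) set \<Rightarrow> int list" where
  "Sub c d F =
     (if F = {} \<or> \<not> is_input c d F then [c..d]
      else
        (let P = subcompass_path F; q = last P in
           concat (map (\<lambda>(lo, hi). Sub lo hi (restrict_arcs F lo hi)) (lower_intervals c P))
           @ rev P
           @ (if q + 1 \<le> d then Sub (q + 1) d (restrict_arcs F (q + 1) d) else [])))"
  by pat_completeness auto

termination
proof (relation "Wellfounded.measure (\<lambda>(c, d, F). nat (d - c + 1))", goal_cases)
  case 1
  show ?case by simp
next
  case (2 c d F P q z lo hi)
  then have P: "set P \<subseteq> {c..d}" using subcompass_path(3) by auto
  from 2 have "(lo, hi) \<in> set (lower_intervals c P)" by simp
  then have xy: "(lo - 1, hi + 1) \<in> set (zip ((c - 1) # P) P)" "lo \<le> hi"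
    unfolding lower_intervals_def by auto
  then have "lo - 1 \<in> set ((c - 1) # P)" "hi + 1 \<in> set P" using set_zip_leftD set_zip_rightD by fast+
  then have "c \<le> lo" "hi + 1 \<le> d" using P by fastforce+
  then show ?case using xy(2) by simp
next
  case (3 c d F P q)
  then have "set P \<subseteq> {c..d}" "P \<noteq> []"
    using subcompass_path(1,3) by (auto simp: path_from_def)
  then have "q \<in> {c..d}" using 3(3) last_in_set by blast
  then show ?case using 3(4) by simp
qed

declare Sub.simps [simp del]


section \<open>The construction\<close>

definition label_arcs :: "(int \<Rightarrow> int) \<Rightarrow> (int \<times> int) set \<Rightarrow> (int \<times> int) set" where
  "label_arcs \<phi> E = (\<lambda>(a, b). (\<phi> a, \<phi> b)) ` E"

definition min_label ::
    "int \<Rightarrow> (int \<times> int) set \<Rightarrow> (int \<times> int \<Rightarrow> real \<Rightarrow> complex) \<Rightarrow> complex set \<Rightarrow> int" where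
  "min_label n E D W = Min (compass n E D ` walker_points n W)"

definition max_label ::
    "int \<Rightarrow> (int \<times> int) set \<Rightarrow> (int \<times> int \<Rightarrow> real \<Rightarrow> complex) \<Rightarrow> complex set \<Rightarrow> int" where
  "max_label n E D W = Max (compass n E D ` walker_points n W)"

text \<open>The walker \<open>W\<^sub>i\<close>, named by its minimum compass label \<open>i\<close>.\<close>

definition walker_at ::
    "int \<Rightarrow> (int \<times> int) set \<Rightarrow> (int \<times> int \<Rightarrow> real \<Rightarrow> complex) \<Rightarrow> int \<Rightarrow> complex set" where
  "walker_at n E D i = (THE W. W \<in> walkers n E D \<and> min_label n E D W = i)"

definition Sub_walker ::
    "int \<Rightarrow> (int \<times> int) set \<Rightarrow> (int \<times> int \<Rightarrow> real \<Rightarrow> complex) \<Rightarrow> complex set \<Rightarrow> int list" where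
  "Sub_walker n E D W =
     Sub (min_label n E D W) (max_label n E D W) (label_arcs (compass n E D) (walker_arcs E D W))"

definition Sub_cut_open ::
    "int \<Rightarrow> (int \<times> int) set \<Rightarrow> (int \<times> int \<Rightarrow> real \<Rightarrow> complex) \<Rightarrow> int list" where
  "Sub_cut_open n E D =
     (let m = Min (compass n E D ` {1..n}) in
        Sub m (m + n - 1) (label_arcs (compass n E D) E))"

definition W_wax ::
    "int \<Rightarrow> (int \<times> int) set \<Rightarrow> (int \<times> int \<Rightarrow> real \<Rightarrow> complex) \<Rightarrow> int list" where
  "W_wax n E D =
     (if has_cycle E then
        concat (map (\<lambda>i. Sub_walker n E D (walker_at n E D i))
          (sorted_list_of_set (min_label n E D ` walkers n E D)))
      else Sub_cut_open n E D)"

definition W_wan ::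
    "int \<Rightarrow> (int \<times> int) set \<Rightarrow> (int \<times> int \<Rightarrow> real \<Rightarrow> complex) \<Rightarrow> int list" where
  "W_wan n E D = rev (sorted_list_of_set (compass n E D ` Field (cycle_of E)))"

definition constructed_windows ::
    "int \<Rightarrow> (int \<times> int) set \<Rightarrow> (int \<times> int \<Rightarrow> real \<Rightarrow> complex) \<Rightarrow> window list" where
  "constructed_windows n E D =
     (if has_cycle E then
        (if W_wax n E D = [] then [] else [Wax (W_wax n E D)]) @ [Wan (W_wan n E D)]
      else [Wax (W_wax n E D)])"

definition constructed_tito ::
    "int \<Rightarrow> (int \<times> int) set \<Rightarrow> (int \<times> int \<Rightarrow> real \<Rightarrow> complex) \<Rightarrow> (int \<times> int) set" where
  "constructed_tito n E D =
     (THE R. is_tito n R \<and> window_notation n R (constructed_windows n E D))"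

end

theory Submission
  imports Defs
begin

text \<open>
  Unroll the boundary of the annulus to the integers. An arc diagram \<open>E\<close> becomes a translation
  invariant set of lifted arcs \<open>(x, y)\<close> with \<open>x < y \<le> x + n\<close>, at most one leaving and one entering each
  integer, and a drawing exists if and only if no two of them cross, that is, \<open>x < x' < y < y'\<close> does not
  occur (\<open>drawing_noncrossing\<close>, \<open>drawing_exists\<close>). For the first direction the drawn arcs are lifted
  through \<open>exp\<close> and the Fashoda theorem is applied; for the second they are drawn as nested parabolas.

  For noncrossing arcs, declare \<open>a < b\<close> inverted if the path of arcs starting at \<open>a\<close> reaches or passes
  \<open>b\<close>. Paths are laminar, so this defines a linear order \<open>ord\<close>; it avoids \<open>312\<close> because the points
  passed from \<open>a\<close> form an interval, and its lower walls are exactly the arcs (\<open>lower_wall_ord\<close>).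
  Conversely, the lower walls of a \<open>312\<close>-avoiding TITO are noncrossing (\<open>walls_arc_lift\<close>) and give the
  TITO back as their order (\<open>ord_walls\<close>): if \<open>b\<close> precedes \<open>a < b\<close>, then taking predecessors from \<open>a\<close> climbs
  through lower walls until it reaches or passes \<open>b\<close>. This is the bijection.

  It remains to see that the construction returns \<open>ord\<close>. A cycle exists if and only if some lifted path
  is infinite; the starting points of infinite paths are the lifted cycle vertices, consecutive ones are
  joined by arcs, and the walkers are the gaps between them (\<open>mem_gap_walker\<close>). Points in different
  gaps are not connected in the complement of the cycle, again by the Fashoda theorem applied to
  logarithms. The compass labeling selects the lifts of each gap that start in \<open>{1..n}\<close>; without a cycle it
  selects \<open>{m..m + n - 1}\<close> for the least \<open>m > 0\<close> that no lifted arc passes. The cut at \<open>m\<close> exists because the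
  arcs and the remaining boundary segment carry a continuous branch of the logarithm and so do not
  enclose the origin (\<open>cut_exists\<close>). On these intervals \<open>Sub\<close> sorts by \<open>ord\<close> (\<open>Sub_ok\<close>), so the lists of the
  construction are windows of \<open>ord\<close> (\<open>ord_window_notation\<close>), and a window notation that meets every
  residue class once determines its TITO (\<open>window_notation_unique\<close>).
\<close>

section \<open>The order of a noncrossing set of lifted arcs\<close>

lemma linear_orderD:
  assumes "linear_order R"
  shows "(x, x) \<in> R" "(x, y) \<in> R \<Longrightarrow> (y, z) \<in> R \<Longrightarrow> (x, z) \<in> R"
    "(x, y) \<in> R \<Longrightarrow> (y, x) \<in> R \<Longrightarrow> x = y" "(x, y) \<in> R \<or> (y, x) \<in> R"
proof -
  have R: "refl R" "trans R" "antisym R" "total R"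
    using assms by (auto simp: linear_order_on_def partial_order_on_def preorder_on_def)
  show "(x, x) \<in> R" using R(1) by (simp add: refl_on_def)
  show "(x, y) \<in> R \<Longrightarrow> (y, z) \<in> R \<Longrightarrow> (x, z) \<in> R" using R(2) by (rule transD)
  show "(x, y) \<in> R \<Longrightarrow> (y, x) \<in> R \<Longrightarrow> x = y" using R(3) by (rule antisymD)
  show "(x, y) \<in> R \<or> (y, x) \<in> R"
    using R(1,4) by (cases "x = y") (auto simp: total_on_def refl_on_def)
qed

lemma covered_by_unique_pred:
  assumes "linear_order R" "covered_by R y x" "covered_by R y' x"
  shows "y = y'"
proof -
  have "(y, y') \<in> R \<or> (y', y) \<in> R" by (rule linear_orderD(4)[OF assms(1)])
  then show ?thesis using assms(2,3) unfolding covered_by_def by blast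
qed

text \<open>
  An arc diagram is handled through the set of all integer lifts of its reflection indices.
\<close>

locale arc_lift =
  fixes n :: int and L :: "(int \<times> int) set"
  assumes n_pos: "n > 0"
    and len: "(x, y) \<in> L \<Longrightarrow> x < y \<and> y \<le> x + n"
    and shift1: "(x + n, y + n) \<in> L \<longleftrightarrow> (x, y) \<in> L"
    and out_unique: "(x, y) \<in> L \<Longrightarrow> (x, y') \<in> L \<Longrightarrow> y = y'"
    and in_unique: "(x, y) \<in> L \<Longrightarrow> (x', y) \<in> L \<Longrightarrow> x = x'"
    and nc: "(x, y) \<in> L \<Longrightarrow> (x', y') \<in> L \<Longrightarrow> x < x' \<Longrightarrow> x' < y \<Longrightarrow> y' \<le> y"
begin

text \<open>
  The inversions of the order \<open>ord\<close> are the pairs \<open>a < b\<close> with \<open>over a b\<close>: the path of arcs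
  starting at \<open>a\<close> reaches \<open>b\<close> or jumps over it.
\<close>

definition over :: "int \<Rightarrow> int \<Rightarrow> bool" where
  "over a b \<longleftrightarrow> (\<exists>z. (a, z) \<in> L\<^sup>* \<and> b \<le> z)"

definition ord :: "(int \<times> int) set" where
  "ord = {(a, b). a = b \<or> (a < b \<and> \<not> over a b) \<or> (b < a \<and> over b a)}"

lemma shift: "(x + k * n, y + k * n) \<in> L \<longleftrightarrow> (x, y) \<in> L"
proof (induction k rule: int_induct[where k = 0])
  case (step1 i)
  then show ?case using shift1[of "x + i * n" "y + i * n"] by (simp add: algebra_simps)
next
  case (step2 i)
  then show ?case using shift1[of "x + (i - 1) * n" "y + (i - 1) * n"] by (simp add: algebra_simps)
qed simp

lemma rtrancl_le: "(a, z) \<in> L\<^sup>* \<Longrightarrow> a \<le> z"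
  by (induction rule: rtrancl_induct) (use len in force)+

lemma rtrancl_shift: "(a, z) \<in> L\<^sup>* \<Longrightarrow> (a + k * n, z + k * n) \<in> L\<^sup>*"
  by (induction rule: rtrancl_induct) (auto intro: rtrancl_into_rtrancl simp: shift)

lemma over_shift: "over (a + k * n) (b + k * n) \<longleftrightarrow> over a b"
proof
  show "over (a + k * n) (b + k * n)" if "over a b"
    using that rtrancl_shift[of a _ k] unfolding over_def by (metis add_right_mono)
  show "over a b" if ov: "over (a + k * n) (b + k * n)"
  proof -
    obtain z where z: "(a + k * n, z) \<in> L\<^sup>*" "b + k * n \<le> z"
      using ov unfolding over_def by blast
    have "(a, z - k * n) \<in> L\<^sup>*" using rtrancl_shift[OF z(1), of "- k"] by (simp add: algebra_simps)
    then show ?thesis unfolding over_def using z(2) by (intro exI[of _ "z - k * n"]) auto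
  qed
qed

lemma over_mono: "over a b \<Longrightarrow> b' \<le> b \<Longrightarrow> over a b'"
  by (auto simp: over_def intro: order_trans)

lemma over_arc: "(a, b) \<in> L \<Longrightarrow> over b c \<Longrightarrow> over a c"
  unfolding over_def by (meson converse_rtrancl_into_rtrancl)

lemma over_next:
  assumes "(a, b) \<in> L" "over a c" "a < c"
  shows "over b c"
proof -
  obtain z where z: "(a, z) \<in> L\<^sup>*" "c \<le> z" using assms by (auto simp: over_def)
  then have "a \<noteq> z" using assms(3) by auto
  then obtain b' where "(a, b') \<in> L" "(b', z) \<in> L\<^sup>*" using z(1) by (meson converse_rtranclE)
  then show ?thesis using out_unique[OF assms(1)] z(2) by (auto simp: over_def)
qed

text \<open>
  A path that starts strictly below an arc stays there: it cannot jump over the head by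
  noncrossing, and cannot land on the head, which has only one incoming arc.
\<close>

lemma under_arc:
  assumes "(x, y) \<in> L" "x < u" "u < y" "(u, v) \<in> L\<^sup>*"
  shows "v < y"
  using assms(4)
proof (induction rule: rtrancl_induct)
  case base
  show ?case by (rule assms(3))
next
  case (step v w)
  have "x < v" using assms(2) rtrancl_le[OF step(1)] by simp
  then have "w \<le> y" using nc[OF assms(1) step(2)] step(3) by simp
  moreover have "w \<noteq> y" using in_unique[OF assms(1)] step(2) \<open>x < v\<close> by force
  ultimately show ?case by simp
qed

lemma not_over_under: "(x, y) \<in> L \<Longrightarrow> x < u \<Longrightarrow> u < y \<Longrightarrow> \<not> over u y"
  using under_arc unfolding over_def by (meson linorder_not_le)

text \<open>
  Paths are laminar: a point \<open>b\<close> passed by the path of \<open>a\<close> either lies on this path or strictly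
  under one of its arcs, and in the second case its own path stays under that arc.
\<close>

lemma over_trans:
  assumes "over a b" "a < b" "over b c"
  shows "over a c"
proof -
  obtain z where z: "(a, z) \<in> L\<^sup>*" "b \<le> z" using assms(1) by (auto simp: over_def)
  from z(1) assms(2) show ?thesis
  proof (induction rule: converse_rtrancl_induct)
    case base
    then show ?case using z(2) by simp
  next
    case (step a a')
    show ?case
    proof (cases "a' < b")
      case True
      then show ?thesis using step by (blast intro: over_arc)
    next
      case False
      show ?thesis
      proof (cases "a' = b")
        case True
        then show ?thesis using step assms(3) by (blast intro: over_arc)
      next
        case neq: False
        then have "c \<le> a'"
          using under_arc[OF step(1), of b] step(4) False assms(3) by (force simp: over_def)
        then show ?thesis using step(1) by (auto simp: over_def)
      qed
    qed
  qed
qed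

text \<open>
  A set of inversions defines a linear order if it and its complement are transitive. The first
  is laminarity; the second holds since \<open>over\<close> is downward closed in its second argument.
\<close>

lemma ord_linear: "linear_order ord"
proof -
  have "trans ord"
  proof (rule transI)
    fix a b c assume ab: "(a, b) \<in> ord" and bc: "(b, c) \<in> ord"
    consider "a = b \<or> b = c" | "a < b" "b < c" | "b < a" "c < b" | "a < b" "c < b" | "b < a" "b < c"
      by linarith
    then show "(a, c) \<in> ord"
    proof cases
      case 1
      then show ?thesis using ab bc by auto
    next
      case 2
      then have "\<not> over a b" using ab by (auto simp: ord_def)
      then show ?thesis using 2 over_mono[of a c b] by (auto simp: ord_def)
    next
      case 3
      then have "over b a" "over c b" using ab bc by (auto simp: ord_def)
      then show ?thesis using 3 over_trans[of c b a] by (auto simp: ord_def)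
    next
      case 4
      then have h: "\<not> over a b" "over c b" using ab bc by (auto simp: ord_def)
      consider "a < c" | "a = c" | "c < a" by linarith
      then show ?thesis
      proof cases
        case 1
        then show ?thesis using h over_trans[of a c b] by (auto simp: ord_def)
      next
        case 3
        then show ?thesis using h over_mono[of c b a] 4 by (auto simp: ord_def)
      qed (auto simp: ord_def)
    next
      case 5
      then have h: "over b a" "\<not> over b c" using ab bc by (auto simp: ord_def)
      consider "a < c" | "a = c" | "c < a" by linarith
      then show ?thesis
      proof cases
        case 1
        then show ?thesis using h over_trans[of b a c] 5 by (auto simp: ord_def)
      next
        case 3
        then show ?thesis using h over_mono[of b a c] by (auto simp: ord_def)
      qed (auto simp: ord_def)
    qed
  qed
  moreover have "refl ord" by (auto simp: refl_on_def ord_def)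
  moreover have "antisym ord" by (auto simp: antisym_def ord_def)
  moreover have "total ord" by (auto simp: total_on_def ord_def)
  ultimately show ?thesis
    by (simp add: linear_order_on_def partial_order_on_def preorder_on_def)
qed

lemma ord_tito: "is_tito n ord"
  using ord_linear over_shift[of _ 1] by (auto simp: is_tito_def ord_def)

text \<open>
  If \<open>c\<close> precedes \<open>a < c\<close>, the path of \<open>a\<close> reaches \<open>c\<close> and so passes every \<open>b\<close> in between.
\<close>

lemma ord_avoids: "avoids_312 ord"
proof -
  have False if "a < b" "b < c" "(c, a) \<in> ord" "(a, b) \<in> ord" for a b c
    using that over_mono[of a c b] by (auto simp: ord_def)
  then show ?thesis unfolding avoids_312_def by blast
qed

lemma arc_covered:
  assumes "(x, y) \<in> L"
  shows "covered_by ord y x"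
proof -
  have xy: "x < y" using len[OF assms] by simp
  have ov: "over x y" using assms by (auto simp: over_def)
  have "z = y \<or> z = x" if "(y, z) \<in> ord" "(z, x) \<in> ord" for z
  proof (rule ccontr)
    assume ne: "\<not> (z = y \<or> z = x)"
    consider "z < x" | "x < z" "z < y" | "y < z" using ne by linarith
    then show False
    proof cases
      case 1
      then show False using that xy over_mono[of z y x] by (auto simp: ord_def)
    next
      case 2
      then show False using that not_over_under[OF assms] by (auto simp: ord_def)
    next
      case 3
      then show False using that xy over_next[OF assms] by (auto simp: ord_def)
    qed
  qed
  moreover have "(y, x) \<in> ord" "y \<noteq> x" using xy ov by (auto simp: ord_def)
  ultimately show ?thesis unfolding covered_by_def by blast
qed

text \<open>
  If \<open>y\<close> is inverted with \<open>x < y\<close>, then \<open>x\<close> has an outgoing arc, and its head is the predecessor of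
  \<open>x\<close>. As predecessors are unique, there are no lower walls besides the arcs.
\<close>

lemma lower_wall_ord: "lower_wall ord x y \<longleftrightarrow> (x, y) \<in> L"
proof
  assume L: "(x, y) \<in> L"
  have cov: "covered_by ord y x" using arc_covered[OF L] .
  then have "(y, x) \<in> ord" unfolding covered_by_def by blast
  with cov show "lower_wall ord x y"
    using len[OF L] unfolding lower_wall_def by blast
next
  assume w: "lower_wall ord x y"
  then have xy: "x < y" and yx: "(y, x) \<in> ord" unfolding lower_wall_def by blast+
  have "(x, y) \<notin> ord" using xy yx by (auto simp: ord_def)
  then have "\<not> covered_by ord x y" unfolding covered_by_def by blast
  then have cov: "covered_by ord y x" using w unfolding lower_wall_def by blast
  have "over x y" using xy yx by (simp add: ord_def)
  then obtain z where z: "(x, z) \<in> L\<^sup>*" "y \<le> z" unfolding over_def by blast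
  then have "x \<noteq> z" using xy by simp
  then obtain y' where y': "(x, y') \<in> L" using z(1) by (meson converse_rtranclE)
  then show "(x, y) \<in> L"
    using covered_by_unique_pred[OF ord_linear cov arc_covered[OF y']] by simp
qed

end

section \<open>Lower walls determine a 312-avoiding TITO\<close>

lemma tito_linear: "is_tito s R \<Longrightarrow> linear_order R"
  by (simp add: is_tito_def)

lemmas titoD = linear_orderD[OF tito_linear]

lemma tito_shift:
  assumes "is_tito s R"
  shows "(a + k * s, b + k * s) \<in> R \<longleftrightarrow> (a, b) \<in> R"
proof -
  have sh: "(a + s, b + s) \<in> R \<longleftrightarrow> (a, b) \<in> R" for a b using assms unfolding is_tito_def by blast
  show ?thesis
  proof (induction k rule: int_induct[where k = 0])
    case (step1 i)
    then show ?case using sh[of "a + i * s" "b + i * s"] by (simp add: algebra_simps)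
  next
    case (step2 i)
    then show ?case using sh[of "a + (i - 1) * s" "b + (i - 1) * s"] by (simp add: algebra_simps)
  qed simp
qed

lemma tito_uminus:
  assumes "is_tito s R"
  shows "is_tito (- s) R"
  using tito_shift[OF assms, of _ "-1"] tito_linear[OF assms] by (simp add: is_tito_def)

lemma tito_chain:
  assumes "is_tito s R" "(x, x + s) \<in> R" "j \<le> j'"
  shows "(x + j * s, x + j' * s) \<in> R"
  using assms(3)
proof (induction rule: int_ge_induct)
  case base
  show ?case by (rule titoD(1)[OF assms(1)])
next
  case (step i)
  have "(x + i * s, x + (i + 1) * s) \<in> R"
    using tito_shift[OF assms(1), of x i "x + s"] assms(2) by (simp add: algebra_simps)
  then show ?case using step titoD(2)[OF assms(1)] by blast
qed

lemma linear_order_has_max: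
  assumes "linear_order R" "finite M" "M \<noteq> {}"
  shows "\<exists>m\<in>M. \<forall>x\<in>M. (x, m) \<in> R"
  using assms(2,3)
proof (induction rule: finite_ne_induct)
  case (singleton x)
  then show ?case using linear_orderD(1)[OF assms(1)] by simp
next
  case (insert x F)
  then obtain m where m: "m \<in> F" "\<forall>y\<in>F. (y, m) \<in> R" by blast
  show ?case
  proof (cases "(x, m) \<in> R")
    case True
    then show ?thesis using m by auto
  next
    case False
    then have "(m, x) \<in> R" using linear_orderD(4)[OF assms(1)] by blast
    then have "\<forall>y\<in>insert x F. (y, x) \<in> R"
      using m linear_orderD(1,2)[OF assms(1)] by blast
    then show ?thesis by blast
  qed
qed

text \<open>
  Every element \<open>a\<close> has a predecessor: one of its two translates \<open>a \<plusminus> n\<close> lies below it, and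
  the half-open interval between the translate and \<open>a\<close> meets every residue class at most
  once, so it is finite.
\<close>

lemma tito_has_pred:
  assumes "is_tito n R" "n > 0"
  shows "\<exists>z. covered_by R z a"
proof -
  have lin: "linear_order R" by (rule tito_linear[OF assms(1)])
  note R = linear_orderD[OF lin]
  obtain d where d: "is_tito d R" "(a - d, a) \<in> R" "\<bar>d\<bar> = n"
  proof (cases "(a - n, a) \<in> R")
    case True
    then show ?thesis using that[of n] assms by simp
  next
    case False
    then have "(a, a - n) \<in> R" using R(4) by blast
    then have "(a + n, a) \<in> R" using tito_shift[OF assms(1), of a 1 "a - n"] by simp
    then show ?thesis using that[of "- n"] assms tito_uminus by simp
  qed
  have step: "(x, x + d) \<in> R" if "(a - d, x) \<in> R" "(x, a) \<in> R" for x
  proof -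
    have "(a, x + d) \<in> R" using tito_shift[OF d(1), of "a - d" 1 x] that(1) by simp
    then show ?thesis using that(2) R(2) by blast
  qed
  define M where "M = {z. (a - d, z) \<in> R \<and> (z, a) \<in> R \<and> z \<noteq> a}"
  have *: "x = y" if x: "x \<in> M" and y: "y \<in> M" and xy: "(x, y) \<in> R" and eq: "x mod n = y mod n" for x y
  proof -
    have "n dvd y - x" using eq by (metis mod_eq_dvd_iff)
    then have "d dvd y - x" using d(3) by (metis abs_dvd_iff)
    then obtain j where j: "y = x + j * d" by (metis dvdE mult.commute diff_add_cancel add.commute)
    have st: "(x, x + d) \<in> R" using x step unfolding M_def by blast
    have ax: "(a, x + d) \<in> R"
      using x tito_shift[OF d(1), of "a - d" 1 x] unfolding M_def by simp
    show ?thesis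
    proof (cases "j \<ge> 1")
      case True
      then have "(x + d, y) \<in> R" using tito_chain[OF d(1) st, of 1 j] j by simp
      then have "(a, y) \<in> R" using ax R(2) by blast
      then have "y = a" using y R(3) unfolding M_def by blast
      then show ?thesis using y unfolding M_def by simp
    next
      case False
      then have "(y, x) \<in> R" using tito_chain[OF d(1) st, of j 0] j by simp
      then show ?thesis using xy R(3) by blast
    qed
  qed
  have "inj_on (\<lambda>z. z mod n) M"
    using * R(4) by (intro inj_onI) metis
  moreover have "(\<lambda>z. z mod n) ` M \<subseteq> {0..<n}" using assms(2) by auto
  ultimately have "finite M" by (meson finite_atLeastLessThan_int inj_on_finite)
  moreover have "a - d \<in> M" unfolding M_def using d assms(2) R(1) by auto
  ultimately obtain m where m: "m \<in> M" "\<forall>x\<in>M. (x, m) \<in> R"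
    using linear_order_has_max[OF lin] by blast
  have "z = m \<or> z = a" if "(m, z) \<in> R" "(z, a) \<in> R" for z
  proof (rule ccontr)
    assume ne: "\<not> (z = m \<or> z = a)"
    have "(a - d, z) \<in> R" using m(1) that(1) R(2) unfolding M_def by blast
    then have "z \<in> M" using that ne unfolding M_def by blast
    then show False using m(2) that(1) R(3) ne by blast
  qed
  then have "covered_by R m a" using m(1) unfolding covered_by_def M_def by blast
  then show ?thesis ..
qed

definition walls :: "(int \<times> int) set \<Rightarrow> (int \<times> int) set" where
  "walls R = {(x, y). lower_wall R x y}"

lemma mem_walls:
  assumes "linear_order R"
  shows "(x, y) \<in> walls R \<longleftrightarrow> x < y \<and> covered_by R y x"
proof -
  have "\<not> covered_by R x y" if "(y, x) \<in> R"
    using that linear_orderD(3)[OF assms] unfolding covered_by_def by blast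
  moreover have "(y, x) \<in> R" if "covered_by R y x" using that unfolding covered_by_def by blast
  ultimately show ?thesis unfolding walls_def lower_wall_def by blast
qed

lemma tito_covered_by_shift:
  assumes "is_tito s R"
  shows "covered_by R (x + k * s) (y + k * s) \<longleftrightarrow> covered_by R x y"
proof -
  have "covered_by R (x + k * s) (y + k * s)" if "covered_by R x y" for x y k
    unfolding covered_by_def
  proof (intro conjI allI impI)
    show "(x + k * s, y + k * s) \<in> R" "x + k * s \<noteq> y + k * s"
      using that tito_shift[OF assms] unfolding covered_by_def by auto
    fix z assume z: "(x + k * s, z) \<in> R \<and> (z, y + k * s) \<in> R"
    have "(x, z - k * s) \<in> R" "(z - k * s, y) \<in> R"
      using z tito_shift[OF assms, of x k "z - k * s"] tito_shift[OF assms, of "z - k * s" k y] by auto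
    then have "z - k * s = x \<or> z - k * s = y" using that unfolding covered_by_def by blast
    then show "z = x + k * s \<or> z = y + k * s" by auto
  qed
  from this[of x y k] this[of "x + k * s" "y + k * s" "- k"] show ?thesis by auto
qed

lemma covered_by_unique_succ:
  assumes "linear_order R" "covered_by R x y" "covered_by R x y'"
  shows "y = y'"
proof -
  have "(y, y') \<in> R \<or> (y', y) \<in> R" by (rule linear_orderD(4)[OF assms(1)])
  then show ?thesis using assms(2,3) unfolding covered_by_def by blast
qed

context
  fixes n :: int and R :: "(int \<times> int) set"
  assumes n_pos: "n > 0" and tito: "is_tito n R" and avoids: "avoids_312 R"
begin

lemma avoid: "a < b \<Longrightarrow> b < c \<Longrightarrow> (c, a) \<in> R \<Longrightarrow> (b, a) \<in> R"
  using avoids titoD(4)[OF tito, of a b] unfolding avoids_312_def by blast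

text \<open>
  A lower wall cannot reach further than one full turn: if \<open>x + n < y\<close> and \<open>y\<close> is the
  predecessor of \<open>x\<close>, the translates of \<open>x\<close> and \<open>y\<close> are forced to interleave in a \<open>312\<close> pattern.
\<close>

lemma wall_len:
  assumes "(x, y) \<in> walls R"
  shows "y \<le> x + n"
proof (rule ccontr)
  assume gt: "\<not> y \<le> x + n"
  note R = titoD[OF tito]
  have xy: "x < y" "covered_by R y x" using assms mem_walls[OF tito_linear[OF tito]] by auto
  then have yx: "(y, x) \<in> R" "y \<noteq> x" unfolding covered_by_def by blast+
  have wan: "(x + n, x) \<in> R" using avoid[of x "x + n" y] gt n_pos yx by simp
  have "(x + n, y) \<in> R"
  proof (rule ccontr)
    assume "(x + n, y) \<notin> R"
    then have "(y, x + n) \<in> R" using R(4) by blast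
    then have "x + n = y \<or> x + n = x" using wan xy unfolding covered_by_def by blast
    then show False using gt n_pos by auto
  qed
  moreover have "(y + n, x + n) \<in> R" using yx tito_shift[OF tito, of y 1 x] by simp
  ultimately have "(y, x + n) \<in> R" using avoid[of "x + n" y "y + n"] gt n_pos by simp
  then show False using \<open>(x + n, y) \<in> R\<close> R(3) gt by force
qed

text \<open>
  Noncrossing: if \<open>x < x' < y < y'\<close> with lower walls \<open>(x, y)\<close> and \<open>(x', y')\<close>, then avoidance for
  \<open>x, x', y\<close> puts \<open>x'\<close> before \<open>x\<close>, hence before its predecessor \<open>y\<close>; avoidance for \<open>x', y, y'\<close> puts
  \<open>y\<close> before \<open>x'\<close>.
\<close>

lemma walls_arc_lift: "arc_lift n (walls R)"
proof -
  note R = titoD[OF tito] and lin = tito_linear[OF tito]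
  note mem = mem_walls[OF lin]
  show ?thesis
  proof
    show "n > 0" by (rule n_pos)
    show "x < y \<and> y \<le> x + n" if "(x, y) \<in> walls R" for x y
      using that wall_len mem by blast
    show "(x + n, y + n) \<in> walls R \<longleftrightarrow> (x, y) \<in> walls R" for x y
      using tito_covered_by_shift[OF tito, of y 1 x] by (simp add: mem)
    show "y = y'" if "(x, y) \<in> walls R" "(x, y') \<in> walls R" for x y y'
      using that covered_by_unique_pred[OF lin] by (auto simp: mem)
    show "x = x'" if "(x, y) \<in> walls R" "(x', y) \<in> walls R" for x x' y
      using that covered_by_unique_succ[OF lin] by (auto simp: mem)
    show "y' \<le> y" if w: "(x, y) \<in> walls R" "(x', y') \<in> walls R" "x < x'" "x' < y" for x y x' y'
    proof (rule ccontr)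
      assume gt: "\<not> y' \<le> y"
      have c: "covered_by R y x" "covered_by R y' x'" using w mem by auto
      then have yx: "(y, x) \<in> R" "(y', x') \<in> R" unfolding covered_by_def by blast+
      have "(x', x) \<in> R" using avoid[OF w(3,4) yx(1)] .
      then have "\<not> (y, x') \<in> R" using c(1) w(3,4) unfolding covered_by_def by force
      then have "(x', y) \<in> R" using R(4) by blast
      moreover have "(y, x') \<in> R" using avoid[OF w(4) _ yx(2)] gt by simp
      ultimately show False using \<open>\<not> (y, x') \<in> R\<close> by simp
    qed
  qed
qed

interpretation W: arc_lift n "walls R" by (rule walls_arc_lift)

text \<open>
  If \<open>b\<close> precedes \<open>a < b\<close>, the predecessor \<open>z\<close> of \<open>a\<close> exceeds \<open>a\<close>, as \<open>b, z, a\<close> would otherwise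
  be a \<open>312\<close> pattern. So \<open>(a, z)\<close> is a lower wall, and iterating climbs past \<open>b\<close>.
\<close>

lemma inversion_imp_over: "a < b \<Longrightarrow> (b, a) \<in> R \<Longrightarrow> W.over a b"
proof (induction "nat (b - a)" arbitrary: a rule: less_induct)
  case less
  note R = titoD[OF tito]
  obtain z where z: "covered_by R z a" using tito_has_pred[OF tito n_pos] by blast
  then have za: "(z, a) \<in> R" "z \<noteq> a" unfolding covered_by_def by blast+
  have bz: "(b, z) \<in> R"
    using z less(2,3) R(4)[of b z] unfolding covered_by_def by blast
  have "\<not> z < a"
  proof
    assume "z < a"
    then have "(a, z) \<in> R" using avoid[OF _ less(2) bz] by simp
    then show False using za R(3) by blast
  qed
  then have wall: "(a, z) \<in> walls R" using z za mem_walls[OF tito_linear[OF tito]] by auto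
  show ?case
  proof (cases "b \<le> z")
    case True
    then show ?thesis using wall unfolding W.over_def by blast
  next
    case False
    then have "W.over z b" using less(1)[of z] bz \<open>\<not> z < a\<close> za(2) by simp
    then show ?thesis using W.over_arc[OF wall] by blast
  qed
qed

text \<open>
  On a descending chain of lower walls from \<open>a\<close> past \<open>b\<close>, the wall \<open>(u, v)\<close> with \<open>u < b \<le> v\<close>
  forces \<open>b\<close> before \<open>u\<close> by avoidance.
\<close>

lemma over_imp_inversion:
  assumes "W.over a b" "a < b"
  shows "(b, a) \<in> R"
proof -
  obtain z where z: "(a, z) \<in> (walls R)\<^sup>*" "b \<le> z" using assms unfolding W.over_def by blast
  from z(1) assms(2) show ?thesis
  proof (induction rule: converse_rtrancl_induct)
    case base
    then show ?case using z(2) by simp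
  next
    case (step a a')
    have w: "(a', a) \<in> R"
      using step(1) mem_walls[OF tito_linear[OF tito]] unfolding covered_by_def by blast
    consider "b < a'" | "b = a'" | "a' < b" by linarith
    then show ?case
    proof cases
      case 1
      then show ?thesis using avoid[OF step(4) _ w] by simp
    next
      case 3
      then show ?thesis using step w titoD(2)[OF tito] by blast
    qed (use w in simp)
  qed
qed

lemma ord_walls: "W.ord = R"
proof (intro set_eqI, clarify)
  fix a b :: int
  note R = titoD[OF tito]
  consider "a = b" | "a < b" | "b < a" by linarith
  then show "(a, b) \<in> W.ord \<longleftrightarrow> (a, b) \<in> R"
  proof cases
    case 1
    then show ?thesis using R(1) by (simp add: W.ord_def)
  next
    case 2
    then have "(b, a) \<in> R \<longleftrightarrow> W.over a b" using over_imp_inversion inversion_imp_over by blast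
    moreover have "(a, b) \<in> R \<longleftrightarrow> (b, a) \<notin> R" using 2 R(3,4) by (metis less_irrefl)
    ultimately show ?thesis using 2 by (simp add: W.ord_def)
  next
    case 3
    then have "(a, b) \<in> R \<longleftrightarrow> W.over b a" using over_imp_inversion inversion_imp_over by blast
    then show ?thesis using 3 by (simp add: W.ord_def)
  qed
qed

end

section \<open>Lifting an arc diagram to the integers\<close>

definition lift :: "int \<Rightarrow> (int \<times> int) set \<Rightarrow> (int \<times> int) set" where
  "lift n E = {(x, y). \<exists>(a, b)\<in>E. \<exists>k. x = a + k * n \<and> y = arc_end n a b + k * n}"

lemma liftI: "(a, b) \<in> E \<Longrightarrow> (a + k * n, arc_end n a b + k * n) \<in> lift n E"
  unfolding lift_def by blast

lemma liftE:
  assumes "(x, y) \<in> lift n E"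
  obtains a b k where "(a, b) \<in> E" "x = a + k * n" "y = arc_end n a b + k * n"
  using assms unfolding lift_def by blast

lemma lift_shift: "(x + k * n, y + k * n) \<in> lift n E \<longleftrightarrow> (x, y) \<in> lift n E"
proof -
  have "(x + k * n, y + k * n) \<in> lift n E" if xy: "(x, y) \<in> lift n E" for x y k
  proof -
    obtain a b l where "(a, b) \<in> E" "x = a + l * n" "y = arc_end n a b + l * n"
      using xy by (rule liftE)
    then show ?thesis using liftI[of a b E "l + k" n] by (simp add: algebra_simps)
  qed
  from this[of x y k] this[of "x + k * n" "y + k * n" "- k"] show ?thesis by auto
qed

lemma shifted_range_unique:
  fixes n :: int
  assumes "a + k * n = b + l * n" "a \<in> {c..<c + n}" "b \<in> {c..<c + n}"
  shows "k = l \<and> a = b"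
proof -
  have n: "n > 0" using assms(2) by auto
  have "(k - l) * n = b - a" using assms(1) by (simp add: algebra_simps)
  then have "(k - l) * n < 1 * n" "(-1) * n < (k - l) * n" using assms(2,3) by auto
  then have "k - l < 1" "-1 < k - l" using n mult_less_cancel_right_pos by blast+
  then have "k = l" by simp
  then show ?thesis using assms(1) by simp
qed

lemma shifted_range_unique0:
  fixes n :: int
  assumes "a = b + l * n" "a \<in> {c..<c + n}" "b \<in> {c..<c + n}"
  shows "l = 0 \<and> a = b"
  using shifted_range_unique[of a 0 n b l c] assms by simp

lemma shift_into_range:
  fixes n :: int
  assumes "n > 0"
  obtains k r where "x = r + k * n" "r \<in> {c..<c + n}"
proof
  show "x = (c + (x - c) mod n) + ((x - c) div n) * n" by (simp add: algebra_simps)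
  show "c + (x - c) mod n \<in> {c..<c + n}" using assms by simp
qed

lemma mem_lift_base:
  assumes "E \<subseteq> {1..n} \<times> {1..n}" "a \<in> {1..n}"
  shows "(a, y) \<in> lift n E \<longleftrightarrow> (\<exists>b. (a, b) \<in> E \<and> y = arc_end n a b)"
proof
  assume "(a, y) \<in> lift n E"
  then obtain a' b k where h: "(a', b) \<in> E" "a = a' + k * n" "y = arc_end n a' b + k * n"
    by (rule liftE)
  then have "k = 0 \<and> a = a'"
    by (intro shifted_range_unique0[of a a' k n 1]) (use assms in auto)
  then show "\<exists>b. (a, b) \<in> E \<and> y = arc_end n a b" using h by auto
next
  assume "\<exists>b. (a, b) \<in> E \<and> y = arc_end n a b"
  then show "(a, y) \<in> lift n E" using liftI[of a _ E 0 n] by auto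
qed

lemma lift_arc_end_iff:
  assumes "E \<subseteq> {1..n} \<times> {1..n}" "a \<in> {1..n}" "b \<in> {1..n}"
  shows "(a, arc_end n a b) \<in> lift n E \<longleftrightarrow> (a, b) \<in> E"
  using assms mem_lift_base[OF assms(1,2), of "arc_end n a b"]
  by (fastforce simp: arc_end_def split: if_splits)

lemma arc_diagram_walls:
  assumes "walls R = lift n E" "E \<subseteq> {1..n} \<times> {1..n}"
  shows "arc_diagram n R = E"
proof -
  have w: "lower_wall R x y \<longleftrightarrow> (x, y) \<in> lift n E" for x y
    using assms(1) unfolding walls_def by auto
  have "(a, b) \<in> arc_diagram n R \<longleftrightarrow> (a, b) \<in> E" for a b
  proof (cases "a \<in> {1..n} \<and> b \<in> {1..n}")
    case True
    then have "a \<in> {1..n}" by simp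
    note m = mem_lift_base[OF assms(2) this]
    have "(a, b) \<in> arc_diagram n R \<longleftrightarrow> (a, b) \<in> lift n E \<or> (a, b + n) \<in> lift n E"
      using True by (simp add: arc_diagram_def w)
    also have "\<dots> \<longleftrightarrow> (a, b) \<in> E"
    proof -
      have rng: "1 \<le> b' \<and> b' \<le> n" if "(a, b') \<in> E" for b' using that assms(2) by auto
      show ?thesis
      proof
        assume "(a, b) \<in> lift n E \<or> (a, b + n) \<in> lift n E"
        then obtain b' where "(a, b') \<in> E" "b = arc_end n a b' \<or> b + n = arc_end n a b'"
          unfolding m by blast
        then have "b' = b" using rng[of b'] True by (auto simp: arc_end_def split: if_splits)
        then show "(a, b) \<in> E" using \<open>(a, b') \<in> E\<close> by simp
      next
        assume "(a, b) \<in> E"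
        moreover have "arc_end n a b = b \<or> arc_end n a b = b + n" by (simp add: arc_end_def)
        ultimately show "(a, b) \<in> lift n E \<or> (a, b + n) \<in> lift n E" unfolding m by metis
      qed
    qed
    finally show ?thesis .
  next
    case False
    then show ?thesis using assms(2) by (auto simp: arc_diagram_def)
  qed
  then show ?thesis by auto
qed

lemma lift_arc_diagram:
  assumes "n > 0" "is_tito n R" "avoids_312 R"
  shows "lift n (arc_diagram n R) = walls R"
proof -
  interpret W: arc_lift n "walls R" by (rule walls_arc_lift[OF assms])
  have w: "lower_wall R x y \<longleftrightarrow> (x, y) \<in> walls R" for x y unfolding walls_def by simp
  have sub: "arc_diagram n R \<subseteq> {1..n} \<times> {1..n}" by (auto simp: arc_diagram_def)
  have base: "(a, y) \<in> lift n (arc_diagram n R) \<longleftrightarrow> (a, y) \<in> walls R" if a: "a \<in> {1..n}" for a y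
  proof
    assume "(a, y) \<in> lift n (arc_diagram n R)"
    then obtain b where b: "(a, b) \<in> arc_diagram n R" "y = arc_end n a b"
      using mem_lift_base[OF sub a] by blast
    show "(a, y) \<in> walls R"
    proof (cases "a < b")
      case True
      then have "(a, b + n) \<notin> walls R" using W.len[of a "b + n"] by auto
      then show ?thesis using b True by (auto simp: arc_diagram_def w arc_end_def)
    next
      case False
      then have "(a, b) \<notin> walls R" using W.len[of a "b"] by auto
      then show ?thesis using b False by (auto simp: arc_diagram_def w arc_end_def)
    qed
  next
    assume y: "(a, y) \<in> walls R"
    note l = W.len[OF y]
    define b where "b = (if y \<le> n then y else y - n)"
    have "(a, b) \<in> arc_diagram n R" "y = arc_end n a b"
      using y l a by (auto simp: arc_diagram_def w b_def arc_end_def)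
    then show "(a, y) \<in> lift n (arc_diagram n R)"
      using mem_lift_base[OF sub a] by blast
  qed
  have "(x, y) \<in> lift n (arc_diagram n R) \<longleftrightarrow> (x, y) \<in> walls R" for x y
  proof -
    obtain k r where r: "x = r + k * n" "r \<in> {1..<1 + n}" using shift_into_range[OF assms(1)] .
    have r': "r \<in> {1..n}" using r(2) by simp
    show ?thesis
      using base[OF r', of "y - k * n"] lift_shift[of r k n "y - k * n"] W.shift[of r k "y - k * n"] r(1) by simp
  qed
  then show ?thesis by auto
qed

lemma arc_lift_single_valued:
  assumes "arc_lift n (lift n E)" "E \<subseteq> {1..n} \<times> {1..n}"
  shows "single_valued E" "single_valued (E\<inverse>)"
proof -
  interpret arc_lift n "lift n E" by (rule assms)
  show "single_valued E"
  proof (rule single_valuedI)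
    fix a b b' assume ab: "(a, b) \<in> E" "(a, b') \<in> E"
    then have "arc_end n a b = arc_end n a b'"
      using out_unique[of a "arc_end n a b" "arc_end n a b'"] liftI[OF ab(1), of 0 n]
        liftI[OF ab(2), of 0 n] by simp
    moreover have "b \<in> {1..n}" "b' \<in> {1..n}" using ab assms(2) by auto
    ultimately show "b = b'" by (auto simp: arc_end_def split: if_splits)
  qed
  show "single_valued (E\<inverse>)"
  proof (rule single_valuedI)
    fix b a a' assume ab: "(b, a) \<in> E\<inverse>" "(b, a') \<in> E\<inverse>"
    define j where "j = (arc_end n a' b - arc_end n a b) div n"
    have j: "arc_end n a b + j * n = arc_end n a' b"
      using n_pos by (auto simp: j_def arc_end_def)
    have "(a + j * n, arc_end n a' b) \<in> lift n E" using liftI[of a b E j n] ab j by simp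
    moreover have "(a', arc_end n a' b) \<in> lift n E" using liftI[of a' b E 0 n] ab by simp
    ultimately have "a' = a + j * n" using in_unique by simp
    then have "j = 0 \<and> a' = a"
      by (rule shifted_range_unique0[where c = 1]) (use ab assms(2) in auto)
    then show "a = a'" by simp
  qed
qed

section \<open>Cycle vertices and the gaps between them\<close>

context arc_lift
begin

text \<open>
  The lifts of the vertices on the cycle are exactly the starting points of infinite paths: arcs
  have at most one successor and one predecessor, so an infinite path is periodic modulo \<open>n\<close>.
\<close>

definition Cyc :: "int set" where
  "Cyc = {x. \<forall>b. over x b}"

lemma Cyc_shift: "x + k * n \<in> Cyc \<longleftrightarrow> x \<in> Cyc"
proof -
  have "x + k * n \<in> Cyc" if "x \<in> Cyc" for x k
  proof -
    have "over (x + k * n) b" for b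
      using that over_shift[of x k "b - k * n"] unfolding Cyc_def by simp
    then show ?thesis unfolding Cyc_def by blast
  qed
  from this[of x k] this[of "x + k * n" "- k"] show ?thesis by auto
qed

lemma Cyc_arc: "(x, y) \<in> L \<Longrightarrow> x \<in> Cyc \<longleftrightarrow> y \<in> Cyc"
  unfolding Cyc_def mem_Collect_eq
  by (metis over_arc over_next over_mono linorder_le_less_linear less_add_one order_le_less_trans less_imp_le)

lemma Cyc_next:
  assumes "x \<in> Cyc"
  obtains y where "(x, y) \<in> L" "y \<in> Cyc"
proof -
  obtain z where "(x, z) \<in> L\<^sup>*" "x + 1 \<le> z" using assms unfolding Cyc_def over_def by blast
  then obtain y where "(x, y) \<in> L" by (metis converse_rtranclE not_less zless_add1_eq)
  then show thesis using that Cyc_arc assms by blast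
qed

lemma not_Cyc_under: "(x, y) \<in> L \<Longrightarrow> x < u \<Longrightarrow> u < y \<Longrightarrow> u \<notin> Cyc"
  using not_over_under unfolding Cyc_def by blast

lemma Cyc_between:
  assumes "(x, y) \<in> L" "c \<in> Cyc" "x < c"
  shows "y \<le> c"
  using not_Cyc_under[OF assms(1,3)] assms(2) by force

text \<open>
  Consecutive elements of \<open>Cyc\<close> are joined by arcs: the arc leaving \<open>c \<in> Cyc\<close> skips no element
  of \<open>Cyc\<close>, because paths that start under an arc stay under it.
\<close>

lemma Cyc_connected:
  assumes "c \<in> Cyc" "d \<in> Cyc" "c \<le> d"
  shows "(c, d) \<in> L\<^sup>*"
  using assms
proof (induction "nat (d - c)" arbitrary: c rule: less_induct)
  case less
  show ?case
  proof (cases "c = d")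
    case False
    obtain y where y: "(c, y) \<in> L" "y \<in> Cyc" using Cyc_next less(2) by blast
    then have "y \<le> d" using Cyc_between less False by auto
    then have "(y, d) \<in> L\<^sup>*" using less(1)[of y] y len[OF y(1)] less(3) by auto
    then show ?thesis using y(1) by auto
  qed simp
qed

lemma Cyc_below:
  assumes "Cyc \<noteq> {}" "u \<notin> Cyc"
  obtains x y where "(x, y) \<in> L" "x \<in> Cyc" "y \<in> Cyc" "x < u" "u < y"
proof -
  obtain c where c: "c \<in> Cyc" using assms by blast
  obtain k r where r: "c = r + k * n" "r \<in> {u - n..<(u - n) + n}"
    using shift_into_range[OF n_pos] .
  have ex: "r \<in> Cyc" "r < u" using r c Cyc_shift by auto
  define x where "x = Max (Cyc \<inter> {r..u})"
  have fin: "finite (Cyc \<inter> {r..u})" by simp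
  have "x \<in> Cyc \<inter> {r..u}" unfolding x_def by (rule Max_in[OF fin]) (use ex in auto)
  then have x: "x \<in> Cyc" "x < u" "r \<le> x" using assms(2) by (auto simp: order_le_less)
  obtain y where y: "(x, y) \<in> L" "y \<in> Cyc" using Cyc_next x(1) by blast
  have "\<not> y \<le> u"
  proof
    assume "y \<le> u"
    then have "y \<in> Cyc \<inter> {r..u}" using y len[OF y(1)] x by auto
    then have "y \<le> x" unfolding x_def using fin by simp
    then show False using len[OF y(1)] by simp
  qed
  then show thesis using that x y by force
qed

lemma over_gap:
  assumes "Cyc \<noteq> {}" "u \<notin> Cyc" "over u v" "u < v" "c \<in> Cyc" "u < c"
  shows "v < c"
proof -
  obtain x y where xy: "(x, y) \<in> L" "x \<in> Cyc" "y \<in> Cyc" "x < u" "u < y"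
    using Cyc_below assms(1,2) by blast
  have "y \<le> c" using Cyc_between[OF xy(1) assms(5)] xy(4) assms(6) by simp
  moreover have "v < y"
    using not_over_under[OF xy(1,4,5)] over_mono[OF assms(3), of y] by (meson linorder_not_le)
  ultimately show ?thesis by simp
qed

lemma not_Cyc_before_Cyc:
  assumes "u \<notin> Cyc" "c \<in> Cyc"
  shows "(u, c) \<in> ord"
proof -
  have ne: "Cyc \<noteq> {}" using assms by auto
  consider "u < c" | "c < u" using assms by (metis linorder_cases)
  then show ?thesis
  proof cases
    case 1
    then have "\<not> over u c" using over_gap[OF ne assms(1) _ _ assms(2), of c] by blast
    then show ?thesis using 1 by (simp add: ord_def)
  next
    case 2
    then show ?thesis using assms(2) by (simp add: ord_def Cyc_def)
  qed
qed

lemma ord_Cyc: "c \<in> Cyc \<Longrightarrow> (d, c) \<in> ord" if "c \<le> d"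
  using that by (cases "c = d") (auto simp: ord_def Cyc_def)

text \<open>
  Without a cycle, some gap between consecutive integers lies under no arc. Otherwise, for
  each \<open>p\<close> take the arc over \<open>p\<close> with the leftmost tail; noncrossing forces the next such
  arc to start where the previous one ends, and this produces an infinite path.
\<close>

lemma uncovered_gap:
  assumes "Cyc = {}"
  obtains m where "m \<in> {1..n}" "\<And>x y. (x, y) \<in> L \<Longrightarrow> x < m \<Longrightarrow> y < m"
proof -
  define C where "C p x \<longleftrightarrow> x < p \<and> (\<exists>y. (x, y) \<in> L \<and> p \<le> y)" for p x
  define M where "M p x \<longleftrightarrow> C p x \<and> (\<forall>x'. C p x' \<longrightarrow> x \<le> x')" for p x
  have "\<exists>p. \<forall>x. \<not> C p x"
  proof (rule ccontr)
    assume "\<not> ?thesis"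
    then have all: "\<exists>x. C p x" for p by blast
    have ex: "\<exists>x. M p x" for p
    proof -
      have sub: "{x. C p x} \<subseteq> {p - n..p}" unfolding C_def using len by fastforce
      then have fin: "finite {x. C p x}" by (rule finite_subset) simp
      have "{x. C p x} \<noteq> {}" using all by blast
      then have "Min {x. C p x} \<in> {x. C p x}" using Min_in fin by blast
      moreover have "Min {x. C p x} \<le> x'" if "C p x'" for x' using that fin by simp
      ultimately show ?thesis unfolding M_def by blast
    qed
    have next_arc: "M (y + 1) y" if "M p x" "(x, y) \<in> L" "p \<le> y" for p x y
    proof -
      obtain x' where x': "M (y + 1) x'" using ex by blast
      then obtain y' where y': "(x', y') \<in> L" "y + 1 \<le> y'" "x' < y + 1" unfolding M_def C_def by blast
      have "\<not> x' < x"
      proof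
        assume "x' < x"
        then have "C p x'" using y' that unfolding C_def M_def by force
        then show False using that(1) \<open>x' < x\<close> unfolding M_def by force
      qed
      moreover have "x' \<noteq> x" using out_unique[OF that(2)] y' by force
      moreover have "\<not> x' < y" using nc[OF that(2) y'(1)] calculation y'(2) by force
      ultimately have "x' = y" using y' by simp
      then show ?thesis using x' by simp
    qed
    obtain x0 where "M 0 x0" using ex by blast
    then obtain y0 where y0: "(x0, y0) \<in> L" "0 \<le> y0" unfolding M_def C_def by blast
    have inf: "over y (y + int k)" if "M (y + 1) y" for y k
      using that
    proof (induction k arbitrary: y)
      case 0
      then show ?case by (auto simp: over_def)
    next
      case (Suc k)
      then obtain y' where y': "(y, y') \<in> L" "y + 1 \<le> y'" unfolding M_def C_def by blast
      then have "over y' (y' + int k)" using Suc next_arc by blast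
      then show ?case using over_arc[OF y'(1)] over_mono y'(2) by fastforce
    qed
    have "over y0 b" for b
      using inf[OF next_arc[OF \<open>M 0 x0\<close> y0], of "nat (b - y0)"] over_mono by force
    then show False using assms unfolding Cyc_def by blast
  qed
  then obtain p where p: "\<And>x y. (x, y) \<in> L \<Longrightarrow> x < p \<Longrightarrow> y < p" unfolding C_def by force
  obtain k m where m: "p = m + k * n" "m \<in> {1..<1 + n}" using shift_into_range[OF n_pos] .
  have "y < m" if "(x, y) \<in> L" "x < m" for x y
    using p[of "x + k * n" "y + k * n"] that m shift by simp
  then show thesis using that[of m] m by auto
qed

section \<open>The procedure Sub sorts by the order\<close>

definition strict :: "int \<Rightarrow> int \<Rightarrow> bool" where
  "strict u v \<longleftrightarrow> (u, v) \<in> ord \<and> u \<noteq> v"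

lemma strict_less: "u < v \<Longrightarrow> strict u v \<longleftrightarrow> \<not> over u v"
  by (auto simp: strict_def ord_def)

lemma strict_greater: "v < u \<Longrightarrow> strict u v \<longleftrightarrow> over v u"
  by (auto simp: strict_def ord_def)

definition Sub_ok :: "int \<Rightarrow> int \<Rightarrow> bool" where
  "Sub_ok c d \<longleftrightarrow> set (Sub c d (restrict_arcs L c d)) = {c..d} \<and>
     sorted_wrt strict (Sub c d (restrict_arcs L c d))"

text \<open>
  The contribution of the subwalkers below the end of the path. The argument \<open>b\<close> is the point
  just before the first interval, so that \<open>lower_part\<close> unfolds along \<open>P\<close>.
\<close>

definition lower_part :: "int \<Rightarrow> int list \<Rightarrow> int list" where
  "lower_part b P = concat (map (\<lambda>(lo, hi). Sub lo hi (restrict_arcs L lo hi)) (lower_intervals (b + 1) P))"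

lemma restrict_restrict: "c \<le> lo \<Longrightarrow> hi \<le> d \<Longrightarrow>
    restrict_arcs (restrict_arcs L c d) lo hi = restrict_arcs L lo hi"
  by (auto simp: restrict_arcs_def)

lemma lower_part_Nil: "lower_part b [] = []"
  by (simp add: lower_part_def lower_intervals_def)

lemma Sub_empty: "d < c \<Longrightarrow> Sub c d (restrict_arcs L c d) = []"
proof -
  assume "d < c"
  then have "restrict_arcs L c d = {}" by (auto simp: restrict_arcs_def)
  then show ?thesis using \<open>d < c\<close> by (subst Sub.simps) simp
qed

lemma lower_part_Cons:
  "lower_part b (a # P) = Sub (b + 1) (a - 1) (restrict_arcs L (b + 1) (a - 1)) @ lower_part a P"
  by (simp add: lower_part_def lower_intervals_def Sub_empty)

lemma path_over:
  assumes "successively (\<lambda>x y. (x, y) \<in> L) P" "a \<in> set P"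
  shows "(a, last P) \<in> L\<^sup>*" "(hd P, a) \<in> L\<^sup>*"
proof -
  have "(a, last P) \<in> L\<^sup>* \<and> (hd P, a) \<in> L\<^sup>*"
    using assms
  proof (induction P arbitrary: a)
    case (Cons x P)
    show ?case
    proof (cases P)
      case (Cons y zs)
      then have xy: "(x, y) \<in> L" and P: "successively (\<lambda>x y. (x, y) \<in> L) P" "y \<in> set P" "hd P = y"
        "P \<noteq> []"
        using Cons.prems(1) by auto
      show ?thesis
      proof (cases "a = x")
        case True
        then show ?thesis
          using Cons.IH[OF P(1,2)] xy P(4) by (auto intro: converse_rtrancl_into_rtrancl)
      next
        case False
        then have "a \<in> set P" using Cons.prems(2) by simp
        then show ?thesis
          using Cons.IH[OF P(1)] xy P(3,4) by (auto intro: converse_rtrancl_into_rtrancl)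
      qed
    qed (use Cons.prems in simp)
  qed simp
  then show "(a, last P) \<in> L\<^sup>*" "(hd P, a) \<in> L\<^sup>*" by auto
qed

lemma lower_part_ok:
  assumes "P \<noteq> []" "successively (\<lambda>x y. (x, y) \<in> L) P" "b < hd P"
    and gap: "\<And>x v. b < x \<Longrightarrow> x < hd P \<Longrightarrow> over x v \<Longrightarrow> v < hd P"
    and sub: "\<And>lo hi. b < lo \<Longrightarrow> hi < last P \<Longrightarrow>
      (\<And>x y. lo \<le> x \<Longrightarrow> x \<le> hi \<Longrightarrow> (x, y) \<in> L \<Longrightarrow> y \<le> hi) \<Longrightarrow> Sub_ok lo hi"
  shows "set (lower_part b P) = {b<..<last P} - set P" "sorted_wrt strict (lower_part b P)"
    "\<forall>x\<in>set (lower_part b P). \<forall>a\<in>set P. x < a \<longrightarrow> \<not> over x a"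
proof -
  have "set (lower_part b P) = {b<..<last P} - set P \<and> sorted_wrt strict (lower_part b P) \<and>
    (\<forall>x\<in>set (lower_part b P). \<forall>a\<in>set P. x < a \<longrightarrow> \<not> over x a)"
    using assms
  proof (induction P arbitrary: b)
    case (Cons a P)
    have le_last: "x \<le> last (a # P)" if "x \<in> set (a # P)" for x
      using path_over(1)[OF Cons.prems(2) that] rtrancl_le by blast
    have ge_hd: "a \<le> x" if "x \<in> set (a # P)" for x
      using path_over(2)[OF Cons.prems(2) that] rtrancl_le by auto
    have gap: "v < a" if "b < x" "x < a" "over x v" for x v
      using Cons.prems(4) that by simp
    have ok: "Sub_ok (b + 1) (a - 1)"
    proof (rule Cons.prems(5))
      show "a - 1 < last (a # P)" using le_last[of a] by simp
      fix x y assume "b + 1 \<le> x" "x \<le> a - 1" "(x, y) \<in> L"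
      moreover have "over x y" using \<open>(x, y) \<in> L\<close> unfolding over_def by blast
      ultimately show "y \<le> a - 1" using gap[of x y] by simp
    qed simp
    define S where "S = Sub (b + 1) (a - 1) (restrict_arcs L (b + 1) (a - 1))"
    have S: "set S = {b<..<a}" "sorted_wrt strict S"
    proof -
      have "{b + 1..a - 1} = {b<..<a}" by auto
      then show "set S = {b<..<a}" "sorted_wrt strict S" using ok unfolding Sub_ok_def S_def by simp_all
    qed
    show ?case
    proof (cases P)
      case Nil
      have "lower_part b (a # P) = S" using Nil by (simp add: lower_part_Cons lower_part_Nil S_def)
      then show ?thesis using S gap Nil by force
    next
      case (Cons a' P')
      have aa: "(a, a') \<in> L" using Cons.prems(2) Cons by simp
      have "set (lower_part a P) = {a<..<last P} - set P \<and> sorted_wrt strict (lower_part a P) \<and>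
        (\<forall>x\<in>set (lower_part a P). \<forall>a\<in>set P. x < a \<longrightarrow> \<not> over x a)"
      proof (rule Cons.IH)
        show "successively (\<lambda>x y. (x, y) \<in> L) P" using Cons.prems(2) Cons by simp
        show "a < hd P" using len[OF aa] Cons by simp
        show "v < hd P" if "a < x" "x < hd P" "over x v" for x v
          using that not_over_under[OF aa that(1)] Cons over_mono[of x v a'] by force
        show "Sub_ok lo hi" if h: "a < lo" "hi < last P"
          "\<And>x y. lo \<le> x \<Longrightarrow> x \<le> hi \<Longrightarrow> (x, y) \<in> L \<Longrightarrow> y \<le> hi" for lo hi
          by (rule Cons.prems(5)) (use h Cons.prems(3) Cons in auto)
      qed (simp add: Cons)
      then have IH: "set (lower_part a P) = {a<..<last P} - set P" "sorted_wrt strict (lower_part a P)"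
        "\<forall>x\<in>set (lower_part a P). \<forall>a\<in>set P. x < a \<longrightarrow> \<not> over x a" by auto
      have eq: "lower_part b (a # P) = S @ lower_part a P" by (simp add: lower_part_Cons S_def)
      have ge: "x \<ge> a" if "x \<in> set (a # P)" for x using ge_hd that by simp
      have aP: "a < x" if "x \<in> set P" for x
        using ge_hd[of x] that Cons.prems(2) path_over(2)[of P x] Cons len[OF aa] rtrancl_le[of a' x] by auto
      have "last P \<in> set P" using Cons by simp
      then have lP: "a < last P" using aP by blast
      have "set (lower_part b (a # P)) = {b<..<last (a # P)} - set (a # P)"
      proof -
        have "{b<..<a} \<union> ({a<..<last P} - set P) = {b<..<last P} - insert a (set P)"
          using lP Cons.prems(3) by (auto dest: aP)
        then show ?thesis unfolding eq using S(1) IH(1) Cons by simp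
      qed
      moreover have nov: "\<not> over x v" if "x \<in> set S" "a \<le> v" for x v
        using that gap[of x v] S(1) by force
      moreover have "sorted_wrt strict (lower_part b (a # P))"
        unfolding eq sorted_wrt_append using S IH nov strict_less by force
      moreover have "\<forall>x\<in>set (lower_part b (a # P)). \<forall>a'\<in>set (a # P). x < a' \<longrightarrow> \<not> over x a'"
        unfolding eq using nov ge IH(1,3) by force
      ultimately show ?thesis by blast
    qed
  qed simp
  then show "set (lower_part b P) = {b<..<last P} - set P" "sorted_wrt strict (lower_part b P)"
    "\<forall>x\<in>set (lower_part b P). \<forall>a\<in>set P. x < a \<longrightarrow> \<not> over x a" by auto
qed

text \<open>
  The path of \<open>Sub\<close> comes reversed, since its points are mutually inverted. A point in a gap of
  the path reaches only points of its gap, so it precedes the path points above it, and it is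
  passed by the path, so it precedes those below it as well. The path is maximal, so nothing up to
  its end reaches beyond this end, and the last subwalker comes last.
\<close>

lemma Sub_ok:
  assumes "\<And>x y. c \<le> x \<Longrightarrow> x \<le> d \<Longrightarrow> (x, y) \<in> L \<Longrightarrow> y \<le> d"
  shows "Sub_ok c d"
  using assms
proof (induction "nat (d - c + 1)" arbitrary: c d rule: less_induct)
  case less
  define F where "F = restrict_arcs L c d"
  have inp: "is_input c d F" unfolding is_input_def F_def restrict_arcs_def using len by force
  have FL: "F \<subseteq> L" unfolding F_def restrict_arcs_def by auto
  show ?case
  proof (cases "F = {}")
    case True
    have "Sub c d F = [c..d]" using True by (subst Sub.simps) simp
    moreover have "sorted_wrt strict [c..d]"
    proof -
      have "(x, y) \<notin> L" if "c \<le> x" "x \<le> d" for x y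
      proof
        assume "(x, y) \<in> L"
        then have "(x, y) \<in> F" using less(2)[OF that] len[of x y] that
          unfolding F_def restrict_arcs_def by auto
        then show False using True by simp
      qed
      then have "x = z" if "(x, z) \<in> L\<^sup>*" "c \<le> x" "x \<le> d" for x z
        using that by (metis converse_rtranclE)
      then have st: "strict x y" if "c \<le> x" "x \<le> d" "x < y" for x y
        using that strict_less[OF that(3)] unfolding over_def by force
      show ?thesis by (rule sorted_wrt_mono_rel[of _ "(<)"]) (use st in auto)
    qed
    ultimately show ?thesis unfolding Sub_ok_def F_def by simp
  next
    case False
    define P where "P = subcompass_path F"
    note sp = subcompass_path[OF inp False, folded P_def]
    have P: "P \<noteq> []" "hd P = Min (Domain F)" "successively (\<lambda>x y. (x, y) \<in> F) P"
      using sp(1) by (auto simp: path_from_def)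
    have PL: "successively (\<lambda>x y. (x, y) \<in> L) P"
      using P(3) by (rule successively_mono) (use FL in auto)
    have Prng: "set P \<subseteq> {c..d}" by (rule sp(3))
    define q where "q = last P"
    have qP: "q \<in> set P" unfolding q_def using P(1) by simp
    then have q: "c \<le> q" "q \<le> d" using Prng by auto
    have no_out: "(q, y) \<notin> L" for y
    proof
      assume qy: "(q, y) \<in> L"
      then have "(q, y) \<in> F" using less(2)[OF q qy] len[OF qy] q
        unfolding F_def restrict_arcs_def by auto
      then have "path_from F (Min (Domain F)) (P @ [y])"
        using P unfolding path_from_def q_def by (auto simp: successively_append_iff)
      then show False using sp(2) by fastforce
    qed
    then have reach_q: "z = q" if "(q, z) \<in> L\<^sup>*" for z using that by (metis converse_rtranclE)
    have hdP: "hd P \<in> set P" using P(1) by simp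
    have finD: "finite (Domain F)"
      by (rule finite_subset[of _ "{c..d}"]) (auto simp: F_def restrict_arcs_def)
    have first: "(x, y) \<notin> L" if "c \<le> x" "x < hd P" for x y
    proof
      assume xy: "(x, y) \<in> L"
      have "x \<le> d" using that hdP Prng by force
      then have "(x, y) \<in> F" using less(2)[OF that(1) _ xy] len[OF xy] that xy
        unfolding F_def restrict_arcs_def by auto
      then have "Min (Domain F) \<le> x" using finD by (intro Min_le) auto
      then show False using that P(2) by simp
    qed
    have Pq: "x \<le> q" if "x \<in> set P" for x
      using path_over(1)[OF PL that] rtrancl_le q_def by blast
    have Phd: "hd P \<le> x" if "x \<in> set P" for x
      using path_over(2)[OF PL that] rtrancl_le by blast
    note IH = less(1)
    have low: "set (lower_part (c - 1) P) = {c - 1<..<last P} - set P"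
      "sorted_wrt strict (lower_part (c - 1) P)"
      "\<forall>x\<in>set (lower_part (c - 1) P). \<forall>a\<in>set P. x < a \<longrightarrow> \<not> over x a"
    proof -
      have 1: "c - 1 < hd P" using hdP Prng by force
      have 2: "v < hd P" if h: "c - 1 < x" "x < hd P" "over x v" for x v
      proof -
        obtain z where z: "(x, z) \<in> L\<^sup>*" "v \<le> z" using h(3) unfolding over_def by blast
        moreover have "(x, y) \<notin> L" for y using first[of x y] h(1,2) by simp
        ultimately have "x = z" by (metis converse_rtranclE)
        then show ?thesis using z h by simp
      qed
      have 3: "Sub_ok lo hi" if h: "c - 1 < lo" "hi < last P"
        "\<And>x y. lo \<le> x \<Longrightarrow> x \<le> hi \<Longrightarrow> (x, y) \<in> L \<Longrightarrow> y \<le> hi" for lo hi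
        by (rule IH) (use h q in \<open>auto simp: q_def\<close>)
      note lp = lower_part_ok[OF P(1) PL 1 2 3]
      show "set (lower_part (c - 1) P) = {c - 1<..<last P} - set P" by (rule lp(1))
      show "sorted_wrt strict (lower_part (c - 1) P)" by (rule lp(2))
      show "\<forall>x\<in>set (lower_part (c - 1) P). \<forall>a\<in>set P. x < a \<longrightarrow> \<not> over x a" by (rule lp(3))
    qed
    define U where "U = Sub (q + 1) d (restrict_arcs L (q + 1) d)"
    have "Sub_ok (q + 1) d"
    proof (rule IH)
      show "nat (d - (q + 1) + 1) < nat (d - c + 1)" using q by simp
      show "y \<le> d" if "q + 1 \<le> x" "x \<le> d" "(x, y) \<in> L" for x y
        using less(2)[of x y] that q by simp
    qed
    then have U: "set U = {q + 1..d}" "sorted_wrt strict U" unfolding Sub_ok_def U_def by auto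
    have eq: "Sub c d F = lower_part (c - 1) P @ rev P @ U"
    proof -
      have "(if q + 1 \<le> d then Sub (q + 1) d (restrict_arcs F (q + 1) d) else []) = U"
        using q restrict_restrict[of c "q + 1" d d] by (simp add: U_def F_def Sub_empty)
      moreover have "Sub lo hi (restrict_arcs F lo hi) = Sub lo hi (restrict_arcs L lo hi)"
        if "(lo, hi) \<in> set (lower_intervals c P)" for lo hi
      proof -
        have "(lo - 1, hi + 1) \<in> set (zip ((c - 1) # P) P)"
          using that unfolding lower_intervals_def by auto
        then have "lo - 1 \<in> set ((c - 1) # P)" "hi + 1 \<in> set P"
          by (rule set_zip_leftD, metis set_zip_rightD)
        then have "c \<le> lo" "hi \<le> d" using Prng by fastforce+
        then show ?thesis unfolding F_def by (simp add: restrict_restrict)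
      qed
      ultimately show ?thesis
        using False inp by (subst Sub.simps)
          (auto simp: Let_def lower_part_def P_def[symmetric] q_def[symmetric]
            intro!: arg_cong[where f = concat] map_cong)
    qed
    have not_past_q: "\<not> over x y" if "c \<le> x" "x \<le> q" "q < y" for x y
    proof
      assume ov: "over x y"
      show False
      proof (cases "x < hd P")
        case True
        obtain z where "(x, z) \<in> L\<^sup>*" "y \<le> z" using ov unfolding over_def by blast
        moreover have "x \<noteq> z" using calculation that by auto
        ultimately show False using first[OF that(1) True] by (metis converse_rtranclE)
      next
        case False
        have hq: "(hd P, q) \<in> L\<^sup>*" using path_over(2)[OF PL qP] .
        have "over (hd P) y"
        proof (cases "x = hd P")
          case False
          then show ?thesis
            using over_trans[of "hd P" x y] hq that ov \<open>\<not> x < hd P\<close> unfolding over_def by force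
        qed (use ov in simp)
        moreover have "\<not> over q y" using reach_q that unfolding over_def by force
        moreover have "over q y" if "(a, q) \<in> L\<^sup>*" "over a y" for a
          using that
        proof (induction rule: converse_rtrancl_induct)
          case (step a a')
          have "a < y" using rtrancl_le[OF step(2)] len[OF step(1)] \<open>q < y\<close> by simp
          then show ?case using step over_next by blast
        qed
        ultimately show False using hq by blast
      qed
    qed
    have PU: "strict x y" if "c \<le> x" "x \<le> q" "y \<in> set U" for x y
      using not_past_q[of x y] that U(1) strict_less[of x y] by simp
    have revP: "sorted_wrt strict (rev P)"
    proof -
      have "sorted_wrt (\<lambda>x y. (x, y) \<in> L\<^sup>+) P"
        using PL by (intro iffD1[OF successively_conv_sorted_wrt] successively_mono[OF PL])
          (auto intro: transpI)
      then have "sorted_wrt (\<lambda>x y. strict y x) P"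
      proof (rule sorted_wrt_mono_rel[rotated])
        fix x y assume xy: "(x, y) \<in> L\<^sup>+"
        then obtain u where "(x, u) \<in> L" "(u, y) \<in> L\<^sup>*" by (meson tranclD)
        then have "x < y" using len rtrancl_le by force
        then show "strict y x" using xy strict_greater[of x y] unfolding over_def
          by (auto dest: trancl_into_rtrancl)
      qed
      then show ?thesis by (simp add: sorted_wrt_rev)
    qed
    have lowP: "strict x a" if "x \<in> set (lower_part (c - 1) P)" "a \<in> set P" for x a
    proof (cases "x < a")
      case True
      then show ?thesis using low(3) that strict_less by blast
    next
      case False
      have x: "x < q" "x \<notin> set P" using that low(1) unfolding q_def by auto
      have "a \<noteq> x" using x(2) that(2) by blast
      then have "a < x" using False by simp
      moreover have "over a x" using path_over(1)[OF PL that(2)] x unfolding over_def q_def by force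
      ultimately show ?thesis using strict_greater by blast
    qed
    have Pcq: "set P \<subseteq> {c - 1<..<q} \<union> {q}" using Prng Pq by force
    have "{c..d} = {c - 1<..<q} \<union> {q} \<union> {q + 1..d}" using q by auto
    then have "({c - 1<..<q} - set P) \<union> set P \<union> {q + 1..d} = {c..d}" using qP Pcq by blast
    then have "set (Sub c d F) = {c..d}"
      by (simp only: eq set_append set_rev low(1) U(1) q_def[symmetric] Un_assoc)
    moreover have "sorted_wrt strict (Sub c d F)"
      unfolding eq sorted_wrt_append
    proof (intro conjI ballI)
      show "sorted_wrt strict (lower_part (c - 1) P)" "sorted_wrt strict (rev P)" "sorted_wrt strict U"
        by (fact low(2) revP U(2))+
      show "strict x y" if "x \<in> set (rev P)" "y \<in> set U" for x y
        using PU[of x y] that Prng Pq by force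
      show "strict x y" if x: "x \<in> set (lower_part (c - 1) P)" and y: "y \<in> set (rev P @ U)" for x y
      proof (cases "y \<in> set P")
        case True
        then show ?thesis using lowP[OF x] by blast
      next
        case False
        have "x \<in> {c - 1<..<q}" using x low(1) unfolding q_def by blast
        then show ?thesis using PU[of x y] y False by simp
      qed
    qed
    ultimately show ?thesis unfolding Sub_ok_def F_def by blast
  qed
qed

end

section \<open>Windows and blocks\<close>

lemma mod_eq_imp_shift:
  fixes n s :: int
  assumes "s = n \<or> s = - n" "x mod n = y mod n"
  obtains j where "y = x + j * s"
proof -
  have "n dvd y - x" using assms(2) by (metis mod_eq_dvd_iff)
  then have "s dvd y - x" using assms(1) by auto
  then obtain j where "y - x = s * j" by blast
  then have "y = x + j * s" by (simp add: algebra_simps)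
  then show thesis using that by blast
qed

text \<open>
  A sorted list all of whose entries precede the translates of all entries by \<open>s\<close> is a window of
  the block of its translates: lexicographically ordered by translate and position, this block
  has finite intervals, and no translate falls between two neighbours in the list. The step \<open>s\<close> is \<open>n\<close>
  for a waxing and \<open>- n\<close> for a waning block.
\<close>

lemma window_block:
  assumes tito: "is_tito s R" and s: "s = n \<or> s = - n" "s \<noteq> 0"
    and w: "w \<noteq> []" "sorted_wrt (\<lambda>u v. (u, v) \<in> R \<and> u \<noteq> v) w"
    and step: "\<And>u v. u \<in> set w \<Longrightarrow> v \<in> set w \<Longrightarrow> (u, v + s) \<in> R \<and> u \<noteq> v + s"
    and I: "I = {x + k * s | x k. x \<in> set w}"
    and convex_I: "\<forall>a\<in>I. \<forall>c\<in>I. \<forall>b. (a, b) \<in> R \<and> (b, c) \<in> R \<longrightarrow> b \<in> I"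
  shows "is_block R I" "successively (covered_by R) w" "length w = block_size n I"
    "\<And>x. x \<in> I \<Longrightarrow> (x, x + s) \<in> R"
proof -
  note R = titoD[OF tito]
  have convex: "b \<in> I" if "a \<in> I" "c \<in> I" "(a, b) \<in> R" "(b, c) \<in> R" for a b c
    using convex_I that by blast
  have key: "(u + k * s, v + l * s) \<in> R \<and> u + k * s \<noteq> v + l * s"
    if "u \<in> set w" "v \<in> set w" "k < l" for u v k l
  proof -
    have 1: "(u + k * s, v + (k + 1) * s) \<in> R"
      using step[OF that(1,2)] tito_shift[OF tito, of u k "v + s"] by (simp add: algebra_simps)
    have 2: "(v + (k + 1) * s, v + l * s) \<in> R"
      using tito_chain[OF tito, of v "k + 1" l] step[OF that(2,2)] that(3) by simp
    have "u + k * s \<noteq> v + (k + 1) * s" using step[OF that(1,2)] by (simp add: algebra_simps)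
    then show ?thesis using 1 2 R(2,3) by metis
  qed
  have memI: "u + k * s \<in> I" if "u \<in> set w" for u k using that I by blast
  show up: "(x, x + s) \<in> R" if "x \<in> I" for x
  proof -
    obtain u k where "u \<in> set w" "x = u + k * s" using \<open>x \<in> I\<close> I by blast
    then show ?thesis using key[of u u k "k + 1"] by (simp add: algebra_simps)
  qed
  have up': "x + s \<in> I \<and> x - s \<in> I \<and> (x - s, x) \<in> R" if "x \<in> I" for x
  proof -
    obtain u k where u: "u \<in> set w" "x = u + k * s" using \<open>x \<in> I\<close> I by blast
    then show ?thesis using memI[of u "k + 1"] memI[of u "k - 1"] up[of "x - s"] by (simp add: algebra_simps)
  qed
  show "is_block R I"
    unfolding is_block_def
  proof (intro conjI)
    show "I \<noteq> {}" using memI[of "hd w" 0] w(1) by force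
    show "\<forall>a\<in>I. \<forall>c\<in>I. \<forall>b. (a, b) \<in> R \<and> (b, c) \<in> R \<longrightarrow> b \<in> I" using convex by blast
    show "\<not> (\<exists>a\<in>I. \<forall>x\<in>I. (a, x) \<in> R)"
    proof
      assume "\<exists>a\<in>I. \<forall>x\<in>I. (a, x) \<in> R"
      then obtain a where "a \<in> I" "(a, a - s) \<in> R" using up' by blast
      then have "a = a - s" using up' R(3) by blast
      then show False using s by simp
    qed
    show "\<not> (\<exists>a\<in>I. \<forall>x\<in>I. (x, a) \<in> R)"
    proof
      assume "\<exists>a\<in>I. \<forall>x\<in>I. (x, a) \<in> R"
      then obtain a where "a \<in> I" "(a + s, a) \<in> R" using up' by blast
      then have "a = a + s" using up R(3) by blast
      then show False using s by simp
    qed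
    show "\<forall>a\<in>I. \<forall>c\<in>I. finite {b \<in> I. (a, b) \<in> R \<and> (b, c) \<in> R}"
    proof (intro ballI)
      fix a c assume "a \<in> I" "c \<in> I"
      then obtain u k v l where a: "u \<in> set w" "a = u + k * s" and c: "v \<in> set w" "c = v + l * s"
        using I by blast
      have "{b \<in> I. (a, b) \<in> R \<and> (b, c) \<in> R} \<subseteq> (\<lambda>(x, j). x + j * s) ` (set w \<times> {k..l})"
      proof
        fix b assume b: "b \<in> {b \<in> I. (a, b) \<in> R \<and> (b, c) \<in> R}"
        then obtain x j where x: "x \<in> set w" "b = x + j * s" using I by blast
        have "k \<le> j" using key[OF x(1) a(1), of j k] b a x R(3) by force
        moreover have "j \<le> l" using key[OF c(1) x(1), of l j] b c x R(3) by force
        ultimately show "b \<in> (\<lambda>(x, j). x + j * s) ` (set w \<times> {k..l})" using x by force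
      qed
      then show "finite {b \<in> I. (a, b) \<in> R \<and> (b, c) \<in> R}" by (rule finite_subset) simp
    qed
  qed
  have nth_less: "(w ! i, w ! j) \<in> R \<and> w ! i \<noteq> w ! j" if "i < j" "j < length w" for i j
    using w(2) that by (simp add: sorted_wrt_iff_nth_less)
  have "covered_by R (w ! i) (w ! Suc i)" if i: "Suc i < length w" for i
    unfolding covered_by_def
  proof (intro conjI allI impI)
    show "(w ! i, w ! Suc i) \<in> R" "w ! i \<noteq> w ! Suc i" using nth_less[of i "Suc i"] i by auto
    fix z assume z: "(w ! i, z) \<in> R \<and> (z, w ! Suc i) \<in> R"
    have mem: "w ! i \<in> set w" "w ! Suc i \<in> set w" using i by auto
    then have "z \<in> I" using convex[of "w ! i" "w ! Suc i" z] z memI[of _ 0] by simp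
    then obtain x j where x: "x \<in> set w" "z = x + j * s" using I by blast
    have "\<not> j < 0" using key[OF x(1) mem(1), of j 0] z x R(3) by force
    moreover have "\<not> 0 < j" using key[OF mem(2) x(1), of 0 j] z x R(3) by force
    ultimately have "z = x" using x(2) by simp
    then obtain p where p: "p < length w" "z = w ! p" using x(1) by (metis in_set_conv_nth)
    have "\<not> p < i" using nth_less[of p i] i p z R(3) by force
    moreover have "\<not> Suc i < p" using nth_less[of "Suc i" p] i p z R(3) by force
    ultimately have "p = i \<or> p = Suc i" by linarith
    then show "z = w ! i \<or> z = w ! Suc i" using p by auto
  qed
  then show "successively (covered_by R) w" by (simp add: successively_conv_nth)
  have dist: "distinct w"
    unfolding distinct_conv_nth using nth_less by (metis linorder_neq_iff)
  have inj: "inj_on (\<lambda>x. x mod n) (set w)"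
  proof (rule inj_onI)
    fix x y assume x: "x \<in> set w" and y: "y \<in> set w" and "x mod n = y mod n"
    then obtain j where j: "y = x + j * s" using mod_eq_imp_shift[OF s(1)] by blast
    have "\<not> j < 0" using key[OF x y, of j 0] j by auto
    moreover have "\<not> 0 < j" using key[OF y x, of 0 j] j by auto
    ultimately show "x = y" using j by simp
  qed
  have "(\<lambda>x. x mod n) ` I = (\<lambda>x. x mod n) ` set w"
  proof -
    have *: "(x + k * s) mod n = x mod n" for x k using s(1)
      by (metis minus_mult_commute mod_mult_self1)
    have "(\<lambda>x. x mod n) ` I \<subseteq> (\<lambda>x. x mod n) ` set w" using I * by auto
    moreover have "set w \<subseteq> I" using memI[of _ 0] by auto
    ultimately show ?thesis by blast
  qed
  then show "length w = block_size n I"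
    unfolding block_size_def using card_image[OF inj] distinct_card[OF dist] by simp
qed

lemma is_block_converse: "is_block (R\<inverse>) I \<longleftrightarrow> is_block R I"
  unfolding is_block_def converse_iff by (simp add: conj_commute) blast

text \<open>
  Above \<open>x\<close>, the block \<open>J\<close> has no last element, while \<open>I\<close> has only finitely many elements up to \<open>y\<close>.
  So \<open>J\<close> gets to \<open>y\<close> or past it, and contains \<open>y\<close> by convexity.
\<close>

lemma block_upward:
  assumes lin: "linear_order R" and I: "is_block R I" and J: "is_block R J"
    and x: "x \<in> I" "x \<in> J" and y: "y \<in> I" "(x, y) \<in> R"
  shows "y \<in> J"
proof -
  note R = linear_orderD[OF lin]
  have "\<exists>j\<in>J. (y, j) \<in> R"
  proof (rule ccontr)
    assume "\<not> ?thesis"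
    then have below: "\<forall>j\<in>J. (j, y) \<in> R" using R(4) by blast
    define A where "A = {j \<in> J. (x, j) \<in> R}"
    have "A \<subseteq> {b \<in> I. (x, b) \<in> R \<and> (b, y) \<in> R}"
      using below I x(1) y unfolding A_def is_block_def by blast
    then have fin: "finite A" using I x(1) y unfolding is_block_def by (meson finite_subset)
    have "A \<noteq> {}" using x(2) R(1) unfolding A_def by blast
    then obtain m where m: "m \<in> A" "\<forall>j\<in>A. (j, m) \<in> R" using linear_order_has_max[OF lin fin] by blast
    have "(j, m) \<in> R" if "j \<in> J" for j
      using m that R(2)[of j x m] R(4)[of x j] unfolding A_def by blast
    then show False using J m(1) unfolding is_block_def A_def by blast
  qed
  then show ?thesis using x(2) y J unfolding is_block_def by blast
qed

lemma block_subset: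
  assumes lin: "linear_order R" and "is_block R I" "is_block R J" "x \<in> I" "x \<in> J"
  shows "I \<subseteq> J"
proof
  fix y assume y: "y \<in> I"
  have lin': "linear_order (R\<inverse>)" using lin by simp
  consider "(x, y) \<in> R" | "(x, y) \<in> R\<inverse>" using linear_orderD(4)[OF lin] by blast
  then show "y \<in> J"
    using block_upward[OF lin assms(2-5) y] block_upward[OF lin' _ _ assms(4,5) y] assms(2,3)
    unfolding is_block_converse by blast
qed

lemma blocks_eq:
  assumes "linear_order R" "\<And>I. I \<in> B \<Longrightarrow> is_block R I" "\<Union>B = UNIV"
  shows "{I. is_block R I} = B"
proof
  show "B \<subseteq> {I. is_block R I}" using assms(2) by blast
  show "{I. is_block R I} \<subseteq> B"
  proof
    fix I assume "I \<in> {I. is_block R I}"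
    then have I: "is_block R I" by simp
    then obtain x where x: "x \<in> I" unfolding is_block_def by blast
    then obtain J where J: "J \<in> B" "x \<in> J" using assms(3) by blast
    then have "I = J"
      using block_subset[OF assms(1) I assms(2)[OF J(1)] x J(2)]
        block_subset[OF assms(1) assms(2)[OF J(1)] I J(2) x] by blast
    then show "I \<in> B" using J by simp
  qed
qed

text \<open>
  The order that a window \<open>w\<close> forces on the translates of its entries.
\<close>

definition lex_window :: "int \<Rightarrow> int list \<Rightarrow> (int \<times> int) set" where
  "lex_window s w = {(w ! i + k * s, w ! j + l * s) | i j k l.
     i < length w \<and> j < length w \<and> (k < l \<or> k = l \<and> i \<le> j)}"

lemma between_window:
  assumes "linear_order R" "successively (covered_by R) w" "w \<noteq> []"
    "(hd w, z) \<in> R" "(z, last w) \<in> R"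
  shows "z \<in> set w"
  using assms(2-)
proof (induction w)
  case (Cons x w)
  note R = linear_orderD[OF assms(1)]
  show ?case
  proof (cases w)
    case Nil
    then show ?thesis using Cons.prems R(3)[of x z] by simp
  next
    case (Cons y w')
    have xy: "covered_by R x y" "successively (covered_by R) w" using Cons.prems(1) Cons by auto
    show ?thesis
    proof (cases "(y, z) \<in> R")
      case True
      then show ?thesis using Cons.IH[OF xy(2)] Cons.prems(4) Cons by simp
    next
      case False
      then have "(z, y) \<in> R" using R(4) by blast
      then show ?thesis using xy(1) Cons.prems(3) Cons unfolding covered_by_def by auto
    qed
  qed
qed simp

text \<open>
  Were the translate \<open>hd w + s\<close> not above \<open>last w\<close>, it would lie in between the
  consecutive entries of \<open>w\<close> and hence be a member of \<open>w\<close> with the residue of \<open>hd w\<close>.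
\<close>

lemma lex_window_subset:
  assumes tito: "is_tito s R" and s: "s \<noteq> 0" and cov: "successively (covered_by R) w"
    and up: "\<And>x. x \<in> set w \<Longrightarrow> (x, x + s) \<in> R"
    and res: "\<And>u v k. u \<in> set w \<Longrightarrow> v \<in> set w \<Longrightarrow> u = v + k * s \<Longrightarrow> k = 0"
  shows "lex_window s w \<subseteq> R"
proof (cases "w = []")
  case True
  then show ?thesis by (simp add: lex_window_def)
next
  case False
  note R = titoD[OF tito]
  have "successively (\<lambda>u v. (u, v) \<in> R) w"
    using cov by (rule successively_mono) (auto simp: covered_by_def)
  moreover have "transp (\<lambda>u v. (u, v) \<in> R)" using R(2) by (blast intro: transpI)
  ultimately have srt: "sorted_wrt (\<lambda>u v. (u, v) \<in> R) w" by (simp add: successively_conv_sorted_wrt)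
  have nth_le: "(w ! i, w ! j) \<in> R" if "i \<le> j" "j < length w" for i j
    using srt that R(1) by (cases "i = j") (auto simp: sorted_wrt_iff_nth_less)
  have hd: "hd w \<in> set w" "hd w = w ! 0" using False by (auto simp: hd_conv_nth)
  have lst: "last w = w ! (length w - 1)" using False by (simp add: last_conv_nth)
  have hl: "(last w, hd w + s) \<in> R"
  proof (rule ccontr)
    assume "(last w, hd w + s) \<notin> R"
    then have "(hd w + s, last w) \<in> R" using R(4) by blast
    then have "hd w + s \<in> set w"
      using between_window[OF tito_linear[OF tito] cov False up[OF hd(1)]] by blast
    from res[OF this hd(1), of 1] show False by simp
  qed
  have next_: "(w ! i, w ! j + s) \<in> R" if "i < length w" "j < length w" for i j
  proof -
    have "(w ! i, last w) \<in> R" unfolding lst using that nth_le by simp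
    moreover have "(hd w + s, w ! j + s) \<in> R"
      using nth_le[of 0 j] that tito_shift[OF tito, of "w ! 0" 1 "w ! j"] unfolding hd(2) by simp
    ultimately show ?thesis using hl R(2) by blast
  qed
  show ?thesis
  proof
    fix p assume "p \<in> lex_window s w"
    then obtain i j k l where p: "p = (w ! i + k * s, w ! j + l * s)" "i < length w" "j < length w"
      "k < l \<or> k = l \<and> i \<le> j" unfolding lex_window_def by blast
    show "p \<in> R"
    proof (cases "k < l")
      case True
      have "(w ! i + k * s, w ! j + (k + 1) * s) \<in> R"
        using next_[OF p(2,3)] tito_shift[OF tito, of "w ! i" k "w ! j + s"] by (simp add: algebra_simps)
      moreover have "(w ! j + (k + 1) * s, w ! j + l * s) \<in> R"
        using tito_chain[OF tito, of "w ! j" "k + 1" l] up[of "w ! j"] True p(3) by simp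
      ultimately show ?thesis using p(1) R(2) by blast
    next
      case False
      then have "k = l" "i \<le> j" using p(4) by auto
      then show ?thesis using nth_le[of i j] tito_shift[OF tito] p by simp
    qed
  qed
qed

lemma lex_window_total:
  assumes "u \<in> set w" "v \<in> set w"
  shows "(u + k * s, v + l * s) \<in> lex_window s w \<or> (v + l * s, u + k * s) \<in> lex_window s w"
proof -
  obtain i j where "i < length w" "u = w ! i" "j < length w" "v = w ! j"
    using assms by (metis in_set_conv_nth)
  moreover have "(k < l \<or> k = l \<and> i \<le> j) \<or> (l < k \<or> l = k \<and> j \<le> i)" by linarith
  ultimately show ?thesis unfolding lex_window_def by blast
qed

lemma linear_order_eqI:
  assumes "linear_order R" "linear_order R'" "Q \<subseteq> R" "Q \<subseteq> R'"
    "\<And>x y. (x, y) \<in> Q \<or> (y, x) \<in> Q"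
  shows "R = R'"
proof -
  have *: "(x, y) \<in> R'" if "linear_order R" "linear_order R'" "Q \<subseteq> R" "Q \<subseteq> R'" "(x, y) \<in> R" for R R' x y
  proof (cases "(x, y) \<in> Q")
    case False
    then have "(y, x) \<in> R" using assms(5) that by blast
    then have "x = y" using linear_orderD(3)[OF that(1)] that by blast
    then show ?thesis using linear_orderD(1)[OF that(2)] by simp
  qed (use that in blast)
  show ?thesis using *[OF assms(1-4)] *[OF assms(2,1,4,3)] by auto
qed

definition windows_order :: "int \<Rightarrow> int list \<Rightarrow> int list \<Rightarrow> (int \<times> int) set" where
  "windows_order n v w = lex_window n v \<union> lex_window (- n) w \<union>
     {(x + k * n, y + l * n) | x y k l. x \<in> set v \<and> y \<in> set w}"

definition windows_of :: "int list \<Rightarrow> int list \<Rightarrow> window list" where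
  "windows_of v w = (if v = [] then [] else [Wax v]) @ (if w = [] then [] else [Wan w])"

lemma windows_order_subset:
  assumes "n > 0" and tito: "is_tito n R" and wn: "window_notation n R (windows_of v w)"
    and res: "\<And>x y k. x \<in> set v \<union> set w \<Longrightarrow> y \<in> set v \<union> set w \<Longrightarrow> x = y + k * n \<Longrightarrow> k = 0"
  shows "windows_order n v w \<subseteq> R"
proof -
  note R = titoD[OF tito]
  obtain Is where Is: "sorted_wrt (\<lambda>I J. \<forall>x\<in>I. \<forall>y\<in>J. (x, y) \<in> R \<and> x \<noteq> y) Is"
    "list_all2 (is_window n R) Is (windows_of v w)"
    using wn unfolding window_notation_def by blast
  have v: "successively (covered_by R) v \<and> (\<forall>x\<in>set v. (x, x + n) \<in> R)"
  proof (cases "v = []")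
    case False
    then obtain I where "is_window n R I (Wax v)"
      using Is(2) by (auto simp: windows_of_def list_all2_Cons2)
    then show ?thesis unfolding is_window_def waxing_def by auto
  qed simp
  have w: "successively (covered_by R) w \<and> (\<forall>x\<in>set w. (x, x + - n) \<in> R)"
  proof (cases "w = []")
    case False
    then obtain I where "is_window n R I (Wan w)"
      using Is(2) by (auto simp: windows_of_def list_all2_Cons2 split: if_splits)
    then have I: "successively (covered_by R) w" "\<forall>x\<in>set w. (x + n, x) \<in> R"
      unfolding is_window_def waning_def by auto
    have "(x, x + - n) \<in> R" if "x \<in> set w" for x
      using I(2) that tito_shift[OF tito, of "x + n" "-1" x] by simp
    then show ?thesis using I by blast
  qed simp
  have tito': "is_tito (- n) R" by (rule tito_uminus[OF tito])
  have "lex_window n v \<subseteq> R"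
    by (rule lex_window_subset[OF tito]) (use assms(1) v res in blast)+
  moreover have "lex_window (- n) w \<subseteq> R"
  proof (rule lex_window_subset[OF tito'])
    show "k = 0" if "x \<in> set w" "y \<in> set w" "x = y + k * - n" for x y k
      using res[of x y "- k"] that by simp
  qed (use assms(1) w in auto)
  moreover have "(x + k * n, y + l * n) \<in> R" if x: "x \<in> set v" and y: "y \<in> set w" for x y k l
  proof -
    have "v \<noteq> []" "w \<noteq> []" using x y by auto
    then obtain I J where "Is = [I, J]" "is_window n R I (Wax v)" "is_window n R J (Wan w)"
      using Is(2) by (auto simp: windows_of_def list_all2_Cons2)
    then have xy: "(x, y) \<in> R" using Is(1) x y unfolding is_window_def by auto
    have "(x + (k - l) * n, y) \<in> R"
    proof (cases "k \<le> l")
      case True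
      then have "(x + (k - l) * n, x) \<in> R" using tito_chain[OF tito, of x "k - l" 0] v x by simp
      then show ?thesis using xy R(2) by blast
    next
      case False
      then have "(y + 0 * - n, y + (k - l) * - n) \<in> R"
        using tito_chain[OF tito', of y 0 "k - l"] w y by simp
      then have "(x, y + (l - k) * n) \<in> R" using xy R(2)[of x y] by (simp add: algebra_simps)
      then show ?thesis using tito_shift[OF tito, of x "k - l" "y + (l - k) * n"] by (simp add: algebra_simps)
    qed
    then show ?thesis using tito_shift[OF tito, of "x + (k - l) * n" l y] by (simp add: algebra_simps)
  qed
  ultimately show ?thesis unfolding windows_order_def by blast
qed

lemma window_notation_unique:
  assumes n: "n > 0" and R: "is_tito n R" "window_notation n R (windows_of v w)"
    and R': "is_tito n R'" "window_notation n R' (windows_of v w)"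
    and res: "\<And>x y k. x \<in> set v \<union> set w \<Longrightarrow> y \<in> set v \<union> set w \<Longrightarrow> x = y + k * n \<Longrightarrow> k = 0"
    and all: "\<And>z. \<exists>x\<in>set v \<union> set w. \<exists>k. z = x + k * n"
  shows "R = R'"
proof (rule linear_order_eqI[OF tito_linear[OF R(1)] tito_linear[OF R'(1)]])
  show "windows_order n v w \<subseteq> R" by (rule windows_order_subset[OF n R res])
  show "windows_order n v w \<subseteq> R'" by (rule windows_order_subset[OF n R' res])
  show "(x, y) \<in> windows_order n v w \<or> (y, x) \<in> windows_order n v w" for x y
  proof -
    obtain a k b l where x: "x = a + k * n" "a \<in> set v \<union> set w" and y: "y = b + l * n" "b \<in> set v \<union> set w"
      using all by metis
    consider "a \<in> set v" "b \<in> set v" | "a \<in> set w" "b \<in> set w" | "a \<in> set v" "b \<in> set w"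
      | "b \<in> set v" "a \<in> set w" using x y by blast
    then show ?thesis
    proof cases
      case 1
      then show ?thesis using lex_window_total[of a v b k n l] x y unfolding windows_order_def by blast
    next
      case 2
      then have "(x, y) \<in> lex_window (- n) w \<or> (y, x) \<in> lex_window (- n) w"
        using lex_window_total[of a w b "- k" "- n" "- l"] x y by simp
      then show ?thesis unfolding windows_order_def by blast
    qed (use x y in \<open>unfold windows_order_def, blast+\<close>)
  qed
qed

section \<open>Window notation of the order\<close>

context arc_lift
begin

text \<open>
  All points outside \<open>Cyc\<close> precede all points of \<open>Cyc\<close>, since paths of the former do not pass the next
  element of \<open>Cyc\<close> while paths of the latter pass everything. So the blocks are the complement of \<open>Cyc\<close>
  and \<open>Cyc\<close>, apart from an empty one. The hypothesis \<open>uncrossed_v\<close> puts every entry of \<open>v\<close> before all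
  entries translated by \<open>n\<close>.
\<close>

lemma ord_window_notation:
  assumes v: "sorted_wrt strict v" "set v = {z..<z + n} - Cyc"
    and uncrossed_v: "\<forall>x\<in>set v. \<forall>y. over x y \<longrightarrow> y < z + n"
    and w: "w = rev (sorted_list_of_set (Cyc \<inter> {1..n}))"
  shows "window_notation n ord (windows_of v w)"
    and "\<exists>x\<in>set v \<union> set w. \<exists>k. u = x + k * n"
    and "x \<in> set v \<union> set w \<Longrightarrow> y \<in> set v \<union> set w \<Longrightarrow> x = y + k * n \<Longrightarrow> k = 0"
proof -
  note R = titoD[OF ord_tito]
  have uncrossed: "y < z + n" if "x \<in> set v" "over x y" for x y
    using uncrossed_v that by blast
  have setw: "set w = Cyc \<inter> {1..n}" using w by simp
  have NC: "- Cyc = {x + k * n | x k. x \<in> set v}"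
  proof (intro set_eqI iffI)
    fix u assume u: "u \<in> - Cyc"
    obtain k r where r: "u = r + k * n" "r \<in> {z..<z + n}" using shift_into_range[OF n_pos] .
    then have "r \<in> set v" using u Cyc_shift v(2) by auto
    then show "u \<in> {x + k * n | x k. x \<in> set v}" using r by blast
  next
    fix u assume "u \<in> {x + k * n | x k. x \<in> set v}"
    then show "u \<in> - Cyc" using v(2) Cyc_shift by auto
  qed
  have CC: "Cyc = {x + k * n | x k. x \<in> set w}"
  proof (intro set_eqI iffI)
    fix u assume u: "u \<in> Cyc"
    obtain k r where r: "u = r + k * n" "r \<in> {1..<1 + n}" using shift_into_range[OF n_pos] .
    then have "r \<in> set w" using u Cyc_shift setw by auto
    then show "u \<in> {x + k * n | x k. x \<in> set w}" using r by blast
  next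
    fix u assume "u \<in> {x + k * n | x k. x \<in> set w}"
    then show "u \<in> Cyc" using setw Cyc_shift by auto
  qed
  have CC': "Cyc = {x + k * - n | x k. x \<in> set w}"
  proof -
    have "(\<exists>k. u = x + k * n) \<longleftrightarrow> (\<exists>k. u = x + k * - n)" for u x :: int
      by (metis minus_mult_minus minus_minus)
    then show ?thesis unfolding CC by blast
  qed
  show all: "\<exists>x\<in>set v \<union> set w. \<exists>k. u = x + k * n" for u
  proof (cases "u \<in> Cyc")
    case True
    then show ?thesis unfolding CC by blast
  next
    case False
    then have "u \<in> - Cyc" by simp
    then show ?thesis unfolding NC by blast
  qed
  show "k = 0" if x: "x \<in> set v \<union> set w" and y: "y \<in> set v \<union> set w" and eq: "x = y + k * n"
  proof -
    have "x \<in> Cyc \<longleftrightarrow> y \<in> Cyc" using eq Cyc_shift by simp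
    then have "(x \<in> {z..<z + n} \<and> y \<in> {z..<z + n}) \<or> (x \<in> {1..<1 + n} \<and> y \<in> {1..<1 + n})"
      using x y v(2) setw by auto
    then show ?thesis using shifted_range_unique0[OF eq] by blast
  qed
  have NC_C: "(u, c) \<in> ord \<and> u \<noteq> c" if "u \<notin> Cyc" "c \<in> Cyc" for u c
    using not_Cyc_before_Cyc[OF that] that by auto
  have v_block: "is_block ord (- Cyc) \<and> is_window n ord (- Cyc) (Wax v)" if ne: "v \<noteq> []"
  proof -
    have st: "(x, y + n) \<in> ord \<and> x \<noteq> y + n" if "x \<in> set v" "y \<in> set v" for x y
    proof -
      have "x < y + n" using that v(2) by auto
      moreover have "\<not> over x (y + n)" using uncrossed[OF that(1), of "y + n"] that v(2) by auto
      ultimately show ?thesis by (auto simp: ord_def)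
    qed
    have cvx: "\<forall>a\<in>- Cyc. \<forall>c\<in>- Cyc. \<forall>b. (a, b) \<in> ord \<and> (b, c) \<in> ord \<longrightarrow> b \<in> - Cyc"
      using NC_C R(3) by blast
    have srt: "sorted_wrt (\<lambda>u v. (u, v) \<in> ord \<and> u \<noteq> v) v"
      using v(1) by (simp add: strict_def[abs_def])
    note wb = window_block[OF ord_tito disjI1[OF refl] _ ne srt st NC cvx]
    have n0: "n \<noteq> 0" using n_pos by simp
    have "set v \<subseteq> - Cyc" using v(2) by blast
    then show ?thesis using wb[OF n0] unfolding is_window_def waxing_def by simp
  qed
  have w_block: "is_block ord Cyc \<and> is_window n ord Cyc (Wan w)" if ne: "w \<noteq> []"
  proof -
    have st: "(x, y + - n) \<in> ord \<and> x \<noteq> y + - n" if "x \<in> set w" "y \<in> set w" for x y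
    proof -
      have "y + - n < x" using that setw by auto
      moreover have "y + - n \<in> Cyc" using that setw Cyc_shift[of y "-1"] by simp
      ultimately show ?thesis using ord_Cyc[of "y + - n" x] by simp
    qed
    have cvx: "\<forall>a\<in>Cyc. \<forall>c\<in>Cyc. \<forall>b. (a, b) \<in> ord \<and> (b, c) \<in> ord \<longrightarrow> b \<in> Cyc"
      using NC_C R(3) by blast
    have srt: "sorted_wrt (\<lambda>u v. (u, v) \<in> ord \<and> u \<noteq> v) w"
    proof -
      have "sorted_wrt (<) (sorted_list_of_set (Cyc \<inter> {1..n}))" by simp
      then have "sorted_wrt (\<lambda>u v. (v, u) \<in> ord \<and> v \<noteq> u) (sorted_list_of_set (Cyc \<inter> {1..n}))"
        by (rule sorted_wrt_mono_rel[rotated]) (use ord_Cyc in auto)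
      then show ?thesis unfolding w sorted_wrt_rev .
    qed
    note wb = window_block[OF tito_uminus[OF ord_tito] disjI2[OF refl] _ ne srt st CC' cvx]
    have n0: "- n \<noteq> 0" using n_pos by simp
    have "(x + n, x) \<in> ord \<and> x + n \<noteq> x" if "x \<in> Cyc" for x
    proof -
      have "x + n \<in> Cyc" using that Cyc_shift[of x 1] by simp
      then show ?thesis using wb(4)[OF n0, of "x + n"] n_pos by simp
    qed
    then show ?thesis using wb(1-3)[OF n0] setw unfolding is_window_def waning_def by auto
  qed
  define Is where "Is = (if v = [] then [] else [- Cyc]) @ (if w = [] then [] else [Cyc])"
  have vC: "v = [] \<longleftrightarrow> - Cyc = {}"
  proof
    assume "- Cyc = {}"
    moreover have "hd v \<in> set v" if "v \<noteq> []" using that by simp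
    ultimately show "v = []" using v(2) by blast
  qed (simp add: NC)
  have wC: "w = [] \<longleftrightarrow> Cyc = {}"
  proof
    assume "Cyc = {}"
    then show "w = []" using w by simp
  next
    assume "w = []"
    then show "Cyc = {}" using CC by simp
  qed
  have "{I. is_block ord I} = set Is"
  proof (rule blocks_eq[OF ord_linear])
    show "is_block ord I" if "I \<in> set Is" for I
      using that v_block w_block unfolding Is_def by (auto split: if_splits)
    show "\<Union> (set Is) = UNIV" unfolding Is_def vC wC by auto
  qed
  moreover have "sorted_wrt (\<lambda>I J. \<forall>x\<in>I. \<forall>y\<in>J. (x, y) \<in> ord \<and> x \<noteq> y) Is"
    unfolding Is_def using NC_C by auto
  moreover have "list_all2 (is_window n ord) Is (windows_of v w)"
    unfolding Is_def windows_of_def using v_block w_block by auto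
  ultimately show "window_notation n ord (windows_of v w)" unfolding window_notation_def by blast
qed

end

section \<open>The cycle of a diagram\<close>

locale diagram = arc_lift n "lift n E" for n :: int and E :: "(int \<times> int) set" +
  assumes E_sub: "E \<subseteq> {1..n} \<times> {1..n}"
begin

abbreviation "Lift \<equiv> lift n E"

lemma E_iff: "a \<in> {1..n} \<Longrightarrow> b \<in> {1..n} \<Longrightarrow> (a, b) \<in> E \<longleftrightarrow> (a, arc_end n a b) \<in> Lift"
  using lift_arc_end_iff[OF E_sub] by blast

lemma E_lift: "(a, b) \<in> E \<Longrightarrow> (a, arc_end n a b) \<in> Lift"
  using liftI[of a b E 0 n] by simp

lemma E_out: "(a, b) \<in> E \<Longrightarrow> (a, b') \<in> E \<Longrightarrow> b = b'"
  using arc_lift_single_valued(1)[OF arc_lift_axioms E_sub] by (rule single_valuedD)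

lemma arc_end_cases: "arc_end n a b = b \<or> arc_end n a b = b + n"
  by (simp add: arc_end_def)

lemma arc_end_Cyc: "arc_end n a b \<in> Cyc \<longleftrightarrow> b \<in> Cyc"
  using arc_end_cases[of a b] Cyc_shift[of b 1] by auto

definition cycle_arcs :: "(int \<times> int) set" where
  "cycle_arcs = {(a, b) \<in> E. a \<in> Cyc}"

lemma cycle_arcs_Cyc: "(a, b) \<in> E \<Longrightarrow> a \<in> Cyc \<longleftrightarrow> b \<in> Cyc"
  using Cyc_arc[OF E_lift] arc_end_Cyc by blast

lemma zip_rotate1:
  "set (zip p (rotate1 p)) = {(p ! i, p ! (Suc i mod length p)) | i. i < length p}"
  by (auto simp: set_zip nth_rotate1)

lemma cycle_vertices_Cyc:
  assumes p: "set (zip p (rotate1 p)) \<subseteq> E" "a \<in> set p"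
  shows "a \<in> Cyc"
proof -
  have step: "\<exists>a'\<in>set p. (a, a') \<in> E" if "a \<in> set p" for a
  proof -
    obtain i where i: "i < length p" "a = p ! i" using \<open>a \<in> set p\<close> by (metis in_set_conv_nth)
    then have "(a, p ! (Suc i mod length p)) \<in> E" using p(1) unfolding zip_rotate1 by blast
    moreover have "Suc i mod length p < length p" using i by (intro mod_less_divisor) auto
    ultimately show ?thesis by (meson nth_mem)
  qed
  have "over a (a + int N)" if "a \<in> set p" for a N
    using that
  proof (induction N arbitrary: a)
    case 0
    show ?case by (auto simp: over_def)
  next
    case (Suc N)
    obtain a' where a': "a' \<in> set p" "(a, a') \<in> E" using step Suc(2) by blast
    define e where "e = arc_end n a a'"
    have "over e (e + int N)"
      using Suc(1)[OF a'(1)] over_shift[of a' 1 "a' + int N"] arc_end_cases[of a a'] unfolding e_def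
      by (auto simp: algebra_simps)
    moreover have e: "(a, e) \<in> Lift" using E_lift a'(2) unfolding e_def by blast
    ultimately show ?case using over_arc[OF e] over_mono[of a "e + int N"] len[OF e] by simp
  qed
  then have "over a (a + int (nat (b - a)))" for b using p(2) by blast
  then have "over a b" for b using over_mono[of a "a + int (nat (b - a))" b] by simp
  then show ?thesis unfolding Cyc_def by blast
qed

text \<open>
  Every cycle consists of all arcs at \<open>Cyc\<close>: starting from one of its vertices, the lifted path
  visits every later element of \<open>Cyc\<close>.
\<close>

lemma cycle_eq:
  assumes "is_cycle E C"
  shows "C = cycle_arcs" "Cyc \<noteq> {}"
proof -
  obtain p where p: "p \<noteq> []" "C = set (zip p (rotate1 p))" "C \<subseteq> E"
    using assms unfolding is_cycle_def by blast
  have pC: "a \<in> Cyc" if "a \<in> set p" for a using cycle_vertices_Cyc that p(2,3) by blast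
  obtain c where c: "c \<in> set p" using p(1) by (meson list.set_sel(1))
  then show "Cyc \<noteq> {}" using pC by blast
  have nxt: "\<exists>b\<in>set p. (a, b) \<in> C" if "a \<in> set p" for a
  proof -
    obtain i where i: "i < length p" "a = p ! i" using \<open>a \<in> set p\<close> by (metis in_set_conv_nth)
    moreover have "Suc i mod length p < length p" using i by (intro mod_less_divisor) auto
    ultimately show ?thesis unfolding p(2) zip_rotate1 using nth_mem by blast
  qed
  have prng: "a \<in> {1..n}" if "a \<in> set p" for a using nxt[OF that] p(3) E_sub by blast
  have closed: "\<exists>a\<in>set p. \<exists>k. z = a + k * n" if "(c', z) \<in> Lift\<^sup>*" "\<exists>a\<in>set p. \<exists>k. c' = a + k * n" for c' z
    using that
  proof (induction rule: rtrancl_induct)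
    case (step y z)
    then obtain a k where a: "a \<in> set p" "y = a + k * n" by blast
    obtain b where b: "b \<in> set p" "(a, b) \<in> C" using nxt[OF a(1)] by blast
    then have "(y, arc_end n a b + k * n) \<in> Lift" using liftI[of a b E k n] a p(3) by blast
    then have "z = arc_end n a b + k * n" using out_unique step(2) by blast
    then have "z = b + k * n \<or> z = b + (k + 1) * n"
      using arc_end_cases[of a b] by (auto simp: algebra_simps)
    then show ?case using b(1) by blast
  qed blast
  show "C = cycle_arcs"
  proof
    show "C \<subseteq> cycle_arcs"
    proof
      fix e assume e: "e \<in> C"
      then have "fst e \<in> set p" unfolding p(2) by (metis in_set_zipE prod.collapse)
      then show "e \<in> cycle_arcs" unfolding cycle_arcs_def using e p(3) pC by auto
    qed
    show "cycle_arcs \<subseteq> C"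
    proof clarify
      fix a b assume "(a, b) \<in> cycle_arcs"
      then have ab: "(a, b) \<in> E" "a \<in> Cyc" unfolding cycle_arcs_def by auto
      have a: "a \<in> {1..n}" using ab E_sub by blast
      have "c + (-1) * n \<le> a" using a prng[OF c] by auto
      then have "(c + (-1) * n, a) \<in> Lift\<^sup>*" using Cyc_connected ab(2) pC[OF c] Cyc_shift by blast
      then obtain a' k where a': "a' \<in> set p" "a = a' + k * n" using closed c by blast
      then have "k = 0 \<and> a = a'"
        by (intro shifted_range_unique0[of a a' k n 1]) (use a prng[OF a'(1)] in auto)
      then have "a \<in> set p" using a' by simp
      then obtain b' where b': "(a, b') \<in> C" using nxt by blast
      then have "b' = b" using E_out ab(1) p(3) by blast
      then show "(a, b) \<in> C" using b' by simp
    qed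
  qed
qed

text \<open>
  Listing \<open>Cyc \<inter> {1..n}\<close> in increasing order lists the cycle once around, since consecutive
  elements of \<open>Cyc\<close> are joined by arcs and the last one is joined to the first one plus \<open>n\<close>.
\<close>

lemma cycle_arcs_cycle:
  assumes "Cyc \<noteq> {}"
  shows "is_cycle E cycle_arcs"
proof -
  define p where "p = sorted_list_of_set (Cyc \<inter> {1..n})"
  have setp: "set p = Cyc \<inter> {1..n}" and dist: "distinct p" and srt: "sorted_wrt (<) p"
    unfolding p_def by auto
  have ne: "p \<noteq> []"
  proof -
    obtain c where c: "c \<in> Cyc" using assms by blast
    obtain k r where "c = r + k * n" "r \<in> {1..<1 + n}" using shift_into_range[OF n_pos] .
    then have "r \<in> set p" using c Cyc_shift unfolding setp by auto
    then show ?thesis by auto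
  qed
  have less_nth: "i < j" if "i < length p" "j < length p" "p ! i < p ! j" for i j
    using srt that unfolding sorted_wrt_iff_nth_less by (metis linorder_neqE_nat order_less_asym less_irrefl)
  have nth_less: "p ! i < p ! j" if "i < j" "j < length p" for i j
    using srt that unfolding sorted_wrt_iff_nth_less by blast
  have arc: "(p ! i, p ! (Suc i mod length p)) \<in> E" if i: "i < length p" for i
  proof -
    have pi: "p ! i \<in> Cyc" "p ! i \<in> {1..n}" using i setp nth_mem by blast+
    obtain y where y: "(p ! i, y) \<in> Lift" "y \<in> Cyc" using Cyc_next[OF pi(1)] .
    note l = len[OF y(1)]
    show ?thesis
    proof (cases "Suc i < length p")
      case True
      have s: "p ! Suc i \<in> Cyc" "p ! Suc i \<in> {1..n}" using True setp nth_mem by blast+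
      have "y \<le> p ! Suc i" using Cyc_between[OF y(1) s(1)] nth_less[of i "Suc i"] True by simp
      then have "y \<in> set p" using y(2) l pi s unfolding setp by auto
      then obtain j where j: "j < length p" "y = p ! j" by (metis in_set_conv_nth)
      then have "i < j" using less_nth[of i j] i l by simp
      then have "p ! Suc i \<le> y" using nth_less[of "Suc i" j] j by (cases "j = Suc i") auto
      then have "y = p ! Suc i" using \<open>y \<le> p ! Suc i\<close> by simp
      moreover have "arc_end n (p ! i) (p ! Suc i) = p ! Suc i"
        using nth_less[of i "Suc i"] True by (simp add: arc_end_def)
      ultimately show ?thesis using E_iff[OF pi(2) s(2)] y(1) True by simp
    next
      case False
      then have il: "i = length p - 1" using i by simp
      have h: "p ! 0 \<in> Cyc" "p ! 0 \<in> {1..n}" using ne setp nth_mem by blast+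
      have hi: "p ! 0 \<le> p ! i" using nth_less[of 0 i] i by (cases "i = 0") auto
      have "y > n"
      proof (rule ccontr)
        assume "\<not> y > n"
        then have "y \<in> set p" using y(2) l pi unfolding setp by auto
        then obtain j where j: "j < length p" "y = p ! j" by (metis in_set_conv_nth)
        then show False using less_nth[of i j] i l il by simp
      qed
      have "p ! 0 + n \<in> Cyc" using Cyc_shift[of "p ! 0" 1] h by simp
      then have "y \<le> p ! 0 + n" using Cyc_between[OF y(1)] h pi by simp
      moreover have "p ! 0 \<le> y - n"
      proof -
        have "y - n \<in> Cyc" using Cyc_shift[of y "-1"] y(2) by simp
        then have "y - n \<in> set p" unfolding setp using \<open>y > n\<close> \<open>y \<le> p ! 0 + n\<close> h by simp
        then obtain j where "j < length p" "y - n = p ! j" by (metis in_set_conv_nth)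
        then show ?thesis using nth_less[of 0 j] by (cases "j = 0") auto
      qed
      ultimately have "y = p ! 0 + n" by simp
      then have "y = arc_end n (p ! i) (p ! 0)" using hi by (simp add: arc_end_def)
      moreover have "Suc i mod length p = 0" using il ne by simp
      ultimately show ?thesis using E_iff[OF pi(2) h(2)] y(1) by simp
    qed
  qed
  then have sub: "set (zip p (rotate1 p)) \<subseteq> E" unfolding zip_rotate1 by blast
  then have "is_cycle E (set (zip p (rotate1 p)))" unfolding is_cycle_def using ne dist by blast
  then show ?thesis using cycle_eq(1) by metis
qed

lemma has_cycle_iff: "has_cycle E \<longleftrightarrow> Cyc \<noteq> {}"
  unfolding has_cycle_def using cycle_eq(2) cycle_arcs_cycle by blast

lemma cycle_of_eq: "Cyc \<noteq> {} \<Longrightarrow> cycle_of E = cycle_arcs"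
  unfolding cycle_of_def by (rule the_equality) (rule cycle_arcs_cycle cycle_eq(1), assumption)+

lemma Field_cycle_of:
  assumes "Cyc \<noteq> {}"
  shows "Field (cycle_of E) = Cyc \<inter> {1..n}"
proof
  show "Field (cycle_of E) \<subseteq> Cyc \<inter> {1..n}"
    unfolding cycle_of_eq[OF assms] cycle_arcs_def Field_def
    using E_sub cycle_arcs_Cyc by blast
  show "Cyc \<inter> {1..n} \<subseteq> Field (cycle_of E)"
  proof
    fix a assume a: "a \<in> Cyc \<inter> {1..n}"
    then obtain y where "(a, y) \<in> Lift" using Cyc_next by blast
    then obtain b where "(a, b) \<in> E" using mem_lift_base[OF E_sub] a by blast
    then show "a \<in> Field (cycle_of E)"
      unfolding cycle_of_eq[OF assms] cycle_arcs_def Field_def using a by blast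
  qed
qed

end

section \<open>Drawings and noncrossing lifted arcs\<close>

text \<open>
  The exponential is the universal cover of the punctured plane. It sends \<open>ang n x\<close> to the
  boundary point at the angular position of \<open>x\<close>, and the unit disc lifts to \<open>Re z \<le> 0\<close>.
\<close>

definition ang :: "int \<Rightarrow> real \<Rightarrow> complex" where
  "ang n x = \<i> * of_real (- (2 * pi * x / of_int n))"

lemma ang_simps: "Re (ang n x) = 0" "Im (ang n x) = - (2 * pi * x / of_int n)"
  by (auto simp: ang_def)

lemma ang_add: "ang n (x + y) = ang n x + ang n y"
  by (simp add: ang_def algebra_simps add_divide_distrib)

lemma exp_ang: "exp (ang n x) = cis (- (2 * pi * x / of_int n))"
  by (simp add: ang_def cis_conv_exp)

lemma Im_ang_less: "n > 0 \<Longrightarrow> v < u \<Longrightarrow> Im (ang n (of_int u)) < Im (ang n (of_int v))"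
  by (simp add: ang_simps divide_strict_right_mono)

lemma marked_ang: "marked n i = exp (ang n (of_int i))"
  by (simp add: exp_ang marked_def)

lemma exp_ang_period:
  assumes "n \<noteq> 0"
  shows "exp (ang n (of_int (k * n))) = 1"
proof -
  have "- (2 * pi * of_int (k * n) / of_int n) = 2 * pi * of_int (- k)" using assms by simp
  then show ?thesis unfolding exp_ang using cis_multiple_2pi[of "of_int (- k)"] by (metis Ints_of_int)
qed

lemma exp_ang_eq:
  assumes "n > 0" "exp (ang n x) = exp (ang n y)"
  obtains k :: int where "x = y + of_int (k * n)"
proof -
  obtain k :: int where "ang n x = ang n y + of_real (of_int (2 * k) * pi) * \<i>"
    using assms(2) unfolding exp_eq by auto
  then have "Im (ang n x) = Im (ang n y) + of_int (2 * k) * pi" by simp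
  then have "- (2 * pi * x / of_int n) = - (2 * pi * y / of_int n) + 2 * of_int k * pi"
    by (simp add: ang_simps)
  then have "2 * pi * x = 2 * pi * (y - of_int k * of_int n)"
    using assms(1) by (simp add: field_simps)
  then have "x = y - of_int k * of_int n" by simp
  then show thesis using that[of "- k"] by simp
qed

lemma marked_eq:
  assumes "n > 0" "marked n i = marked n j"
  obtains k where "i = j + k * n"
proof -
  obtain k :: int where "real_of_int i = real_of_int j + of_int (k * n)"
    using exp_ang_eq[OF assms(1)] assms(2) unfolding marked_ang by blast
  then have "i = j + k * n" by linarith
  then show thesis by (rule that)
qed

lemma marked_shift: "n > 0 \<Longrightarrow> marked n (i + k * n) = marked n i"
  using exp_ang_period[of n k] by (simp add: marked_ang ang_add exp_add)

text \<open>
  The Fashoda theorem, that two paths in a rectangle meet if their end points interlace on one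
  side, in the form needed for logarithms of curves in the unit disc.
\<close>

lemma fashoda_half_plane:
  fixes f g :: "real \<Rightarrow> complex"
  assumes "path f" "path g"
    and le: "\<And>z. z \<in> path_image f \<union> path_image g \<Longrightarrow> Re z \<le> 0"
    and ends: "Re (pathstart f) = 0" "Re (pathfinish f) = 0" "Re (pathstart g) = 0" "Re (pathfinish g) = 0"
    and ord: "Im (pathfinish g) < Im (pathfinish f)" "Im (pathfinish f) < Im (pathstart g)"
      "Im (pathstart g) < Im (pathstart f)"
  shows "path_image f \<inter> path_image g \<noteq> {}"
proof -
  define T :: "complex \<Rightarrow> real^2" where "T z = vector [- Im z, - Re z]" for z
  have T: "T z $ 1 = - Im z" "T z $ 2 = - Re z" for z by (simp_all add: T_def)
  have cont: "continuous_on S T" for S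
  proof -
    have "T = (\<lambda>z. (- Im z) *\<^sub>R axis 1 1 + (- Re z) *\<^sub>R axis 2 1)"
      by (rule ext) (simp add: vec_eq_iff forall_2 T axis_def)
    then show ?thesis by (auto intro!: continuous_intros)
  qed
  have paths: "path (T \<circ> f)" "path (T \<circ> g)"
    using assms(1,2) cont by (auto intro: path_continuous_image)
  have "bounded (path_image (T \<circ> f) \<union> path_image (T \<circ> g))"
    using paths by (simp add: bounded_path_image)
  then obtain B where B: "\<And>v. v \<in> path_image (T \<circ> f) \<union> path_image (T \<circ> g) \<Longrightarrow> norm v \<le> B"
    unfolding bounded_iff by blast
  define a b :: "real^2" where "a = vector [- B, 0]" and "b = vector [B, B]"
  have box: "path_image (T \<circ> f) \<union> path_image (T \<circ> g) \<subseteq> cbox a b"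
  proof
    fix v assume v: "v \<in> path_image (T \<circ> f) \<union> path_image (T \<circ> g)"
    then obtain z where z: "z \<in> path_image f \<union> path_image g" "v = T z"
      by (auto simp: path_image_compose)
    have "\<bar>v $ 1\<bar> \<le> B" "\<bar>v $ 2\<bar> \<le> B" using B[OF v] component_le_norm_cart order_trans by blast+
    then show "v \<in> cbox a b" using le[OF z(1)] z(2) by (auto simp: mem_box_cart forall_2 a_def b_def T)
  qed
  obtain v where "v \<in> path_image (T \<circ> f)" "v \<in> path_image (T \<circ> g)"
  proof (rule fashoda_interlace[OF paths])
    show "path_image (T \<circ> f) \<subseteq> cbox a b" "path_image (T \<circ> g) \<subseteq> cbox a b" using box by auto
  qed (use ends ord in \<open>auto simp: pathstart_compose pathfinish_compose T a_def\<close>)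
  then obtain z w where zw: "z \<in> path_image f" "w \<in> path_image g" "T z = T w"
    by (auto simp: path_image_compose)
  then have "z = w" using T by (metis complex_eqI neg_equal_iff_equal)
  then show ?thesis using zw by blast
qed

lemma arc_end_bounds: "a \<in> {1..n} \<Longrightarrow> b \<in> {1..n} \<Longrightarrow> a < arc_end n a b \<and> arc_end n a b \<le> a + n"
  by (auto simp: arc_end_def)

lemma bump_bounds: "0 \<le> t * (1 - t) \<and> t * (1 - t) \<le> 1 / 4" if "t \<in> {0..1::real}"
proof -
  have "t * (1 - t) = 1 / 4 - (t - 1 / 2)\<^sup>2" by (simp add: power2_eq_square algebra_simps)
  moreover have "0 \<le> t * (1 - t)" using that by simp
  ultimately show ?thesis by simp
qed

lemma bump_pos: "0 < t * (1 - t)" if "t \<in> {0<..<1::real}"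
  using that by simp

lemma annulus_nonzero: "annulus \<subseteq> - {0}"
  by (auto simp: annulus_def)

lemma represents_arcD:
  assumes "represents_arc n (a, b) g"
  shows "simple_curve n a b g" "homotopic_paths (- {0}) (model_arc n a b) g"
proof -
  have hom: "homotopic_with_canon (simple_curve n a b) {0..1} annulus (model_arc n a b) g"
    using assms by (simp add: represents_arc_def)
  show sc: "simple_curve n a b g"
    using homotopic_with_imp_property[OF hom] by blast
  have "simple_curve n a b (model_arc n a b)"
    using homotopic_with_imp_property[OF hom] by blast
  then have ends: "pathstart (model_arc n a b) = marked n a" "pathfinish (model_arc n a b) = marked n b"
    unfolding simple_curve_def by auto
  have "homotopic_with_canon (\<lambda>r. pathstart r = pathstart (model_arc n a b) \<and>
      pathfinish r = pathfinish (model_arc n a b)) {0..1} annulus (model_arc n a b) g"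
    using hom by (rule homotopic_with_mono) (simp add: ends simple_curve_def)
  then show "homotopic_paths (- {0}) (model_arc n a b) g"
    unfolding homotopic_paths_def
    by (rule homotopic_with_subset_right) (rule annulus_nonzero)
qed

text \<open>
  A logarithm of a drawn arc. Lifting through \<open>exp\<close> the isotopy from the model curve, whose
  logarithm is explicit, shows where the lift ends.
\<close>

lemma arc_logarithm:
  assumes n: "n > 0" and g: "represents_arc n (a, b) g"
  obtains h where "path h" "h 0 = ang n (of_int a)" "h 1 = ang n (of_int (arc_end n a b))"
    "\<And>t. t \<in> {0..1} \<Longrightarrow> exp (h t) = g t" "\<And>t. t \<in> {0..1} \<Longrightarrow> Re (h t) \<le> 0"
    "\<And>t. t \<in> {0<..<1} \<Longrightarrow> Re (h t) < 0"
proof -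
  note sc = represents_arcD(1)[OF g] and hom = represents_arcD(2)[OF g]
  define m where "m t = of_real (ln (1 - t * (1 - t))) +
    ang n (of_int a + t * of_int (arc_end n a b - a))" for t
  have pos: "1 - t * (1 - t) > 0" if "t \<in> {0..1}" for t :: real using bump_bounds[OF that] by simp
  have pm: "path m"
    unfolding path_def m_def ang_def using pos n by (force intro!: continuous_intros)
  have em: "exp (m t) = model_arc n a b t" if "t \<in> {0..1}" for t
  proof -
    have "exp (of_real (ln (1 - t * (1 - t))) :: complex) = of_real (1 - t * (1 - t))"
      using pos[OF that] by (simp only: exp_of_real exp_ln)
    then show ?thesis by (simp add: m_def exp_add exp_ang model_arc_def)
  qed
  have m01: "m 0 = ang n (of_int a)" "m 1 = ang n (of_int (arc_end n a b))" by (simp_all add: m_def)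
  have pg: "path g" "path_image g \<subseteq> - {0}" and pmod: "path (model_arc n a b)" "path_image (model_arc n a b) \<subseteq> - {0}"
    using homotopic_paths_imp_path[OF hom] homotopic_paths_imp_subset[OF hom] by auto
  have "pathstart g = exp (ang n (of_int a))"
    using sc unfolding simple_curve_def marked_ang by simp
  then obtain h where h: "path h" "path_image h \<subseteq> UNIV" "pathstart h = ang n (of_int a)"
    "\<And>t. t \<in> {0..1} \<Longrightarrow> exp (h t) = g t"
    using covering_space_lift_path_strong[OF covering_space_exp_punctured_plane UNIV_I pg] by metis
  have "pathfinish m = pathfinish h"
    by (rule covering_space_monodromy[OF covering_space_exp_punctured_plane pmod pg hom pm _ _ h(1,2)])
      (use em h m01 in \<open>auto simp: pathstart_def\<close>)
  then have h1: "h 1 = ang n (of_int (arc_end n a b))" using m01 by (simp add: pathfinish_def)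
  have h0: "h 0 = ang n (of_int a)" using h(3) by (simp add: pathstart_def)
  have neg: "Re (h t) < 0" if "t \<in> {0<..<1}" for t
  proof -
    have "norm (g t) < 1" using sc that unfolding simple_curve_def by blast
    moreover have "norm (g t) = exp (Re (h t))" using h(4)[of t] that by (metis norm_exp_eq_Re greaterThanLessThan_iff atLeastAtMost_iff less_imp_le)
    ultimately show ?thesis by simp
  qed
  have le: "Re (h t) \<le> 0" if "t \<in> {0..1}" for t
  proof -
    consider "t = 0" | "t = 1" | "t \<in> {0<..<1}" using \<open>t \<in> {0..1}\<close> by force
    then show ?thesis by cases (use h0 h1 neg[of t] in \<open>simp_all add: ang_simps\<close>)
  qed
  show thesis by (rule that[OF h(1) h0 h1 h(4) le neg])
qed

lemma lifted_arc:
  assumes n: "n > 0" and D: "is_drawing n E D" and L: "(x, y) \<in> lift n E"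
  obtains a b k h where "(a, b) \<in> E" "x = a + k * n" "y = arc_end n a b + k * n"
    "path h" "h 0 = ang n (of_int x)" "h 1 = ang n (of_int y)"
    "\<And>t. t \<in> {0..1} \<Longrightarrow> exp (h t) = D (a, b) t" "\<And>t. t \<in> {0..1} \<Longrightarrow> Re (h t) \<le> 0"
    "\<And>t. t \<in> {0<..<1} \<Longrightarrow> Re (h t) < 0"
proof -
  obtain a b k where ab: "(a, b) \<in> E" "x = a + k * n" "y = arc_end n a b + k * n"
    using L by (rule liftE)
  have rep: "represents_arc n (a, b) (D (a, b))" using D ab(1) unfolding is_drawing_def by blast
  obtain h where h: "path h" "h 0 = ang n (of_int a)" "h 1 = ang n (of_int (arc_end n a b))"
    "\<And>t. t \<in> {0..1} \<Longrightarrow> exp (h t) = D (a, b) t" "\<And>t. t \<in> {0..1} \<Longrightarrow> Re (h t) \<le> 0"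
    "\<And>t. t \<in> {0<..<1} \<Longrightarrow> Re (h t) < 0"
    using arc_logarithm[OF n rep] by metis
  define c where "c = ang n (of_int (k * n))"
  have c: "exp c = 1" "Re c = 0" using n exp_ang_period[of n k] by (auto simp: c_def ang_simps)
  show thesis
  proof (rule that[OF ab])
    show "path (\<lambda>t. h t + c)" using h(1) unfolding path_def by (intro continuous_intros)
    show "h 0 + c = ang n (of_int x)" "h 1 + c = ang n (of_int y)"
      using h(2,3) ab by (simp_all add: c_def ang_add)
    show "exp (h t + c) = D (a, b) t" if "t \<in> {0..1}" for t using h(4)[OF that] c by (simp add: exp_add)
    show "Re (h t + c) \<le> 0" if "t \<in> {0..1}" for t using h(5)[OF that] c by simp
    show "Re (h t + c) < 0" if "t \<in> {0<..<1}" for t using h(6)[OF that] c by simp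
  qed
qed

text \<open>
  If two lifted arcs crossed combinatorially, their end points would interlace, so the
  logarithms of their drawings would meet. For different arcs this contradicts disjointness of
  the drawing; translates of one arc cannot interlace, as it makes at most one full turn.
\<close>

lemma drawing_noncrossing:
  assumes n: "n > 0" and E: "E \<subseteq> {1..n} \<times> {1..n}" and D: "is_drawing n E D"
    and xy: "(x, y) \<in> lift n E" and xy': "(x', y') \<in> lift n E" and lt: "x < x'" "x' < y"
  shows "y' \<le> y"
proof (rule ccontr)
  assume gt: "\<not> y' \<le> y"
  obtain a b k f where f: "(a, b) \<in> E" "x = a + k * n" "y = arc_end n a b + k * n"
    "path f" "f 0 = ang n (of_int x)" "f 1 = ang n (of_int y)"
    "\<And>t. t \<in> {0..1} \<Longrightarrow> exp (f t) = D (a, b) t" "\<And>t. t \<in> {0..1} \<Longrightarrow> Re (f t) \<le> 0"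
    "\<And>t. t \<in> {0<..<1} \<Longrightarrow> Re (f t) < 0" using lifted_arc[OF n D xy] by metis
  obtain a' b' k' g where g: "(a', b') \<in> E" "x' = a' + k' * n" "y' = arc_end n a' b' + k' * n"
    "path g" "g 0 = ang n (of_int x')" "g 1 = ang n (of_int y')"
    "\<And>t. t \<in> {0..1} \<Longrightarrow> exp (g t) = D (a', b') t" "\<And>t. t \<in> {0..1} \<Longrightarrow> Re (g t) \<le> 0"
    "\<And>t. t \<in> {0<..<1} \<Longrightarrow> Re (g t) < 0" using lifted_arc[OF n D xy'] by metis
  note Imlt = Im_ang_less[OF n]
  have "path_image f \<inter> path_image g \<noteq> {}"
  proof (rule fashoda_half_plane[OF f(4) g(4)])
    show "Re z \<le> 0" if "z \<in> path_image f \<union> path_image g" for z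
      using that f(8) g(8) unfolding path_image_def by blast
  qed (use f(5,6) g(5,6) lt gt Imlt in \<open>auto simp: pathstart_def pathfinish_def ang_simps(1)\<close>)
  then obtain p where "p \<in> f ` {0..1}" "p \<in> g ` {0..1}" unfolding path_image_def by blast
  then obtain s t where st: "s \<in> {0..1}" "t \<in> {0..1}" "f s = g t" by (metis imageE)
  have ne: "ang n (of_int u) \<noteq> ang n (of_int v)" if "u \<noteq> v" for u v :: int
    using Imlt[of u v] Imlt[of v u] that by (metis linorder_neqE less_irrefl)
  have ne4: "ang n (of_int x) \<noteq> ang n (of_int x')" "ang n (of_int x) \<noteq> ang n (of_int y')"
    "ang n (of_int y) \<noteq> ang n (of_int x')" "ang n (of_int y) \<noteq> ang n (of_int y')"
    by (rule ne; use lt gt in simp)+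
  have s: "s \<in> {0<..<1} \<longleftrightarrow> Re (f s) < 0" if "s \<in> {0..1}" for s
  proof -
    consider "s = 0" | "s = 1" | "s \<in> {0<..<1}" using \<open>s \<in> {0..1}\<close> by force
    then show ?thesis by cases (use f(5,6) f(9)[of s] in \<open>simp_all add: ang_simps\<close>)
  qed
  have t: "t \<in> {0<..<1} \<longleftrightarrow> Re (g t) < 0" if "t \<in> {0..1}" for t
  proof -
    consider "t = 0" | "t = 1" | "t \<in> {0<..<1}" using \<open>t \<in> {0..1}\<close> by force
    then show ?thesis by cases (use g(5,6) g(9)[of t] in \<open>simp_all add: ang_simps\<close>)
  qed
  have iff: "s \<in> {0<..<1} \<longleftrightarrow> t \<in> {0<..<1}" using s[OF st(1)] t[OF st(2)] st(3) by simp
  show False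
  proof (cases "s \<in> {0<..<1}")
    case False
    then have "t \<notin> {0<..<1}" using iff by blast
    then have "s = 0 \<or> s = 1" "t = 0 \<or> t = 1" using False st(1,2) by auto
    then show False using st(3) f(5,6) g(5,6) ne4 by auto
  next
    case True
    then have "t \<in> {0<..<1}" using iff by simp
    moreover have "D (a, b) s = D (a', b') t" using f(7)[OF st(1)] g(7)[OF st(2)] st(3) by simp
    ultimately have "D (a, b) ` {0<..<1} \<inter> D (a', b') ` {0<..<1} \<noteq> {}" using True by blast
    then have eq: "(a, b) = (a', b')" using D f(1) g(1) unfolding is_drawing_def by blast
    have "y \<le> x + n" using arc_end_bounds[of a n b] f(1-3) E by auto
    moreover have "k < k'"
    proof -
      have "k * n < k' * n" using eq lt(1) f(2) g(2) by simp
      then show ?thesis using n mult_less_cancel_right_pos by blast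
    qed
    then have "x + n \<le> x'"
      using eq f(2) g(2) n mult_right_mono[of "k + 1" k' n] by (simp add: algebra_simps)
    ultimately show False using lt by simp
  qed
qed

lemma drawing_diagram:
  assumes n: "n > 0" and nad: "noncrossing_arc_diagram n E" and D: "is_drawing n E D"
  shows "diagram n E"
proof -
  have E: "E \<subseteq> {1..n} \<times> {1..n}" and sv: "single_valued E" "single_valued (E\<inverse>)"
    using nad unfolding noncrossing_arc_diagram_def by auto
  show ?thesis
  proof
    show "n > 0" "E \<subseteq> {1..n} \<times> {1..n}" by fact+
    show "x < y \<and> y \<le> x + n" if "(x, y) \<in> lift n E" for x y
      using that arc_end_bounds E by (auto simp: lift_def)
    show "(x + n, y + n) \<in> lift n E \<longleftrightarrow> (x, y) \<in> lift n E" for x y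
      using lift_shift[of x 1 n y E] by simp
    show "y' \<le> y" if "(x, y) \<in> lift n E" "(x', y') \<in> lift n E" "x < x'" "x' < y" for x y x' y'
      using drawing_noncrossing[OF n E D] that by blast
    show "y = y'" if L: "(x, y) \<in> lift n E" "(x, y') \<in> lift n E" for x y y'
    proof -
      obtain a b k where ab: "(a, b) \<in> E" "x = a + k * n" "y = arc_end n a b + k * n"
        using L(1) by (rule liftE)
      obtain a' b' k' where ab': "(a', b') \<in> E" "x = a' + k' * n" "y' = arc_end n a' b' + k' * n"
        using L(2) by (rule liftE)
      have "k = k' \<and> a = a'"
        by (rule shifted_range_unique[where c = 1 and n = n]) (use ab ab' E in auto)
      then show ?thesis using ab ab' sv(1) by (auto dest: single_valuedD)
    qed
    show "x = x'" if L: "(x, y) \<in> lift n E" "(x', y) \<in> lift n E" for x x' y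
    proof -
      obtain a b k where ab: "(a, b) \<in> E" "x = a + k * n" "y = arc_end n a b + k * n"
        using L(1) by (rule liftE)
      obtain a' b' k' where ab': "(a', b') \<in> E" "x' = a' + k' * n" "y = arc_end n a' b' + k' * n"
        using L(2) by (rule liftE)
      obtain j j' where "y = b + j * n" "y = b' + j' * n"
      proof -
        have "\<exists>j. arc_end n a b + k * n = b + j * n" for a b k
        proof (cases "a < b")
          case True
          then show ?thesis by (auto simp: arc_end_def)
        next
          case False
          then show ?thesis by (intro exI[of _ "k + 1"]) (simp add: arc_end_def algebra_simps)
        qed
        then show thesis using that ab(3) ab'(3) by metis
      qed
      then have "j = j' \<and> b = b'"
        by (intro shifted_range_unique[where c = 1 and n = n]) (use ab ab' E in auto)
      then have "a = a'" using ab(1) ab'(1) sv(2) by (auto dest: single_valuedD)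
      then have "k = k'" using ab(3) ab'(3) \<open>j = j' \<and> b = b'\<close> n by simp
      then show ?thesis using ab ab' \<open>a = a'\<close> by simp
    qed
  qed
qed

text \<open>
  Conversely, noncrossing lifted arcs are drawn in angular coordinates as the parabolas
  \<open>(s - x) * (y - s) / n\<^sup>2\<close> over \<open>[x, y]\<close>: disjoint intervals give disjoint parabolas and nested
  intervals give nested ones. In the parametrisation of the model curve this is the profile
  \<open>t * (1 - t)\<close> scaled by \<open>((y - x) / n)\<^sup>2\<close>.
\<close>

definition scaled_arc :: "int \<Rightarrow> real \<Rightarrow> int \<Rightarrow> int \<Rightarrow> real \<Rightarrow> complex" where
  "scaled_arc n c a b t = of_real (1 - c * (t * (1 - t))) *
     exp (ang n (of_int a + t * of_int (arc_end n a b - a)))"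

lemma scaled_arc_1: "scaled_arc n 1 a b = model_arc n a b"
  by (rule ext) (simp add: scaled_arc_def model_arc_def exp_ang)

lemma scaled_arc_radius:
  assumes "0 < c" "c \<le> 1" "t \<in> {0..1}"
  shows "norm (scaled_arc n c a b t) = 1 - c * (t * (1 - t))" "1 - c * (t * (1 - t)) \<ge> 3 / 4"
    "1 - c * (t * (1 - t)) \<le> 1"
proof -
  note b = bump_bounds[OF assms(3)]
  have "c * (t * (1 - t)) \<le> 1 * (1 / 4)" using b assms by (intro mult_mono) auto
  then show "1 - c * (t * (1 - t)) \<ge> 3 / 4" by simp
  then show "norm (scaled_arc n c a b t) = 1 - c * (t * (1 - t))"
    by (simp add: scaled_arc_def norm_mult exp_ang del: of_real_diff of_real_mult)
  show "1 - c * (t * (1 - t)) \<le> 1" using b assms by simp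
qed

lemma scaled_arc_simple_curve:
  assumes n: "n > 0" and ab: "a \<in> {1..n}" "b \<in> {1..n}" and c: "0 < c" "c \<le> 1"
  shows "simple_curve n a b (scaled_arc n c a b)"
proof -
  define e where "e = arc_end n a b"
  have e: "a < e" "e \<le> a + n" using arc_end_bounds[OF ab] by (auto simp: e_def)
  have "path (scaled_arc n c a b)"
    unfolding path_def scaled_arc_def ang_def using n by (auto intro!: continuous_intros)
  moreover have "loop_free (scaled_arc n c a b)"
    unfolding loop_free_def
  proof (intro ballI impI)
    fix s t assume st: "s \<in> {0..1::real}" "t \<in> {0..1::real}" and eq: "scaled_arc n c a b s = scaled_arc n c a b t"
    define r where "r = 1 - c * (t * (1 - t))"
    have r: "1 - c * (s * (1 - s)) = r" unfolding r_def using scaled_arc_radius(1)[OF c] eq st by metis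
    have "complex_of_real r \<noteq> 0" using scaled_arc_radius(2)[OF c st(2)] unfolding r_def of_real_eq_0_iff by linarith
    moreover have "of_real r * exp (ang n (of_int a + s * of_int (e - a))) =
        of_real r * exp (ang n (of_int a + t * of_int (e - a)))"
      using eq r unfolding scaled_arc_def e_def r_def by metis
    ultimately have "exp (ang n (of_int a + s * of_int (e - a))) = exp (ang n (of_int a + t * of_int (e - a)))"
      by (metis mult_left_cancel)
    then obtain k :: int where "of_int a + s * of_int (e - a) = of_int a + t * of_int (e - a) + of_int (k * n)"
      using exp_ang_eq[OF n] by blast
    then have k: "(s - t) * of_int (e - a) = of_int k * of_int n" by (simp add: algebra_simps)
    have ea: "0 < real_of_int (e - a)" "real_of_int (e - a) \<le> of_int n" using e by auto
    show "s = t \<or> s = 0 \<and> t = 1 \<or> s = 1 \<and> t = 0"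
    proof (cases "k = 0")
      case True
      then show ?thesis using k ea by simp
    next
      case False
      have "\<bar>s - t\<bar> * of_int (e - a) = \<bar>of_int k\<bar> * of_int n"
        using arg_cong[OF k, of abs] ea n by (simp add: abs_mult)
      moreover have "1 * of_int n \<le> \<bar>of_int k :: real\<bar> * of_int n"
        using False n by (intro mult_right_mono) auto
      ultimately have "of_int n \<le> \<bar>s - t\<bar> * of_int (e - a)" by (simp only: mult_1_left)
      from order_trans[OF ea(2) this] have "1 \<le> \<bar>s - t\<bar>"
        using mult_le_cancel_right_pos[OF ea(1), of 1 "\<bar>s - t\<bar>"] by (simp only: mult_1_left)
      then show ?thesis using st by auto
    qed
  qed
  moreover have "pathstart (scaled_arc n c a b) = marked n a"
    by (simp add: pathstart_def scaled_arc_def marked_ang)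
  moreover have "pathfinish (scaled_arc n c a b) = marked n b"
    using marked_shift[OF n, of b 1] by (auto simp: pathfinish_def scaled_arc_def arc_end_def marked_ang)
  moreover have "scaled_arc n c a b ` {0<..<1} \<subseteq> {z. 1 / 2 < norm z \<and> norm z < 1}"
  proof clarify
    fix t :: real assume t: "t \<in> {0<..<1}"
    then have t': "t \<in> {0..1}" by simp
    have "0 < c * (t * (1 - t))" using c bump_pos[OF t] by simp
    then show "1 / 2 < norm (scaled_arc n c a b t) \<and> norm (scaled_arc n c a b t) < 1"
      using scaled_arc_radius[OF c t'] by simp
  qed
  ultimately show ?thesis unfolding simple_curve_def simple_path_def by blast
qed

text \<open>
  Interpolating the scaling factor between \<open>1\<close> and \<open>c\<close> is an isotopy from the model curve.
\<close>

lemma scaled_arc_represents: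
  assumes n: "n > 0" and ab: "a \<in> {1..n}" "b \<in> {1..n}" and c: "0 < c" "c \<le> 1"
  shows "represents_arc n (a, b) (scaled_arc n c a b)"
proof -
  define h where "h = (\<lambda>(u, t). scaled_arc n ((1 - u) + u * c) a b t)"
  have k: "0 < (1 - u) + u * c" "(1 - u) + u * c \<le> 1" if "u \<in> {0..1}" for u
  proof -
    have "u * c \<le> u * 1" using c that by (intro mult_left_mono) auto
    then show "(1 - u) + u * c \<le> 1" by simp
    show "0 < (1 - u) + u * c"
    proof (cases "u = 1")
      case False
      then show ?thesis using c that by (intro add_pos_nonneg) auto
    qed (use c in simp)
  qed
  have "homotopic_with_canon (simple_curve n a b) {0..1} annulus (model_arc n a b) (scaled_arc n c a b)"
    unfolding homotopic_with_def
  proof (intro exI[of _ h] conjI allI ballI)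
    have "continuous_on ({0..1} \<times> {0..1}) h"
      unfolding h_def scaled_arc_def ang_def case_prod_unfold using n
      by (intro continuous_intros) auto
    moreover have "h ` ({0..1} \<times> {0..1}) \<subseteq> annulus"
    proof clarify
      fix u t :: real assume "u \<in> {0..1}" "t \<in> {0..1}"
      then show "h (u, t) \<in> annulus"
        using scaled_arc_radius(1)[OF k[of u], of t n a b] scaled_arc_radius(2,3)[OF k[of u], of t]
        by (simp add: annulus_def h_def)
    qed
    ultimately show "continuous_map (prod_topology (top_of_set {0..1}) (top_of_set {0..1})) (top_of_set annulus) h"
      by (simp add: prod_topology_subtopology_eu image_subset_iff_funcset)
    show "h (0, t) = model_arc n a b t" for t by (simp add: h_def scaled_arc_1)
    show "h (1, t) = scaled_arc n c a b t" for t by (simp add: h_def)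
    show "simple_curve n a b (\<lambda>t. h (u, t))" if "u \<in> {0..1}" for u
      unfolding h_def using scaled_arc_simple_curve[OF n ab k[OF that]] by simp
  qed
  then show ?thesis by (simp add: represents_arc_def)
qed

context diagram
begin

lemma drawing_exists: "\<exists>D. is_drawing n E D"
proof -
  define w where "w e = (case e of (a, b) \<Rightarrow> (of_int (arc_end n a b - a) / of_int n :: real))" for e
  define D where "D e = (case e of (a, b) \<Rightarrow> scaled_arc n ((w e)\<^sup>2) a b)" for e
  have w: "0 < w (a, b)" "w (a, b) \<le> 1" if "(a, b) \<in> E" for a b
    using arc_end_bounds[of a n b] E_sub that n_pos by (auto simp: w_def divide_le_eq_1)
  have w2: "0 < (w (a, b))\<^sup>2" "(w (a, b))\<^sup>2 \<le> 1" if "(a, b) \<in> E" for a b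
    using w[OF that] by (auto simp: power_le_one)
  have rep: "represents_arc n e (D e)" if "e \<in> E" for e
  proof -
    obtain a b where e: "e = (a, b)" by (cases e)
    then have "a \<in> {1..n}" "b \<in> {1..n}" using that E_sub by auto
    then show ?thesis using scaled_arc_represents[OF n_pos _ _ w2] that e by (simp add: D_def)
  qed
  have disj: "e = f" if e: "e \<in> E" and f: "f \<in> E" and s: "s \<in> {0<..<1}" and t: "t \<in> {0<..<1}"
    and eq: "D e s = D f t" for e f s t
  proof -
    obtain a b a' b' where ab: "e = (a, b)" and ab': "f = (a', b')" by (cases e, cases f)
    define x y where "x = a" and "y = arc_end n a b"
    have s': "s \<in> {0..1}" and t': "t \<in> {0..1}" using s t by auto
    have E1: "(a, b) \<in> E" and E2: "(a', b') \<in> E" using e f ab ab' by auto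
    define q where "q = 1 - (w f)\<^sup>2 * (t * (1 - t))"
    have De: "D e = scaled_arc n ((w e)\<^sup>2) a b" and Df: "D f = scaled_arc n ((w f)\<^sup>2) a' b'"
      by (simp_all add: D_def ab ab')
    note we = w2[OF E1, folded ab] and wf = w2[OF E2, folded ab']
    have r: "1 - (w e)\<^sup>2 * (s * (1 - s)) = q"
      unfolding q_def using eq scaled_arc_radius(1)[OF we s'] scaled_arc_radius(1)[OF wf t']
      unfolding De Df by metis
    have "complex_of_real q \<noteq> 0"
      using scaled_arc_radius(2)[OF wf t'] unfolding q_def of_real_eq_0_iff by linarith
    moreover have "of_real q * exp (ang n (of_int a + s * of_int (y - a))) =
        of_real q * exp (ang n (of_int a' + t * of_int (arc_end n a' b' - a')))"
      using eq r unfolding De Df scaled_arc_def y_def q_def by metis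
    ultimately have "exp (ang n (of_int a + s * of_int (y - a))) =
        exp (ang n (of_int a' + t * of_int (arc_end n a' b' - a')))"
      by (metis mult_left_cancel)
    then obtain k :: int where k: "of_int a + s * of_int (y - a) =
        of_int a' + t * of_int (arc_end n a' b' - a') + of_int (k * n)"
      using exp_ang_eq[OF n_pos] by blast
    define x' y' where "x' = a' + k * n" and "y' = arc_end n a' b' + k * n"
    define p where "p = of_int x + s * of_int (y - x)"
    have p': "p = of_int x' + t * of_int (y' - x')"
      using k unfolding p_def x_def x'_def y'_def by (simp add: algebra_simps)
    have L: "(x, y) \<in> Lift" "(x', y') \<in> Lift"
      unfolding x_def y_def x'_def y'_def using E_lift[OF E1] liftI[OF E2] by auto
    have xy: "x < y" "x' < y'" using len[OF L(1)] len[OF L(2)] by auto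
    have in1: "of_int x < p" "p < of_int y"
    proof -
      have "0 < s * of_int (y - x)" "s * of_int (y - x) < 1 * of_int (y - x)"
        using s xy by (auto intro!: mult_pos_pos mult_strict_right_mono)
      then show "of_int x < p" "p < of_int y" unfolding p_def by auto
    qed
    have in2: "of_int x' < p" "p < of_int y'"
    proof -
      have "0 < t * of_int (y' - x')" "t * of_int (y' - x') < 1 * of_int (y' - x')"
        using t xy by (auto intro!: mult_pos_pos mult_strict_right_mono)
      then show "of_int x' < p" "p < of_int y'" unfolding p' by auto
    qed
    have height: "(p - of_int x) * (of_int y - p) = (p - of_int x') * (of_int y' - p)"
    proof -
      have "(p - of_int x) * (of_int y - p) = (of_int (y - x))\<^sup>2 * (s * (1 - s))"
        unfolding p_def by (simp add: power2_eq_square algebra_simps)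
      moreover have "(p - of_int x') * (of_int y' - p) = (of_int (y' - x'))\<^sup>2 * (t * (1 - t))"
        unfolding p' by (simp add: power2_eq_square algebra_simps)
      moreover have "(of_int (y - x))\<^sup>2 = (of_int n)\<^sup>2 * (w e)\<^sup>2" "(of_int (y' - x'))\<^sup>2 = (of_int n)\<^sup>2 * (w f)\<^sup>2"
        using n_pos unfolding w_def ab ab' x_def y_def x'_def y'_def by (auto simp: power_divide)
      ultimately show ?thesis using r unfolding q_def by simp
    qed
    \<comment> \<open>\<open>height\<close> says that the parabolas over \<open>[x, y]\<close> and \<open>[x', y']\<close> agree at \<open>p\<close>.\<close>
    have nest: False if L: "(u, v) \<in> Lift" "(u', v') \<in> Lift" and lt: "u < u'"
      and pu: "of_int u < p" "p < of_int v" "of_int u' < p" "p < of_int v'"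
      and h: "(p - of_int u) * (of_int v - p) = (p - of_int u') * (of_int v' - p)" for u v u' v'
    proof -
      have "u' < v" using pu by linarith
      then have "v' \<le> v" using nc[OF L lt] by simp
      then have "(p - of_int u') * (of_int v' - p) \<le> (p - of_int u') * (of_int v - p)"
        using pu by (intro mult_left_mono) auto
      also have "\<dots> < (p - of_int u) * (of_int v - p)"
        using pu lt by (intro mult_strict_right_mono) auto
      finally show False using h by simp
    qed
    have "x = x'"
      using nest[OF L(1,2) _ in1 in2 height] nest[OF L(2,1) _ in2 in1 height[symmetric]]
      by (meson linorder_neqE)
    then have "a = a' + k * n" by (simp add: x_def x'_def)
    then have "k = 0 \<and> a = a'"
      by (rule shifted_range_unique0[where c = 1]) (use E1 E2 E_sub in auto)
    then show "e = f" using E_out E1 E2 ab ab' by blast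
  qed
  have "is_drawing n E D"
    unfolding is_drawing_def using rep disj by blast
  then show ?thesis by blast
qed

lemma noncrossing: "noncrossing_arc_diagram n E"
  unfolding noncrossing_arc_diagram_def
  using drawing_exists E_sub arc_lift_single_valued[OF arc_lift_axioms E_sub] by blast

end

section \<open>Walkers\<close>

lemma annulus_locally_path_connected: "locally path_connected annulus"
proof -
  define r where "r z = of_real (max (1 / 2) (min 1 (norm z)) / norm z) * z" for z :: complex
  have "retraction (- {0}) annulus r"
    unfolding retraction_def
  proof (intro conjI ballI)
    show "annulus \<subseteq> - {0}" by (rule annulus_nonzero)
    show "continuous_on (- {0}) r"
      unfolding r_def by (intro continuous_intros) auto
    show "r \<in> - {0} \<rightarrow> annulus"
      by (auto simp: r_def annulus_def norm_mult norm_divide)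
    show "r z = z" if "z \<in> annulus" for z
    proof -
      have "max (1 / 2) (min 1 (norm z)) = norm z" "norm z \<noteq> 0" using that by (auto simp: annulus_def)
      then show ?thesis by (simp add: r_def)
    qed
  qed
  then have "annulus retract_of (- {0})" unfolding retract_of_def by blast
  then show ?thesis
    by (rule retract_of_locally_path_connected[rotated])
      (rule open_imp_locally_path_connected, simp add: open_Compl)
qed

lemma norm_marked: "norm (marked n i) = 1"
  by (simp add: marked_def)

lemma annulus_path_logarithm:
  assumes n: "n > 0" and g: "path g" "path_image g \<subseteq> annulus" "pathstart g = marked n i" "pathfinish g = marked n j"
  obtains h k where "path h" "pathstart h = ang n (of_int i)" "pathfinish h = ang n (of_int (j + k * n))"
    "\<And>z. z \<in> path_image h \<Longrightarrow> Re z \<le> 0 \<and> exp z \<in> path_image g"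
proof -
  obtain h where h: "path h" "pathstart h = ang n (of_int i)" "\<And>t. t \<in> {0..1} \<Longrightarrow> exp (h t) = g t"
    using covering_space_lift_path_strong[OF covering_space_exp_punctured_plane UNIV_I g(1) _]
      g(2,3) annulus_nonzero marked_ang by (metis order_trans)
  have "exp (pathfinish h) = exp (ang n (of_int j))"
    using h(3)[of 1] g(4) by (simp add: pathfinish_def marked_ang)
  then obtain k :: int where k: "pathfinish h = ang n (of_int j) + of_real (of_int (2 * k) * pi) * \<i>"
    unfolding exp_eq by auto
  have "of_real (of_int (2 * k) * pi) * \<i> = ang n (of_int (- k * n))"
    using n by (simp add: ang_def)
  then have "pathfinish h = ang n (of_int (j + - k * n))"
    unfolding k of_int_add[of j] ang_add by (rule arg_cong)
  moreover have "Re z \<le> 0 \<and> exp z \<in> path_image g" if z_in: "z \<in> path_image h" for z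
  proof -
    obtain t where t: "t \<in> {0..1}" "z = h t" using z_in unfolding path_image_def by blast
    then have "exp z \<in> path_image g" using h(3) by (auto simp: path_image_def)
    then have "norm (exp z) \<le> 1" using g(2) by (auto simp: annulus_def)
    then show ?thesis using \<open>exp z \<in> path_image g\<close> by simp
  qed
  ultimately show thesis using that h by blast
qed

locale drawn_diagram = diagram +
  fixes D :: "int \<times> int \<Rightarrow> real \<Rightarrow> complex"
  assumes drawing: "is_drawing n E D"
begin

lemma drawn: "(a, b) \<in> E \<Longrightarrow> simple_curve n a b (D (a, b))"
  using drawing represents_arcD(1) unfolding is_drawing_def by blast

lemma drawn_cases:
  assumes "(a, b) \<in> E" "z \<in> path_image (D (a, b))"
  obtains "z = marked n a" | "z = marked n b" | "z \<in> D (a, b) ` {0<..<1}" "1 / 2 < norm z" "norm z < 1"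
proof -
  note sc = drawn[OF assms(1), unfolded simple_curve_def]
  obtain t where t: "t \<in> {0..1}" "z = D (a, b) t" using assms(2) by (auto simp: path_image_def)
  consider "t = 0" | "t = 1" | "t \<in> {0<..<1}" using t(1) by force
  then show thesis
  proof cases
    case 3
    then have "z \<in> D (a, b) ` {0<..<1}" using t by blast
    moreover have "z \<in> {z. 1 / 2 < norm z \<and> norm z < 1}" using sc calculation by blast
    ultimately show thesis using that by blast
  qed (use that sc t in \<open>auto simp: pathstart_def pathfinish_def\<close>)
qed

lemma drawn_annulus: "(a, b) \<in> E \<Longrightarrow> path_image (D (a, b)) \<subseteq> annulus"
  by (auto elim!: drawn_cases simp: annulus_def norm_marked)

lemma drawn_path: "(a, b) \<in> E \<Longrightarrow> path (D (a, b))"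
  using drawn unfolding simple_curve_def simple_path_def by blast

lemma drawn_ends: "(a, b) \<in> E \<Longrightarrow> marked n a \<in> path_image (D (a, b)) \<and> marked n b \<in> path_image (D (a, b))"
  using drawn unfolding simple_curve_def by (metis pathstart_in_path_image pathfinish_in_path_image)

lemma finite_E: "finite E"
  by (rule finite_subset[OF E_sub]) simp

abbreviation "K \<equiv> cycle_curve E D"

definition outer :: "complex set" where
  "outer = annulus - (K \<union> inside K)"

context
  assumes Cyc_ne: "Cyc \<noteq> {}"
begin

lemma mem_cycle_curve: "z \<in> K \<longleftrightarrow> (\<exists>(a, b)\<in>E. a \<in> Cyc \<and> z \<in> path_image (D (a, b)))"
  unfolding cycle_curve_def cycle_of_eq[OF Cyc_ne] cycle_arcs_def by auto

lemma compact_K: "compact K"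
  unfolding cycle_curve_def cycle_of_eq[OF Cyc_ne]
proof (rule compact_UN)
  show "finite cycle_arcs" by (rule finite_subset[OF _ finite_E]) (auto simp: cycle_arcs_def)
  show "compact (path_image (D e))" if "e \<in> cycle_arcs" for e
    using that drawn_path by (cases e) (auto simp: cycle_arcs_def)
qed

lemma K_annulus: "K \<subseteq> annulus"
  using mem_cycle_curve drawn_annulus by fastforce

lemma marked_in_K: "c \<in> Cyc \<Longrightarrow> marked n c \<in> K"
proof -
  assume c: "c \<in> Cyc"
  obtain k r where r: "c = r + k * n" "r \<in> {1..<1 + n}" using shift_into_range[OF n_pos] .
  have rC: "r \<in> Cyc" using c r Cyc_shift by simp
  obtain y where "(r, y) \<in> Lift" using Cyc_next[OF rC] by blast
  then obtain b where "(r, b) \<in> E" using mem_lift_base[OF E_sub, of r y] r(2) by auto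
  then have "marked n r \<in> K" using mem_cycle_curve drawn_ends rC by blast
  then show ?thesis using marked_shift[OF n_pos] r by simp
qed

lemma K_circle:
  assumes "z \<in> K" "norm z = 1"
  obtains c where "c \<in> Cyc" "z = marked n c"
proof -
  obtain a b where ab: "(a, b) \<in> E" "a \<in> Cyc" "z \<in> path_image (D (a, b))"
    using assms(1) mem_cycle_curve by blast
  then have "b \<in> Cyc" using cycle_arcs_Cyc by blast
  then show thesis using ab drawn_cases[OF ab(1,3)] that assms(2) by (metis less_irrefl)
qed

lemma outer_eq: "outer = annulus \<inter> outside K"
  unfolding outer_def using union_with_inside[of K] by blast

lemma connected_outside:
  assumes "connected T" "T \<inter> K = {}" "x \<in> T" "x \<in> outside K"
  shows "T \<subseteq> outside K"
proof
  fix y assume "y \<in> T"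
  then have "connected_component (- K) x y"
    unfolding connected_component_def using assms by blast
  then show "y \<in> outside K" using outside_same_component assms(4) by blast
qed

lemma circle_outside:
  assumes "norm z = 1" "z \<notin> K"
  shows "z \<in> outside K"
proof -
  have ball: "- cball 0 1 \<subseteq> outside K"
    by (rule outside_subset_convex) (use K_annulus in \<open>auto simp: annulus_def\<close>)
  have seg: "w = z \<or> norm w > 1" if w: "w \<in> closed_segment z (2 * z)" for w
  proof -
    obtain u where u: "0 \<le> u" "w = (1 - u) *\<^sub>R z + u *\<^sub>R (2 * z)"
      using w unfolding closed_segment_def by blast
    then have "w = (1 + u) *\<^sub>R z" by (simp add: algebra_simps scaleR_conv_of_real)
    then show ?thesis using assms(1) u(1) by (cases "u = 0") auto
  qed
  have "closed_segment z (2 * z) \<subseteq> outside K"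
  proof (rule connected_outside)
    show "closed_segment z (2 * z) \<inter> K = {}"
      using seg assms K_annulus by (fastforce simp: annulus_def)
    show "2 * z \<in> outside K" using ball assms(1) by (auto simp: norm_mult)
  qed auto
  then show ?thesis by auto
qed

lemma marked_outer_iff: "marked n i \<in> outer \<longleftrightarrow> i \<notin> Cyc"
proof
  assume "marked n i \<in> outer"
  then show "i \<notin> Cyc" using marked_in_K unfolding outer_def by blast
next
  assume i: "i \<notin> Cyc"
  have "marked n i \<notin> K"
  proof
    assume "marked n i \<in> K"
    then obtain c where c: "c \<in> Cyc" "marked n i = marked n c" using K_circle norm_marked by metis
    then obtain k where "i = c + k * n" using marked_eq[OF n_pos] by blast
    then show False using c i Cyc_shift by simp
  qed
  then show "marked n i \<in> outer"
    unfolding outer_eq using circle_outside norm_marked by (auto simp: annulus_def)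
qed

definition separated :: "int \<Rightarrow> int \<Rightarrow> bool" where
  "separated i j \<longleftrightarrow> (\<exists>c\<in>Cyc. i < c \<and> c < j \<or> j < c \<and> c < i)"

text \<open>
  With no element of \<open>Cyc\<close> in between, the boundary circle itself connects the two points.
\<close>

lemma not_separated_connected:
  assumes "i \<notin> Cyc" "j \<notin> Cyc" "\<not> separated i j"
  shows "connected_component outer (marked n i) (marked n j)"
proof -
  define T where "T = (\<lambda>s. exp (ang n s)) ` closed_segment (of_int i) (of_int j)"
  have "connected T"
    unfolding T_def ang_def by (intro connected_continuous_image continuous_intros) (use n_pos in auto)
  moreover have "marked n i \<in> T" "marked n j \<in> T" unfolding T_def marked_ang by auto
  moreover have "T \<subseteq> outer"
  proof
    fix z assume "z \<in> T"
    then obtain s where s: "s \<in> closed_segment (of_int i) (of_int j)" "z = exp (ang n s)" unfolding T_def by blast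
    have nz: "norm z = 1" using s by (simp add: exp_ang)
    have "z \<notin> K"
    proof
      assume "z \<in> K"
      then obtain c where c: "c \<in> Cyc" "z = marked n c" using K_circle nz by blast
      then obtain k :: int where "s = of_int c + of_int (k * n)"
        using exp_ang_eq[OF n_pos, of s "of_int c"] s(2) unfolding marked_ang by auto
      then have s': "s = of_int (c + k * n)" by simp
      have cC: "c + k * n \<in> Cyc" using c Cyc_shift by simp
      have "i \<le> c + k * n \<and> c + k * n \<le> j \<or> j \<le> c + k * n \<and> c + k * n \<le> i"
        using s(1) unfolding s' closed_segment_eq_real_ivl by (auto split: if_splits simp del: of_int_add of_int_mult)
      moreover have "i \<noteq> c + k * n" "j \<noteq> c + k * n" using cC assms by auto
      ultimately show False using assms(3) cC unfolding separated_def by force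
    qed
    then show "z \<in> outer" unfolding outer_eq using circle_outside nz by (auto simp: annulus_def)
  qed
  ultimately show ?thesis unfolding connected_component_def by blast
qed

lemma cycle_curve_logarithm:
  assumes "(x, y) \<in> Lift\<^sup>*" "x \<in> Cyc"
  obtains f where "path f" "pathstart f = ang n (of_int x)" "pathfinish f = ang n (of_int y)"
    "\<And>z. z \<in> path_image f \<Longrightarrow> Re z \<le> 0 \<and> exp z \<in> K"
proof -
  have "\<exists>f. path f \<and> pathstart f = ang n (of_int x) \<and> pathfinish f = ang n (of_int y) \<and>
    (\<forall>z\<in>path_image f. Re z \<le> 0 \<and> exp z \<in> K)"
    using assms(1)
  proof (induction rule: rtrancl_induct)
    case base
    have "exp (ang n (of_int x)) \<in> K" using marked_in_K[OF assms(2)] by (simp add: marked_ang)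
    then show ?case
      by (intro exI[of _ "\<lambda>_. ang n (of_int x)"])
        (auto simp: ang_simps path_def pathstart_def pathfinish_def path_image_def)
  next
    case (step y y')
    have yC: "y \<in> Cyc" using step(1) assms(2)
      by (induction rule: rtrancl_induct) (use Cyc_arc in blast)+
    obtain f where f: "path f" "pathstart f = ang n (of_int x)" "pathfinish f = ang n (of_int y)"
      "\<forall>z\<in>path_image f. Re z \<le> 0 \<and> exp z \<in> K" using step(3) by blast
    obtain a b k h where h: "(a, b) \<in> E" "y = a + k * n" "y' = arc_end n a b + k * n"
      "path h" "h 0 = ang n (of_int y)" "h 1 = ang n (of_int y')"
      "\<And>t. t \<in> {0..1} \<Longrightarrow> exp (h t) = D (a, b) t" "\<And>t. t \<in> {0..1} \<Longrightarrow> Re (h t) \<le> 0"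
      using lifted_arc[OF n_pos drawing step(2)] by metis
    have "a \<in> Cyc" using yC h(2) Cyc_shift by simp
    then have "Re z \<le> 0 \<and> exp z \<in> K" if z_in: "z \<in> path_image h" for z
    proof -
      obtain t where t: "t \<in> {0..1}" "z = h t" using z_in unfolding path_image_def by blast
      then have "exp z \<in> path_image (D (a, b))" using h(7) by (auto simp: path_image_def)
      then show ?thesis using mem_cycle_curve h(1,8) \<open>a \<in> Cyc\<close> t by blast
    qed
    moreover have "path_image (f +++ h) = path_image f \<union> path_image h"
      using f(3) h(5) by (intro path_image_join) (simp add: pathstart_def)
    ultimately show ?case
      using f h(4-6) by (intro exI[of _ "f +++ h"]) (auto simp: pathstart_def[of h] pathfinish_def[of h] path_join)
  qed
  then show thesis using that by blast
qed

text \<open>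
  The lift of the cycle is an infinite curve through all points of \<open>Cyc\<close>, so two boundary
  points with an element of \<open>Cyc\<close> between them are separated by it.
\<close>

lemma connected_not_separated:
  assumes i: "i \<notin> Cyc" and j: "j \<notin> Cyc" and con: "connected_component outer (marked n i) (marked n j)"
  obtains k where "\<not> separated i (j + k * n)"
proof -
  have "openin (top_of_set annulus) outer"
    unfolding outer_eq using compact_K by (intro openin_open_Int) (simp add: open_outside compact_imp_closed)
  then have "locally path_connected outer"
    using annulus_locally_path_connected locally_open_subset by blast
  then have "path_component outer (marked n i) (marked n j)"
    using con path_component_eq_connected_component by metis
  then obtain g where g: "path g" "path_image g \<subseteq> outer" "pathstart g = marked n i" "pathfinish g = marked n j"
    unfolding path_component_def by blast
  have "path_image g \<subseteq> annulus" using g(2) unfolding outer_def by blast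
  then obtain h k where h: "path h" "pathstart h = ang n (of_int i)" "pathfinish h = ang n (of_int (j + k * n))"
    "\<And>z. z \<in> path_image h \<Longrightarrow> Re z \<le> 0 \<and> exp z \<in> path_image g"
    using annulus_path_logarithm[OF n_pos g(1) _ g(3,4)] by metis
  note Imlt = Im_ang_less[OF n_pos]
  have no: False if p: "path p" "pathstart p = ang n (of_int u)" "pathfinish p = ang n (of_int v)"
    "path_image p = path_image h" and c: "u \<notin> Cyc" "c \<in> Cyc" "u < c" "c < v" for p u v c
  proof -
    obtain x y where x: "x \<in> Cyc" "x < u" using Cyc_below[OF Cyc_ne c(1)] by metis
    then have "(x, c) \<in> Lift\<^sup>*" using Cyc_connected c by simp
    then obtain f where f: "path f" "pathstart f = ang n (of_int x)" "pathfinish f = ang n (of_int c)"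
      "\<And>z. z \<in> path_image f \<Longrightarrow> Re z \<le> 0 \<and> exp z \<in> K"
      using cycle_curve_logarithm x(1) by metis
    have "path_image f \<inter> path_image p \<noteq> {}"
    proof (rule fashoda_half_plane[OF f(1) p(1)])
      show "Re z \<le> 0" if "z \<in> path_image f \<union> path_image p" for z
        using that f(4) h(4) p(4) by blast
    qed (use f(2,3) p(2,3) x(2) c(3,4) Imlt in \<open>simp_all add: ang_simps(1)\<close>)
    then obtain z where "z \<in> path_image f" "z \<in> path_image p" by blast
    then have "exp z \<in> K" "exp z \<in> outer" using f(4) h(4) p(4) g(2) by blast+
    then show False unfolding outer_def by blast
  qed
  have jk: "j + k * n \<notin> Cyc" using j Cyc_shift by simp
  have "\<not> separated i (j + k * n)"
  proof
    assume "separated i (j + k * n)"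
    then obtain c where c: "c \<in> Cyc" "i < c \<and> c < j + k * n \<or> j + k * n < c \<and> c < i"
      unfolding separated_def by blast
    then show False
      using no[OF h(1-3) refl i c(1)] no[of "reversepath h" "j + k * n" i, OF _ _ _ _ jk c(1)] h(1-3) by auto
  qed
  then show thesis by (rule that)
qed

lemma walkers_eq:
  "walkers n E D = {connected_component_set outer (marked n i) | i. i \<in> {1..n} - Cyc}"
proof (intro set_eqI iffI)
  fix W assume "W \<in> walkers n E D"
  then obtain i where i: "i \<in> {1..n}" "marked n i \<in> W" "W \<in> components outer"
    unfolding walkers_def outer_def by blast
  then have "marked n i \<in> outer" using in_components_subset by blast
  moreover obtain x where "W = connected_component_set outer x" using i(3) by (auto simp: components_def)
  ultimately have "W = connected_component_set outer (marked n i)"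
    using i(2) by (metis connected_component_eq)
  then show "W \<in> {connected_component_set outer (marked n i) | i. i \<in> {1..n} - Cyc}"
    using i(1) marked_outer_iff \<open>marked n i \<in> outer\<close> by blast
next
  fix W assume "W \<in> {connected_component_set outer (marked n i) | i. i \<in> {1..n} - Cyc}"
  then obtain i where i: "i \<in> {1..n}" "i \<notin> Cyc" "W = connected_component_set outer (marked n i)" by blast
  then have "marked n i \<in> outer" using marked_outer_iff by simp
  then have "W \<in> components outer" "marked n i \<in> W" using i(3) by (auto simp: components_def connected_component_refl)
  then show "W \<in> walkers n E D" unfolding walkers_def outer_def[symmetric] using i(1) by blast
qed

text \<open>
  Only meaningful if \<open>x \<in> Cyc\<close> and the next element of \<open>Cyc\<close> is larger than \<open>x + 1\<close>.
\<close>

definition gap_walker :: "int \<Rightarrow> complex set" where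
  "gap_walker x = connected_component_set outer (marked n (x + 1))"

lemma mem_gap_walker:
  assumes xy: "(x, y) \<in> Lift" "x \<in> Cyc" "x + 1 < y"
  shows "marked n j \<in> gap_walker x \<longleftrightarrow> (\<exists>k. x < j + k * n \<and> j + k * n < y)"
proof -
  have gap: "u \<notin> Cyc" if "x < u" "u < y" for u using not_Cyc_under[OF xy(1) that] .
  have yC: "y \<in> Cyc" using Cyc_arc xy by blast
  have x1: "x + 1 \<notin> Cyc" using gap xy(3) by simp
  show ?thesis
  proof
    assume "marked n j \<in> gap_walker x"
    then have con: "connected_component outer (marked n (x + 1)) (marked n j)" by (simp add: gap_walker_def)
    then have "marked n j \<in> outer" using connected_component_in by blast
    then have j: "j \<notin> Cyc" using marked_outer_iff by simp
    obtain k where k: "\<not> separated (x + 1) (j + k * n)" using connected_not_separated[OF x1 j con] .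
    have "j + k * n \<notin> Cyc" using j Cyc_shift by simp
    then have "j + k * n \<noteq> x" "j + k * n \<noteq> y" using xy(2) yC by auto
    then have "x < j + k * n \<and> j + k * n < y" using k xy yC unfolding separated_def by force
    then show "\<exists>k. x < j + k * n \<and> j + k * n < y" ..
  next
    assume "\<exists>k. x < j + k * n \<and> j + k * n < y"
    then obtain k where k: "x < j + k * n" "j + k * n < y" by blast
    have "\<not> separated (x + 1) (j + k * n)"
      unfolding separated_def using gap k xy(3) by force
    then have "connected_component outer (marked n (x + 1)) (marked n (j + k * n))"
      using not_separated_connected[OF x1 gap[OF k]] by simp
    then show "marked n j \<in> gap_walker x" using marked_shift[OF n_pos] by (simp add: gap_walker_def)
  qed
qed

text \<open>
  An arc off the cycle that starts in a walker avoids the curve of the cycle and its inside, so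
  it stays in the component of its tail.
\<close>

lemma gap_walker_arcs:
  "walker_arcs E D (gap_walker x) = {(a, b) \<in> E. a \<notin> Cyc \<and> marked n a \<in> gap_walker x}"
proof (intro set_eqI iffI; clarify)
  fix a b assume "(a, b) \<in> walker_arcs E D (gap_walker x)"
  then have ab: "(a, b) \<in> E" "path_image (D (a, b)) \<subseteq> gap_walker x" unfolding walker_arcs_def by auto
  then have "marked n a \<in> gap_walker x" using drawn_ends by blast
  moreover then have "marked n a \<in> outer" unfolding gap_walker_def using connected_component_subset by blast
  ultimately show "(a, b) \<in> E \<and> a \<notin> Cyc \<and> marked n a \<in> gap_walker x" using ab marked_outer_iff by blast
next
  fix a b assume ab: "(a, b) \<in> E" "a \<notin> Cyc" "marked n a \<in> gap_walker x"
  have b: "b \<notin> Cyc" using ab cycle_arcs_Cyc by blast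
  have "path_image (D (a, b)) \<inter> K = {}"
  proof (rule ccontr)
    assume "path_image (D (a, b)) \<inter> K \<noteq> {}"
    then obtain z where z: "z \<in> path_image (D (a, b))" "z \<in> K" by blast
    then obtain a' b' where ab': "(a', b') \<in> E" "a' \<in> Cyc" "z \<in> path_image (D (a', b'))"
      using mem_cycle_curve by blast
    have nm: "marked n u \<notin> K" if "u \<notin> Cyc" for u using marked_outer_iff that unfolding outer_def by blast
    have "z \<in> D (a, b) ` {0<..<1}" "norm z < 1"
      using drawn_cases[OF ab(1) z(1)] z(2) nm ab(2) b by metis+
    moreover then have "z \<in> D (a', b') ` {0<..<1}"
      using drawn_cases[OF ab'(1,3)] norm_marked by (metis less_irrefl)
    ultimately have "(a, b) = (a', b')" using drawing ab(1) ab'(1) unfolding is_drawing_def by blast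
    then show False using ab(2) ab'(2) by simp
  qed
  moreover have "connected (path_image (D (a, b)))" using drawn_path[OF ab(1)] by (rule connected_path_image)
  moreover have "marked n a \<in> outside K" using ab(2) marked_outer_iff outer_eq by blast
  ultimately have "path_image (D (a, b)) \<subseteq> outer"
    unfolding outer_eq using connected_outside drawn_ends[OF ab(1)] drawn_annulus[OF ab(1)] by blast
  then have "path_image (D (a, b)) \<subseteq> connected_component_set outer (marked n a)"
    using drawn_ends[OF ab(1)] \<open>connected (path_image (D (a, b)))\<close> by (intro connected_component_maximal) auto
  also have "\<dots> = gap_walker x" using ab(3) unfolding gap_walker_def by (metis connected_component_eq)
  finally show "(a, b) \<in> walker_arcs E D (gap_walker x)" unfolding walker_arcs_def using ab(1) by blast
qed

end

end

section \<open>Cuts\<close>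

text \<open>
  By Borsuk's theorem a compact set on which the logarithm has a continuous branch does not
  enclose the origin.
\<close>

lemma logarithm_imp_unbounded_component:
  assumes X: "compact X" "(0::complex) \<notin> X"
    and l: "continuous_on X l" "\<And>z. z \<in> X \<Longrightarrow> exp (l z) = z"
  shows "\<not> bounded (connected_component_set (- X) 0)"
proof -
  have "(inverse (norm (z - 0))) *\<^sub>R (z - 0) = exp (\<i> * of_real (Im (l z)))" if "z \<in> X" for z
  proof -
    have z: "z = of_real (exp (Re (l z))) * exp (\<i> * of_real (Im (l z)))"
      using l(2)[OF that] exp_eq_polar[of "l z"] by (simp add: cis_conv_exp)
    then have "norm z = exp (Re (l z))" using l(2)[OF that] by (metis norm_exp_eq_Re)
    then show ?thesis using z
      by (simp add: scaleR_conv_of_real) (metis exp_not_eq_zero inverse_mult_eq_1 left_inverse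
        mult.assoc mult.left_neutral of_real_eq_0_iff of_real_inverse)
  qed
  moreover have "continuous_on X (\<lambda>z. Im (l z))" using l(1) by (intro continuous_intros)
  ultimately have "\<exists>c. homotopic_with_canon (\<lambda>x. True) X (sphere 0 1)
      (\<lambda>z. inverse (norm (z - 0)) *\<^sub>R (z - 0)) (\<lambda>x. c)"
    unfolding inessential_eq_continuous_logarithm_circle by blast
  then show ?thesis using Borsuk_map_essential_bounded_component[OF X] by simp
qed

lemma circle_point_angle:
  assumes "n > 0" "norm z = 1"
  obtains x where "c \<le> x" "x < c + of_int n" "z = exp (ang n x)"
proof -
  define x0 where "x0 = - (Arg z * of_int n / (2 * pi))"
  define k where "k = \<lfloor>(x0 - c) / of_int n\<rfloor>"
  have "z = cis (Arg z)" using assms(2) by (metis Arg_eq cis_conv_exp norm_zero mult_1 of_real_1 zero_neq_one mult.commute)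
  then have z: "z = exp (ang n x0)" using assms(1) by (simp add: exp_ang x0_def)
  have "of_int k \<le> (x0 - c) / of_int n" "(x0 - c) / of_int n < of_int k + 1" unfolding k_def by linarith+
  then have "of_int k * of_int n \<le> x0 - c" "x0 - c < (of_int k + 1) * of_int n"
    using assms(1) by (simp_all add: pos_le_divide_eq pos_divide_less_eq)
  then have "c \<le> x0 + of_int (- k * n)" "x0 + of_int (- k * n) < c + of_int n" by (simp_all add: algebra_simps)
  moreover have "z = exp (ang n (x0 + of_int (- k * n)))"
    using z exp_ang_period[of n "- k"] assms(1) by (simp only: ang_add exp_add) simp
  ultimately show thesis by (rule that)
qed

lemma radial_crossing:
  fixes g :: "real \<Rightarrow> complex"
  assumes "path g" "pathstart g = 0" "norm (pathfinish g) > 1"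
  obtains r s where "0 \<le> r" "r < s" "s \<le> 1" "norm (g r) = 1 / 2" "norm (g s) = 1"
    "\<And>t. r < t \<Longrightarrow> t < s \<Longrightarrow> 1 / 2 < norm (g t) \<and> norm (g t) < 1"
proof -
  have cont: "continuous_on {u..v} (\<lambda>t. norm (g t))" if "0 \<le> u" "v \<le> 1" for u v
    using assms(1) that unfolding path_def by (intro continuous_intros) (auto elim: continuous_on_subset)
  have cl: "compact {t \<in> {0..v}. norm (g t) = c}" if "v \<le> 1" for c v
  proof -
    have "closed ({0..v} \<inter> (\<lambda>t. norm (g t)) -` {c})"
      using continuous_closed_preimage[OF cont[of 0 v]] that by auto
    moreover have "{0..v} \<inter> (\<lambda>t. norm (g t)) -` {c} = {t \<in> {0..v}. norm (g t) = c}" by auto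
    moreover have "bounded {t \<in> {0..v}. norm (g t) = c}" by (rule bounded_subset[of "{0..v}"]) auto
    ultimately show ?thesis by (simp add: compact_eq_bounded_closed)
  qed
  have g0: "norm (g 0) = 0" and g1: "norm (g 1) > 1" using assms by (auto simp: pathstart_def pathfinish_def)
  have hit: "\<exists>t. 0 \<le> t \<and> t \<le> v \<and> norm (g t) = c" if "0 \<le> v" "v \<le> 1" "0 \<le> c" "c \<le> norm (g v)" for c v
    using IVT'[of "\<lambda>t. norm (g t)" 0 c v] that g0 cont[of 0 v] by auto
  have "{t \<in> {0..1}. norm (g t) = 1} \<noteq> {}" using hit[of 1 1] g1 by auto
  then obtain s where s: "s \<in> {t \<in> {0..1}. norm (g t) = 1}" "\<forall>t\<in>{t \<in> {0..1}. norm (g t) = 1}. s \<le> t"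
    using compact_attains_inf[OF cl[of 1 1]] by auto
  have below: "norm (g t) < 1" if t: "0 \<le> t" "t < s" for t
  proof (rule ccontr)
    assume "\<not> norm (g t) < 1"
    then obtain t' where "0 \<le> t'" "t' \<le> t" "norm (g t') = 1" using hit[of t 1] t s(1) by auto
    then show False using s t by force
  qed
  have "{t \<in> {0..s}. norm (g t) = 1 / 2} \<noteq> {}" using hit[of s "1 / 2"] s(1) by auto
  then obtain r where r: "r \<in> {t \<in> {0..s}. norm (g t) = 1 / 2}" "\<forall>t\<in>{t \<in> {0..s}. norm (g t) = 1 / 2}. t \<le> r"
    using compact_attains_sup[OF cl[of s "1 / 2"]] s(1) by auto
  have "r \<noteq> s" using r(1) s(1) by auto
  then have rs: "r < s" using r(1) by auto
  have above: "norm (g t) > 1 / 2" if t: "r < t" "t < s" for t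
  proof (rule ccontr)
    assume "\<not> norm (g t) > 1 / 2"
    then obtain t' where t': "t \<le> t'" "t' \<le> s" "norm (g t') = 1 / 2"
      using IVT'[of "\<lambda>t. norm (g t)" t "1 / 2" s] t s(1) r(1) cont[of t s] by auto
    then have "t' \<le> r" using r t by auto
    then show False using t t'(1) by simp
  qed
  show thesis
    by (rule that[of r s]) (use r(1) s(1) rs above below in auto)
qed

context drawn_diagram
begin

text \<open>
  If no lifted arc passes \<open>m\<close>, all arcs have lifts over the interval from \<open>m\<close> to \<open>m + n - 1\<close>,
  and together with the lift of the boundary segment these give a branch of the logarithm on
  the union \<open>X\<close> of the segment and the drawn arcs. So the origin can escape from \<open>X\<close>, and it
  has to do so through the remaining boundary segment.
\<close>

lemma cut_exists:
  assumes m: "\<And>x y. (x, y) \<in> Lift \<Longrightarrow> x < m \<Longrightarrow> y < m"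
  shows "\<exists>h. is_cut n E D m h"
proof -
  define good where "good e q \<longleftrightarrow> (case q of (h, x, y) \<Rightarrow> path h \<and> (m \<le> x \<and> x \<le> y \<and> y \<le> m + n - 1) \<and>
      (h 0 = ang n (of_int x) \<and> h 1 = ang n (of_int y)) \<and> (\<forall>t\<in>{0..1}. exp (h t) = D e t) \<and>
      (\<forall>t\<in>{0<..<1}. Re (h t) < 0))" for e and q :: "(real \<Rightarrow> complex) \<times> int \<times> int"
  have "\<exists>q. good e q" if e: "e \<in> E" for e
  proof -
    obtain a b where ab: "e = (a, b)" by (cases e)
    obtain k x where x: "a = x + k * n" "x \<in> {m..<m + n}" using shift_into_range[OF n_pos] .
    define y where "y = arc_end n a b + (- k) * n"
    have L: "(x, y) \<in> Lift" using liftI[of a b E "- k" n] e ab x(1) by (simp add: y_def)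
    have "y < m + n"
      using m[of "x - n" "y - n"] L shift[of x "-1" y] x(2) by simp
    obtain a' b' k' h where h: "(a', b') \<in> E" "x = a' + k' * n" "y = arc_end n a' b' + k' * n"
      "path h" "h 0 = ang n (of_int x)" "h 1 = ang n (of_int y)"
      "\<And>t. t \<in> {0..1} \<Longrightarrow> exp (h t) = D (a', b') t" "\<And>t. t \<in> {0<..<1} \<Longrightarrow> Re (h t) < 0"
      using lifted_arc[OF n_pos drawing L] by metis
    have "a + (- k) * n = a' + k' * n" using x h(2) by simp
    then have "- k = k' \<and> a = a'"
      by (rule shifted_range_unique[where c = 1]) (use e ab h(1) E_sub in auto)
    then have "(a', b') = e"
      using E_out e ab h(1) by blast
    then show ?thesis using h x(2) \<open>y < m + n\<close> len[OF L]
      by (intro exI[of _ "(h, x, y)"]) (auto simp: good_def)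
  qed
  then obtain Q where Q: "\<And>e. e \<in> E \<Longrightarrow> good e (Q e)" by metis
  define H lo hi where "H e = fst (Q e)" and "lo e = fst (snd (Q e))" and "hi e = snd (snd (Q e))" for e
  have H: "\<And>e. e \<in> E \<Longrightarrow> path (H e)"
    "\<And>e. e \<in> E \<Longrightarrow> m \<le> lo e \<and> lo e \<le> hi e \<and> hi e \<le> m + n - 1"
    "\<And>e. e \<in> E \<Longrightarrow> H e 0 = ang n (of_int (lo e)) \<and> H e 1 = ang n (of_int (hi e))"
    "\<And>e t. e \<in> E \<Longrightarrow> t \<in> {0..1} \<Longrightarrow> exp (H e t) = D e t"
    "\<And>e t. e \<in> E \<Longrightarrow> t \<in> {0<..<1} \<Longrightarrow> Re (H e t) < 0"
    using Q unfolding good_def H_def lo_def hi_def by (fastforce simp: case_prod_unfold)+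
  define B where "B = ang n ` {of_int m..of_int (m + n - 1)}"
  define Y where "Y = B \<union> (\<Union>e\<in>E. path_image (H e))"
  define X where "X = exp ` Y"
  have compY: "compact Y"
    unfolding Y_def
  proof (intro compact_Un compact_UN finite_E)
    show "compact B" unfolding B_def ang_def
      by (intro compact_continuous_image continuous_intros) (use n_pos in auto)
    show "compact (path_image (H e))" if "e \<in> E" for e using H(1)[OF that] by (rule compact_path_image)
  qed
  have Ycases: "(\<exists>s. of_int m \<le> s \<and> s \<le> of_int (m + n - 1) \<and> p = ang n s) \<or>
      (\<exists>e\<in>E. \<exists>t\<in>{0<..<1}. p = H e t)" if p: "p \<in> Y" for p
  proof (cases "p \<in> B")
    case True
    then show ?thesis unfolding B_def by auto
  next
    case False
    then obtain e t where e: "e \<in> E" "t \<in> {0..1}" "p = H e t"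
      using p unfolding Y_def path_image_def by blast
    consider "t = 0" | "t = 1" | "t \<in> {0<..<1}" using e(2) by force
    then show ?thesis
    proof cases
      case 1
      then show ?thesis using e H(2,3)[OF e(1)] by (intro disjI1 exI[of _ "of_int (lo e)"]) auto
    next
      case 2
      then show ?thesis using e H(2,3)[OF e(1)] by (intro disjI1 exI[of _ "of_int (hi e)"]) auto
    qed (use e in blast)
  qed
  have inj: "inj_on exp Y"
  proof (rule inj_onI)
    fix p q assume p: "p \<in> Y" and q: "q \<in> Y" and eq: "exp p = exp q"
    have Re_eq: "Re p = Re q" using eq by (metis exp_inj_iff norm_exp_eq_Re)
    show "p = q"
    proof (cases "Re p < 0")
      case True
      have inner: "\<exists>e\<in>E. \<exists>t\<in>{0<..<1}. p = H e t" if "p \<in> Y" "Re p < 0" for p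
        using Ycases[OF that(1)] that(2) by (auto simp: ang_simps)
      obtain e t where e: "e \<in> E" "t \<in> {0<..<1}" "p = H e t" using inner[OF p True] by blast
      obtain e' t' where e': "e' \<in> E" "t' \<in> {0<..<1}" "q = H e' t'" using inner[OF q] True Re_eq by auto
      have tt: "t \<in> {0..1}" "t' \<in> {0..1}" using e(2) e'(2) by auto
      have D: "D e t = D e' t'" using eq H(4)[OF e(1) tt(1)] H(4)[OF e'(1) tt(2)] e(3) e'(3) by simp
      then have "D e ` {0<..<1} \<inter> D e' ` {0<..<1} \<noteq> {}" using e(2) e'(2) by blast
      then have ee: "e = e'" using drawing e(1) e'(1) unfolding is_drawing_def by blast
      have "simple_path (D e)" using drawn[of "fst e" "snd e"] e(1) unfolding simple_curve_def by simp
      then have "t = t' \<or> t = 0 \<and> t' = 1 \<or> t = 1 \<and> t' = 0"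
        using D tt unfolding simple_path_def loop_free_def ee by blast
      then show ?thesis using e e' ee by auto
    next
      case False
      have bdry: "\<exists>s. of_int m \<le> s \<and> s \<le> of_int (m + n - 1) \<and> p = ang n s" if "p \<in> Y" "\<not> Re p < 0" for p
        using Ycases[OF that(1)] H(5) that(2) by blast
      obtain s where s: "of_int m \<le> s" "s \<le> of_int (m + n - 1)" "p = ang n s"
        using bdry[OF p False] by blast
      obtain s' where s': "of_int m \<le> s'" "s' \<le> of_int (m + n - 1)" "q = ang n s'"
        using bdry[OF q] False Re_eq by auto
      obtain k :: int where k: "s = s' + of_int (k * n)"
        using exp_ang_eq[OF n_pos] eq unfolding s(3) s'(3) by blast
      have "s < of_int m + of_int n" "s' < of_int m + of_int n" using s(2) s'(2) by simp_all
      moreover have "of_int (k * n) = s - s'" using k by simp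
      ultimately have "of_int (k * n) < (of_int n :: real)" "- of_int n < (of_int (k * n) :: real)"
        using s(1) s'(1) by linarith+
      then have "k * n < 1 * n" "(-1) * n < k * n" by linarith+
      then have "k < 1" "-1 < k" using n_pos mult_less_cancel_right_pos by blast+
      then have "k = 0" by simp
      then show ?thesis using s s' k by simp
    qed
  qed
  have compX: "compact X" unfolding X_def using compY by (intro compact_continuous_image continuous_intros)
  have X0: "0 \<notin> X" unfolding X_def by auto
  have "continuous_on (exp ` Y) (the_inv_into Y exp)"
    by (rule continuous_on_inv[OF _ compY]) (auto intro!: continuous_intros the_inv_into_f_f[OF inj])
  moreover have "exp (the_inv_into Y exp z) = z" if "z \<in> X" for z
    using that unfolding X_def by (rule f_the_inv_into_f[OF inj])
  ultimately have "\<not> bounded (connected_component_set (- X) 0)"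
    using logarithm_imp_unbounded_component[OF compX X0] unfolding X_def by blast
  then obtain w where w: "connected_component (- X) 0 w" "norm w > 1"
    unfolding bounded_iff by (metis mem_Collect_eq not_le)
  have "open (- X)" using compX by (simp add: compact_imp_closed open_Compl)
  then have "path_component (- X) 0 w"
    using w(1) path_component_eq_connected_component open_imp_locally_path_connected by metis
  then obtain p where p: "path p" "path_image p \<subseteq> - X" "pathstart p = 0" "pathfinish p = w"
    unfolding path_component_def by blast
  have "0 \<noteq> w" using w(2) by auto
  then obtain g where g: "arc g" "path_image g \<subseteq> path_image p" "pathstart g = 0" "pathfinish g = w"
    using path_contains_arc[OF p(1,3,4)] by blast
  have gX: "g t \<notin> X" if "t \<in> {0..1}" for t using g(2) p(2) that unfolding path_image_def by blast
  have "norm (pathfinish g) > 1" using g(4) w(2) by simp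
  then obtain r s where rs: "0 \<le> r" "r < s" "s \<le> 1" "norm (g r) = 1 / 2" "norm (g s) = 1"
    "\<And>t. r < t \<Longrightarrow> t < s \<Longrightarrow> 1 / 2 < norm (g t) \<and> norm (g t) < 1"
    using radial_crossing[OF arc_imp_path[OF g(1)] g(3)] by metis
  define h where "h = subpath s r g"
  have arc: "arc h" unfolding h_def by (rule arc_subpath_arc[OF g(1)]) (use rs in auto)
  obtain x where x: "of_int m \<le> x" "x < of_int m + of_int n" "g s = exp (ang n x)"
    using circle_point_angle[OF n_pos rs(5)] by blast
  have "\<not> x \<le> of_int (m + n - 1)"
  proof
    assume "x \<le> of_int (m + n - 1)"
    then have "g s \<in> X" unfolding X_def Y_def B_def using x by auto
    then show False using gX[of s] rs by auto
  qed
  then have "\<exists>x::real. of_int (m + n - 1) < x \<and> x < of_int (m + n) \<and> pathstart h = cis (- (2 * pi * x / of_int n))"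
    using x by (intro exI[of _ x]) (auto simp: h_def exp_ang)
  moreover have "norm (pathfinish h) = 1 / 2" using rs(4) by (simp add: h_def)
  moreover have "h ` {0<..<1} \<subseteq> {z. 1 / 2 < norm z \<and> norm z < 1}"
  proof clarify
    fix u :: real assume u: "u \<in> {0<..<1}"
    have "0 < u * (s - r)" "u * (s - r) < 1 * (s - r)"
      using u rs(2) by (auto intro!: mult_pos_pos mult_strict_right_mono)
    then have "r < s + (r - s) * u" "s + (r - s) * u < s" by (simp_all add: algebra_simps)
    from rs(6)[OF this] show "1 / 2 < norm (h u) \<and> norm (h u) < 1" by (simp add: h_def subpath_def add.commute)
  qed
  moreover have "path_image h \<inter> path_image (D e) = {}" if e: "e \<in> E" for e
  proof -
    have "path_image h \<subseteq> - X"
      using path_image_subpath_subset[of s r g] rs g(2) p(2) unfolding h_def by auto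
    moreover have "path_image (D e) \<subseteq> X"
      unfolding X_def Y_def path_image_def using H(4)[OF e] e by (force simp: image_iff)
    ultimately show ?thesis by blast
  qed
  ultimately show ?thesis unfolding is_cut_def using arc by blast
qed

end

section \<open>Compass labelings\<close>

text \<open>
  Fewer than \<open>n\<close> consecutive integers determine, by their residues, where the run starts; so
  relabelling them by an interval with the same residues is a translation.
\<close>

lemma residue_interval_labels:
  fixes f :: "int \<Rightarrow> int"
  assumes n: "n > 0" and len: "q - p + 1 < n" and pq: "p \<le> q"
    and res: "\<And>y. y \<in> {p..q} \<Longrightarrow> f y mod n = y mod n" and im: "f ` {p..q} = {l..u}"
  obtains t where "\<And>y. y \<in> {p..q} \<Longrightarrow> f y = y + t * n"
proof -
  have near: "y = y'" if "y mod n = y' mod n" "\<bar>y - y'\<bar> < n" for y y' :: int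
  proof -
    have "n dvd y - y'" using that(1) by (metis mod_eq_dvd_iff)
    then show ?thesis using that(2) dvd_imp_le_int[of "y - y'" n] n by force
  qed
  have "inj_on f {p..q}"
  proof (rule inj_onI)
    fix y y' assume y: "y \<in> {p..q}" "y' \<in> {p..q}" "f y = f y'"
    then have "y mod n = y' mod n" using res by metis
    moreover have "\<bar>y - y'\<bar> < n" using y(1,2) len by auto
    ultimately show "y = y'" by (rule near)
  qed
  then have "card {l..u} = card {p..q}" using card_image im by metis
  moreover have "f p \<in> {l..u}" unfolding im[symmetric] using pq by simp
  ultimately have lu: "u = l + (q - p)" using pq by auto
  have lf: "l = f p"
  proof (rule ccontr)
    assume "l \<noteq> f p"
    moreover have "f p \<in> {l..u}" unfolding im[symmetric] using pq by simp
    ultimately have "f p - 1 \<in> f ` {p..q}" unfolding im by auto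
    then obtain y where y: "y \<in> {p..q}" "f y = f p - 1" by auto
    have "y mod n = (f p - 1) mod n" using res[OF y(1)] y(2) by simp
    also have "\<dots> = (p - 1) mod n" using res[of p] pq by (metis atLeastAtMost_iff mod_diff_left_eq order_refl)
    finally have "y mod n = (p - 1) mod n" .
    moreover have "\<bar>y - (p - 1)\<bar> < n" using y(1) len by auto
    ultimately have "y = p - 1" by (rule near)
    then show False using y by simp
  qed
  have "n dvd f p - p" using res[of p] pq by (metis atLeastAtMost_iff mod_eq_dvd_iff order_refl)
  then obtain t where "f p - p = n * t" by blast
  then have t: "f p = p + t * n" by (simp add: algebra_simps)
  have "f y = y + t * n" if y: "y \<in> {p..q}" for y
  proof (rule near)
    show "f y mod n = (y + t * n) mod n" using res[OF y] by simp
    have "f y \<in> {l..u}" using im y by blast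
    then show "\<bar>f y - (y + t * n)\<bar> < n" using lf t lu y len by auto
  qed
  then show thesis by (rule that)
qed

context diagram
begin

text \<open>
  The compass labeling, for a suitable \<open>m\<close>: labels off the cycle are the representatives in
  \<open>{m..<m + n}\<close>.
\<close>

definition label :: "int \<Rightarrow> int \<Rightarrow> int" where
  "label m i = (if i \<in> {1..n} then if i \<in> Cyc \<or> m \<le> i then i else i + n else undefined)"

lemma label_labeling: "is_labeling n (label m)"
  by (auto simp: is_labeling_def label_def extensional_def)

lemma label_pos: "i \<in> {1..n} \<Longrightarrow> label m i > 0"
  by (auto simp: label_def)

lemma label_eqI:
  assumes "m \<in> {1..n}" "i \<in> {1..n}" "i \<notin> Cyc" "i + k * n \<in> {m..<m + n}"
  shows "label m i = i + k * n"
proof -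
  obtain l where l: "label m i = i + l * n" "label m i \<in> {m..<m + n}"
  proof (cases "m \<le> i")
    case True
    then show ?thesis using that[of 0] assms by (auto simp: label_def)
  next
    case False
    then show ?thesis using that[of 1] assms by (auto simp: label_def)
  qed
  have "label m i = (i + k * n) + (l - k) * n" using l(1) by (simp add: algebra_simps)
  then have "l - k = 0 \<and> label m i = i + k * n" by (rule shifted_range_unique0) (use assms l in auto)
  then show ?thesis by simp
qed

lemma label_rep:
  assumes "m \<in> {1..n}" "u \<notin> Cyc" "u \<in> {m..<m + n}"
  obtains i k where "i \<in> {1..n}" "i \<notin> Cyc" "u = i + k * n" "label m i = u"
proof -
  obtain k r where r: "u = r + k * n" "r \<in> {1..<1 + n}" using shift_into_range[OF n_pos] .
  then have "r \<notin> Cyc" using assms Cyc_shift by simp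
  then show thesis using that[of r k] r label_eqI[OF assms(1), of r k] assms(3) by auto
qed

lemma label_shift: "i \<in> {1..n} \<Longrightarrow> i \<notin> Cyc \<Longrightarrow> \<exists>k. label m i = i + k * n"
  by (auto simp: label_def intro: exI[of _ 0] exI[of _ 1])

lemma label_range: "m \<in> {1..n} \<Longrightarrow> i \<in> {1..n} \<Longrightarrow> i \<notin> Cyc \<Longrightarrow> label m i \<in> {m..<m + n}"
  by (auto simp: label_def)

text \<open>
  The head of an arc whose tail has its label in \<open>{c..d}\<close> has a lift in \<open>{c..d}\<close>, as the lifted arc
  does not leave this interval; by uniqueness of representatives, that lift is its label.
\<close>

lemma label_arcs_interval:
  assumes m: "m \<in> {1..n}" and cd: "m \<le> c" "d < m + n" and no: "\<And>u. u \<in> {c..d} \<Longrightarrow> u \<notin> Cyc"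
    and closed: "\<And>x y. c \<le> x \<Longrightarrow> x \<le> d \<Longrightarrow> (x, y) \<in> Lift \<Longrightarrow> y \<le> d"
    and F: "F = {(a, b) \<in> E. a \<notin> Cyc \<and> label m a \<in> {c..d}}"
  shows "label_arcs (label m) F = restrict_arcs Lift c d"
    and "(a, b) \<in> F \<Longrightarrow> label m a < label m b"
proof -
  have im: "(label m a, label m b) \<in> restrict_arcs Lift c d" if "(a, b) \<in> F" for a b
  proof -
    have ab: "(a, b) \<in> E" "a \<notin> Cyc" "label m a \<in> {c..d}" using that F by auto
    have rng: "a \<in> {1..n}" "b \<in> {1..n}" using ab(1) E_sub by auto
    obtain k where k: "label m a = a + k * n" using label_shift[OF rng(1) ab(2)] by blast
    define v where "v = arc_end n a b + k * n"
    have L: "(label m a, v) \<in> Lift" unfolding k v_def using liftI[OF ab(1)] .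
    then have v: "v \<in> {c..d}" using closed[OF _ _ L] len[OF L] ab(3) by auto
    have b: "b \<notin> Cyc" using cycle_arcs_Cyc[OF ab(1)] ab(2) by simp
    obtain j where "v = b + j * n"
      using arc_end_cases[of a b] unfolding v_def by (metis add.assoc mult.commute mult.right_neutral distrib_left)
    then have "label m b = v" using label_eqI[OF m rng(2) b, of j] v cd by auto
    then show ?thesis using L ab(3) v unfolding restrict_arcs_def by simp
  qed
  show "label_arcs (label m) F = restrict_arcs Lift c d"
  proof
    show "label_arcs (label m) F \<subseteq> restrict_arcs Lift c d" using im unfolding label_arcs_def by auto
    show "restrict_arcs Lift c d \<subseteq> label_arcs (label m) F"
    proof clarify
      fix u v assume "(u, v) \<in> restrict_arcs Lift c d"
      then have uv: "(u, v) \<in> Lift" "u \<in> {c..d}" "v \<in> {c..d}" unfolding restrict_arcs_def by auto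
      obtain a b k where ab: "(a, b) \<in> E" "u = a + k * n" "v = arc_end n a b + k * n"
        using uv(1) by (rule liftE)
      have rng: "a \<in> {1..n}" using ab(1) E_sub by auto
      have "a \<notin> Cyc" using no[OF uv(2)] ab(2) Cyc_shift by simp
      then have la: "label m a = u" using label_eqI[OF m rng, of k] ab(2) uv(2) cd by auto
      have abF: "(a, b) \<in> F" using ab(1) \<open>a \<notin> Cyc\<close> la uv(2) F by auto
      then have "(u, label m b) \<in> Lift" using im[OF abF] la unfolding restrict_arcs_def by auto
      then have "label m b = v" using out_unique uv(1) by blast
      then show "(u, v) \<in> label_arcs (label m) F" unfolding label_arcs_def using abF la by force
    qed
  qed
  show "label m a < label m b" if "(a, b) \<in> F"
    using im[OF that] len unfolding restrict_arcs_def by blast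
qed

end

context drawn_diagram
begin

section \<open>Acyclic diagrams\<close>

text \<open>
  The increasing labelings by an interval \<open>{l..l + n - 1}\<close> correspond to the positions \<open>l\<close> that no
  lifted arc passes, and the compass labeling to the least positive one \<open>m\<close>.
\<close>



lemma acyclic_construction:
  assumes "Cyc = {}"
  shows "\<exists>!\<phi>. is_compass_labeling n E D \<phi>"
    and "\<exists>h. is_cut n E D (Min (compass n E D ` {1..n})) h"
    and "\<exists>v m. constructed_windows n E D = windows_of v [] \<and> sorted_wrt strict v \<and> set v = {m..<m + n} \<and>
      (\<forall>x\<in>set v. \<forall>y. over x y \<longrightarrow> y < m + n)"
proof -
  have nc: "\<not> has_cycle E" using assms has_cycle_iff by simp
  have noC: "u \<notin> Cyc" for u using assms by simp
  define P where "P m \<longleftrightarrow> m > 0 \<and> (\<forall>x y. (x, y) \<in> Lift \<longrightarrow> x < m \<longrightarrow> y < m)" for m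
  obtain m0 where m0: "m0 \<in> {1..n}" "\<And>x y. (x, y) \<in> Lift \<Longrightarrow> x < m0 \<Longrightarrow> y < m0"
    using uncovered_gap[OF assms] by blast
  then have "P m0" unfolding P_def by auto
  define m where "m = int (LEAST k. P (int k))"
  have Pn: "P (int (nat m0))" using \<open>P m0\<close> m0(1) by simp
  have Pm: "P m" unfolding m_def using LeastI[of "\<lambda>k. P (int k)", OF Pn] .
  have mle: "m \<le> int (nat m0)" unfolding m_def using Least_le[of "\<lambda>k. P (int k)", OF Pn] by linarith
  have least: "m \<le> l" if "P l" for l
  proof -
    have "P (int (nat l))" using that unfolding P_def by simp
    from Least_le[of "\<lambda>k. P (int k)", OF this] have "m \<le> int (nat l)" unfolding m_def by linarith
    then show ?thesis using that unfolding P_def by simp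
  qed
  have m: "m \<in> {1..n}" using Pm mle m0(1) unfolding P_def by auto
  have unc: "y < m" if "(x, y) \<in> Lift" "x < m" for x y using Pm that unfolding P_def by blast
  have unc': "y < m + n" if "(x, y) \<in> Lift" "x < m + n" for x y
    using unc[of "x - n" "y - n"] that shift[of x "-1" y] by simp
  have closed: "y \<le> m + n - 1" if "m \<le> x" "x \<le> m + n - 1" "(x, y) \<in> Lift" for x y
    using unc'[OF that(3)] that by simp
  have EF: "E = {(a, b) \<in> E. a \<notin> Cyc \<and> label m a \<in> {m..m + n - 1}}"
    using label_range[OF m _ noC] E_sub noC by auto
  note la = label_arcs_interval[OF m order_refl _ noC closed EF]
  have arcs: "label_arcs (label m) E = restrict_arcs Lift m (m + n - 1)" using la(1) by simp
  have im: "label m ` {1..n} = {m..m + n - 1}"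
  proof
    show "label m ` {1..n} \<subseteq> {m..m + n - 1}" using label_range[OF m _ noC] by force
    show "{m..m + n - 1} \<subseteq> label m ` {1..n}"
    proof
      fix u assume u: "u \<in> {m..m + n - 1}"
      obtain i k where "i \<in> {1..n}" "label m i = u"
        using label_rep[OF m noC, of u] u by auto
      then show "u \<in> label m ` {1..n}" by auto
    qed
  qed
  have adm: "admissible_acyclic n E (label m)"
    unfolding admissible_acyclic_def using label_labeling label_pos im la(2) by auto
  have char: "\<rho> = label m \<or> (\<Sum>i\<in>{1..n}. label m i) < (\<Sum>i\<in>{1..n}. \<rho> i)" and
      ge: "(\<Sum>i\<in>{1..n}. label m i) \<le> (\<Sum>i\<in>{1..n}. \<rho> i)" if adm': "admissible_acyclic n E \<rho>" for \<rho>
  proof -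
    obtain l u where lu: "\<rho> ` {1..n} = {l..u}" using adm' unfolding admissible_acyclic_def by blast
    have res: "\<rho> i mod n = i mod n" if "i \<in> {1..n}" for i
      using adm' that unfolding admissible_acyclic_def is_labeling_def by blast
    have inj: "inj_on \<rho> {1..n}"
    proof (rule inj_onI)
      fix i j assume ij: "i \<in> {1..n}" "j \<in> {1..n}" "\<rho> i = \<rho> j"
      then have "i mod n = j mod n" using res by metis
      then obtain k where "j = i + k * n" using mod_eq_imp_shift[of n n i j] by blast
      then have "k = 0 \<and> j = i" by (rule shifted_range_unique0[where c = 1]) (use ij in auto)
      then show "i = j" by simp
    qed
    have "card {l..u} = card {1..n}" using card_image[OF inj] lu by simp
    then have u: "u = l + n - 1" using n_pos by auto
    have rl: "\<rho> i \<in> {l..<l + n}" if "i \<in> {1..n}" for i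
    proof -
      have "\<rho> i \<in> {l..u}" using lu that by blast
      then show ?thesis unfolding u by auto
    qed
    have rho_shift: "\<exists>k. \<rho> i = i + k * n" if "i \<in> {1..n}" for i
      using mod_eq_imp_shift[of n n i "\<rho> i"] res[OF that] by metis
    have "P l"
      unfolding P_def
    proof (intro conjI allI impI)
      have "l \<in> \<rho> ` {1..n}" unfolding lu u using n_pos by simp
      then show "0 < l" using adm' unfolding admissible_acyclic_def by auto
      fix x y assume xy: "(x, y) \<in> Lift" "x < l"
      show "y < l"
      proof (rule ccontr)
        assume "\<not> y < l"
        obtain a b k where ab: "(a, b) \<in> E" "x = a + k * n" "y = arc_end n a b + k * n"
          using xy(1) by (rule liftE)
        have rng: "a \<in> {1..n}" "b \<in> {1..n}" using ab(1) E_sub by auto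
        have lxy: "x < y" "y \<le> x + n" using len[OF xy(1)] by auto
        obtain j where j: "\<rho> a = a + j * n" using rho_shift[OF rng(1)] by blast
        have "x + n \<in> {l..<l + n}" using xy(2) lxy \<open>\<not> y < l\<close> by auto
        moreover have "\<rho> a = (x + n) + (j - k - 1) * n" using j ab(2) by (simp add: algebra_simps)
        ultimately have ra: "\<rho> a = x + n" using shifted_range_unique0 rl[OF rng(1)] by blast
        obtain i where i: "\<rho> b = b + i * n" using rho_shift[OF rng(2)] by blast
        obtain e where e: "y = b + e * n"
          using arc_end_cases[of a b] ab(3) by (metis add.assoc mult.commute mult.right_neutral distrib_left)
        have "y \<in> {l..<l + n}" using xy(2) lxy \<open>\<not> y < l\<close> by auto
        moreover have "\<rho> b = y + (i - e) * n" using i e by (simp add: algebra_simps)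
        ultimately have "\<rho> b = y" using shifted_range_unique0 rl[OF rng(2)] by blast
        moreover have "\<rho> a < \<rho> b" using adm' ab(1) unfolding admissible_acyclic_def by blast
        ultimately show False using ra lxy by simp
      qed
    qed
    then have ml: "m \<le> l" by (rule least)
    have le: "label m i \<le> \<rho> i" if i: "i \<in> {1..n}" for i
    proof -
      obtain k where k: "\<rho> i = i + k * n" using rho_shift[OF i] by blast
      obtain j where j: "label m i = i + j * n" using label_shift[OF i noC] by blast
      have "i + j * n < i + (k + 1) * n"
        using label_range[OF m i noC] rl[OF i] ml k j by (simp add: algebra_simps)
      then have "j < k + 1" using n_pos mult_less_cancel_right_pos by force
      then show ?thesis using k j n_pos by simp
    qed
    show "(\<Sum>i\<in>{1..n}. label m i) \<le> (\<Sum>i\<in>{1..n}. \<rho> i)" using le by (rule sum_mono)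
    show "\<rho> = label m \<or> (\<Sum>i\<in>{1..n}. label m i) < (\<Sum>i\<in>{1..n}. \<rho> i)"
    proof (cases "\<forall>i\<in>{1..n}. \<rho> i = label m i")
      case True
      have "\<rho> \<in> extensional {1..n}" "label m \<in> extensional {1..n}"
        using adm' label_labeling unfolding admissible_acyclic_def is_labeling_def by auto
      then have "\<rho> = label m" using True by (intro extensionalityI) auto
      then show ?thesis ..
    next
      case False
      then obtain i where "i \<in> {1..n}" "label m i < \<rho> i" using le by (metis order_le_imp_less_or_eq)
      then show ?thesis using le by (intro disjI2 sum_strict_mono_ex1) auto
    qed
  qed
  have comp: "is_compass_labeling n E D \<phi> \<longleftrightarrow> \<phi> = label m" for \<phi>
    unfolding is_compass_labeling_def using nc adm char ge by (metis linorder_not_le)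
  then show "\<exists>!\<phi>. is_compass_labeling n E D \<phi>" by simp
  have compass: "compass n E D = label m" unfolding compass_def comp by simp
  have "Min {m..m + n - 1} = m" using n_pos by (intro Min_eqI) auto
  then have Min: "Min (compass n E D ` {1..n}) = m" unfolding compass im .
  show "\<exists>h. is_cut n E D (Min (compass n E D ` {1..n})) h"
    unfolding Min using cut_exists unc by blast
  have "Sub_ok m (m + n - 1)" using closed by (rule Sub_ok)
  moreover have Wx: "W_wax n E D = Sub m (m + n - 1) (restrict_arcs Lift m (m + n - 1))"
    unfolding W_wax_def Sub_cut_open_def Let_def Min unfolding compass arcs using nc by simp
  ultimately have v: "set (W_wax n E D) = {m..m + n - 1}" "sorted_wrt strict (W_wax n E D)"
    unfolding Sub_ok_def by auto
  have reach: "z < m + n" if "(x, z) \<in> Lift\<^sup>*" "x < m + n" for x z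
    using that by (induction rule: rtrancl_induct) (use unc' in auto)
  have "W_wax n E D \<noteq> []" using v(1) n_pos by auto
  then have "constructed_windows n E D = windows_of (W_wax n E D) []"
    unfolding constructed_windows_def windows_of_def using nc by simp
  moreover have "{m..m + n - 1} = {m..<m + n}" by auto
  moreover have "\<forall>x\<in>set (W_wax n E D). \<forall>y. over x y \<longrightarrow> y < m + n"
    using reach v(1) unfolding over_def by fastforce
  ultimately show "\<exists>v m. constructed_windows n E D = windows_of v [] \<and> sorted_wrt strict v \<and> set v = {m..<m + n} \<and>
      (\<forall>x\<in>set v. \<forall>y. over x y \<longrightarrow> y < m + n)"
    using v by blast
qed

section \<open>Diagrams with a cycle\<close>

context
  assumes ne: "Cyc \<noteq> {}"
begin

text \<open>
  All gaps between consecutive elements of \<open>Cyc\<close> that start in \<open>{0..<n}\<close> lie between \<open>base\<close> and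
  \<open>base + n\<close>. At most one of them extends beyond \<open>n\<close>; it contains the points of \<open>{1..<base}\<close>, whose labels exceed \<open>n\<close>.
\<close>

definition base :: int where
  "base = int (LEAST k. int k \<in> Cyc)"

lemma base: "base \<in> Cyc" "base \<in> {0..<n}" "x \<in> Cyc \<Longrightarrow> 0 \<le> x \<Longrightarrow> base \<le> x"
proof -
  obtain c where c: "c \<in> Cyc" using ne by blast
  obtain k r where r: "c = r + k * n" "r \<in> {0..<0 + n}" using shift_into_range[OF n_pos] .
  then have rC: "int (nat r) \<in> Cyc" using c Cyc_shift by simp
  then show "base \<in> Cyc" unfolding base_def by (rule LeastI)
  show le: "base \<le> x" if "x \<in> Cyc" "0 \<le> x" for x
  proof -
    have "int (nat x) \<in> Cyc" using that by simp
    then have "(LEAST k. int k \<in> Cyc) \<le> nat x" by (rule Least_le)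
    then show ?thesis unfolding base_def using that(2) by linarith
  qed
  have "base \<le> r" using le[of r] rC r(2) by simp
  then show "base \<in> {0..<n}" using r(2) by (simp add: base_def)
qed

text \<open>
  The walkers, one nonempty gap for each; tails in \<open>{0..<n}\<close> make the least label positive and at
  most \<open>n\<close>.
\<close>

definition gaps :: "(int \<times> int) set" where
  "gaps = {(x, y) \<in> Lift. x \<in> Cyc \<and> 0 \<le> x \<and> x < n \<and> x + 1 < y}"

lemma gapsD:
  assumes "(x, y) \<in> gaps"
  shows "(x, y) \<in> Lift" "x \<in> Cyc" "y \<in> Cyc" "base \<le> x" "y \<le> base + n" "0 \<le> x" "x < n" "x + 1 < y"
proof -
  show *: "(x, y) \<in> Lift" "x \<in> Cyc" "0 \<le> x" "x < n" "x + 1 < y" using assms unfolding gaps_def by auto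
  show "y \<in> Cyc" using Cyc_arc * by blast
  show "base \<le> x" using base(3) * by blast
  have "base + n \<in> Cyc" using base(1) Cyc_shift[of base 1] by simp
  then show "y \<le> base + n" using Cyc_between[OF *(1)] *(4) base(2) by simp
qed

lemma gap_exists:
  assumes "u \<notin> Cyc"
  obtains x y k where "(x, y) \<in> gaps" "x < u + k * n" "u + k * n < y"
proof -
  obtain x y where xy: "(x, y) \<in> Lift" "x \<in> Cyc" "x < u" "u < y" using Cyc_below[OF ne assms] by blast
  obtain k r where r: "x = r + k * n" "r \<in> {0..<0 + n}" using shift_into_range[OF n_pos] .
  have L: "(r, y + (- k) * n) \<in> Lift" using shift[of x "- k" y] xy(1) r(1) by simp
  have "r \<in> Cyc" using xy(2) r(1) Cyc_shift by simp
  then have "(r, y + (- k) * n) \<in> gaps" using L r xy(3,4) unfolding gaps_def by auto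
  then show thesis by (rule that[of _ _ "- k"]) (use r xy in auto)
qed

lemma gap_inner: "(x, y) \<in> gaps \<Longrightarrow> u \<in> {x + 1..y - 1} \<Longrightarrow> u \<notin> Cyc \<and> u \<in> {base + 1..<base + 1 + n}"
  using gapsD[of x y] not_Cyc_under[of x y u] by auto

lemma gap_closed:
  assumes "(x, y) \<in> gaps" "x + 1 \<le> u" "u \<le> y - 1" "(u, v) \<in> Lift"
  shows "v \<le> y - 1"
  using under_arc[OF gapsD(1)[OF assms(1)], of u v] assms by auto

abbreviation "\<phi> \<equiv> label (base + 1)"

lemma base1: "base + 1 \<in> {1..n}"
  using base(2) by auto

lemma gap_points:
  assumes "(x, y) \<in> gaps"
  shows "walker_points n (gap_walker x) = {i \<in> {1..n}. i \<notin> Cyc \<and> \<phi> i \<in> {x + 1..y - 1}}"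
proof -
  note g = gapsD[OF assms]
  have "marked n i \<in> gap_walker x \<longleftrightarrow> i \<notin> Cyc \<and> \<phi> i \<in> {x + 1..y - 1}" if i: "i \<in> {1..n}" for i
  proof
    assume "marked n i \<in> gap_walker x"
    then obtain k where k: "x < i + k * n" "i + k * n < y" using mem_gap_walker[OF ne g(1,2,8)] by blast
    then have "i + k * n \<notin> Cyc \<and> i + k * n \<in> {base + 1..<base + 1 + n}"
      using gap_inner[OF assms, of "i + k * n"] by simp
    then have "i \<notin> Cyc" "\<phi> i = i + k * n" using label_eqI[OF base1 i, of k] Cyc_shift by auto
    then show "i \<notin> Cyc \<and> \<phi> i \<in> {x + 1..y - 1}" using k by simp
  next
    assume iC: "i \<notin> Cyc \<and> \<phi> i \<in> {x + 1..y - 1}"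
    then obtain k where "\<phi> i = i + k * n" using label_shift[OF i, of "base + 1"] by blast
    then have "x < i + k * n \<and> i + k * n < y" using iC by simp
    then show "marked n i \<in> gap_walker x" using mem_gap_walker[OF ne g(1,2,8)] by blast
  qed
  then show ?thesis unfolding walker_points_def by blast
qed

lemma gap_labels:
  assumes "(x, y) \<in> gaps"
  shows "\<phi> ` walker_points n (gap_walker x) = {x + 1..y - 1}"
proof
  show "\<phi> ` walker_points n (gap_walker x) \<subseteq> {x + 1..y - 1}" unfolding gap_points[OF assms] by blast
  show "{x + 1..y - 1} \<subseteq> \<phi> ` walker_points n (gap_walker x)"
  proof
    fix u assume u: "u \<in> {x + 1..y - 1}"
    obtain i k where "i \<in> {1..n}" "i \<notin> Cyc" "\<phi> i = u"
      using label_rep[OF base1, of u] gap_inner[OF assms u] by metis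
    then show "u \<in> \<phi> ` walker_points n (gap_walker x)" unfolding gap_points[OF assms] using u by blast
  qed
qed

lemma inj_label: "inj_on \<phi> ({1..n} - Cyc)"
proof (rule inj_onI)
  fix i j assume ij: "i \<in> {1..n} - Cyc" "j \<in> {1..n} - Cyc" "\<phi> i = \<phi> j"
  obtain k l where "\<phi> i = i + k * n" "\<phi> j = j + l * n" using ij label_shift by blast
  then have "i + k * n = j + l * n" using ij by simp
  then have "k = l \<and> i = j" by (rule shifted_range_unique[where c = 1]) (use ij in auto)
  then show "i = j" by simp
qed

lemma walkers_gaps: "walkers n E D = gap_walker ` fst ` gaps"
proof
  show "walkers n E D \<subseteq> gap_walker ` fst ` gaps"
  proof
    fix W assume "W \<in> walkers n E D"
    then obtain i where i: "i \<in> {1..n} - Cyc" "W = connected_component_set outer (marked n i)"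
      using walkers_eq[OF ne] by blast
    obtain x y k where g: "(x, y) \<in> gaps" "x < i + k * n" "i + k * n < y" using gap_exists i by blast
    then have "marked n i \<in> gap_walker x" using mem_gap_walker[OF ne gapsD(1,2,8)[OF g(1)]] by blast
    then have "W = gap_walker x" unfolding i(2) gap_walker_def[OF ne] by (metis connected_component_eq)
    then show "W \<in> gap_walker ` fst ` gaps" using g(1) by force
  qed
  show "gap_walker ` fst ` gaps \<subseteq> walkers n E D"
  proof clarify
    fix x y assume g: "(x, y) \<in> gaps"
    have "x + 1 \<notin> Cyc" using gap_inner[OF g, of "x + 1"] gapsD[OF g] by simp
    moreover have "x + 1 \<in> {1..n}" using gapsD[OF g] by simp
    ultimately show "gap_walker (fst (x, y)) \<in> walkers n E D"
      unfolding walkers_eq[OF ne] gap_walker_def[OF ne] fst_conv by blast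
  qed
qed

lemma label_cyclic_admissible: "admissible_cyclic n E D \<phi>"
proof -
  have "\<phi> a < \<phi> b" if "(a, b) \<in> E - cycle_of E" for a b
  proof -
    have ab: "(a, b) \<in> E" "a \<notin> Cyc" using that cycle_of_eq[OF ne] unfolding cycle_arcs_def by auto
    have rng: "a \<in> {1..n}" using ab E_sub by auto
    obtain k where k: "\<phi> a = a + k * n" using label_shift[OF rng ab(2)] by blast
    have ra: "\<phi> a \<in> {base + 1..<base + 1 + n}" using label_range[OF base1 rng ab(2)] .
    have "\<phi> a \<notin> Cyc" using ab(2) Cyc_shift unfolding k by simp
    then obtain x y where xy: "(x, y) \<in> Lift" "x \<in> Cyc" "x < \<phi> a" "\<phi> a < y" using Cyc_below[OF ne] by blast
    have bx: "base \<le> x" using Cyc_between[OF xy(1) base(1)] xy(4) ra by force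
    have "base + n \<in> Cyc" using base(1) Cyc_shift[of base 1] by simp
    then have "\<phi> a \<noteq> base + n" using \<open>\<phi> a \<notin> Cyc\<close> by auto
    then have "\<phi> a < base + n" using ra by simp
    then have "x < base + n" using xy(3) by simp
    then have yb: "y \<le> base + n" using Cyc_between[OF xy(1)] \<open>base + n \<in> Cyc\<close> by blast
    have no: "u \<notin> Cyc" if "u \<in> {x + 1..y - 1}" for u using not_Cyc_under[OF xy(1)] that by simp
    have closed: "v \<le> y - 1" if "x + 1 \<le> u" "u \<le> y - 1" "(u, v) \<in> Lift" for u v
      using under_arc[OF xy(1), of u v] that by auto
    show ?thesis
      by (rule label_arcs_interval(2)[OF base1 _ _ no closed refl]) (use ab xy bx yb in auto)
  qed
  moreover have "\<exists>l u. \<phi> ` walker_points n W = {l..u}" if "W \<in> walkers n E D" for W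
    using that gap_labels unfolding walkers_gaps by force
  ultimately show ?thesis unfolding admissible_cyclic_def using label_labeling label_pos by auto
qed

lemma cyclic_admissible_shift:
  assumes adm: "admissible_cyclic n E D \<rho>" and g: "(x, y) \<in> gaps"
  obtains t where "t \<ge> 0" "\<And>i. i \<in> walker_points n (gap_walker x) \<Longrightarrow> \<rho> i = \<phi> i + t * n"
proof -
  define WP where "WP = walker_points n (gap_walker x)"
  have WP: "WP \<subseteq> {1..n} - Cyc" unfolding WP_def gap_points[OF g] by blast
  have inj: "inj_on \<phi> WP" using inj_label WP by (rule inj_on_subset)
  have im: "\<phi> ` WP = {x + 1..y - 1}" unfolding WP_def by (rule gap_labels[OF g])
  define f where "f u = \<rho> (the_inv_into WP \<phi> u)" for u
  have f: "f (\<phi> i) = \<rho> i" if "i \<in> WP" for i using the_inv_into_f_f[OF inj that] by (simp add: f_def)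
  have W: "gap_walker x \<in> walkers n E D" unfolding walkers_gaps using g by force
  obtain l u where lu: "\<rho> ` WP = {l..u}" using adm W unfolding admissible_cyclic_def WP_def by blast
  have "f ` {x + 1..y - 1} = {l..u}" unfolding im[symmetric] lu[symmetric] image_image using f by (intro image_cong) auto
  moreover have "f v mod n = v mod n" if v: "v \<in> {x + 1..y - 1}" for v
  proof -
    obtain i where i: "i \<in> WP" "v = \<phi> i" using v im by blast
    then have "i \<in> {1..n}" using WP by blast
    then have "\<rho> i mod n = i mod n" "\<phi> i mod n = i mod n"
      using adm label_labeling[of "base + 1"] unfolding admissible_cyclic_def is_labeling_def by blast+
    then show ?thesis unfolding i(2) f[OF i(1)] by (simp only:)
  qed
  moreover have "y - 1 - (x + 1) + 1 < n" using len[OF gapsD(1)[OF g]] by simp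
  moreover have "x + 1 \<le> y - 1" using gapsD(8)[OF g] by simp
  ultimately obtain t where t: "\<And>v. v \<in> {x + 1..y - 1} \<Longrightarrow> f v = v + t * n"
    using residue_interval_labels[OF n_pos] by blast
  have "t \<ge> 0"
  proof (rule ccontr)
    assume "\<not> t \<ge> 0"
    then have "t * n \<le> (-1) * n" using n_pos by (intro mult_right_mono) auto
    then have "f (x + 1) \<le> 0" using t[of "x + 1"] gapsD(7,8)[OF g] by simp
    moreover obtain i where i: "i \<in> WP" "x + 1 = \<phi> i" using im gapsD(8)[OF g] by force
    moreover have "\<rho> i > 0" using adm i WP unfolding admissible_cyclic_def by blast
    ultimately show False using f[of i] by simp
  qed
  moreover have "\<rho> i = \<phi> i + t * n" if "i \<in> WP" for i
  proof -
    have "\<phi> i \<in> {x + 1..y - 1}" using im that by blast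
    then show ?thesis using t[of "\<phi> i"] f[OF that] by simp
  qed
  ultimately show thesis using that unfolding WP_def by blast
qed

text \<open>
  On each walker the admissible labelings are the translates of the label function by nonnegative
  multiples of \<open>n\<close>, so minimality on each walker singles it out.
\<close>

lemma cyclic_compass_iff: "is_compass_labeling n E D \<rho> \<longleftrightarrow> \<rho> = \<phi>"
proof
  have hc: "has_cycle E" using ne has_cycle_iff by simp
  have FC: "Field (cycle_of E) = Cyc \<inter> {1..n}" by (rule Field_cycle_of[OF ne])
  have fin: "finite (walker_points n W)" for W
    by (rule finite_subset[of _ "{1..n}"]) (auto simp: walker_points_def)
  {
    fix \<rho> W assume adm: "admissible_cyclic n E D \<rho>" and "W \<in> walkers n E D"
    then obtain x y where g: "(x, y) \<in> gaps" "W = gap_walker x" unfolding walkers_gaps by force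
    obtain t where t: "t \<ge> 0" "\<And>i. i \<in> walker_points n W \<Longrightarrow> \<rho> i = \<phi> i + t * n"
      using cyclic_admissible_shift[OF adm g(1)] g(2) by metis
    have "(\<Sum>i\<in>walker_points n W. \<phi> i) \<le> (\<Sum>i\<in>walker_points n W. \<rho> i)"
      by (rule sum_mono) (use t n_pos in simp)
  }
  then have "is_compass_labeling n E D \<phi>"
    unfolding is_compass_labeling_def FC using hc label_cyclic_admissible by (auto simp: label_def)
  then show "\<rho> = \<phi> \<Longrightarrow> is_compass_labeling n E D \<rho>" by simp
  assume comp: "is_compass_labeling n E D \<rho>"
  then have adm: "admissible_cyclic n E D \<rho>" and cyc: "\<And>i. i \<in> Cyc \<inter> {1..n} \<Longrightarrow> \<rho> i = i"
    and min: "\<And>W. W \<in> walkers n E D \<Longrightarrow> (\<Sum>i\<in>walker_points n W. \<rho> i) \<le> (\<Sum>i\<in>walker_points n W. \<phi> i)"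
    unfolding is_compass_labeling_def FC using hc label_cyclic_admissible by auto
  have "\<rho> i = \<phi> i" if i: "i \<in> {1..n}" for i
  proof (cases "i \<in> Cyc")
    case True
    then show ?thesis using cyc i by (simp add: label_def)
  next
    case False
    obtain x y k where g: "(x, y) \<in> gaps" "x < i + k * n" "i + k * n < y" using gap_exists[OF False] by blast
    define WP where "WP = walker_points n (gap_walker x)"
    have iW: "i \<in> WP"
      using mem_gap_walker[OF ne gapsD(1,2,8)[OF g(1)]] g i unfolding WP_def walker_points_def by blast
    obtain t where t: "t \<ge> 0" "\<And>j. j \<in> WP \<Longrightarrow> \<rho> j = \<phi> j + t * n"
      using cyclic_admissible_shift[OF adm g(1)] unfolding WP_def by metis
    have "gap_walker x \<in> walkers n E D" unfolding walkers_gaps using g(1) by force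
    then have "(\<Sum>j\<in>WP. \<phi> j + t * n) \<le> (\<Sum>j\<in>WP. \<phi> j)" using min[of "gap_walker x"] t(2) unfolding WP_def by simp
    then have "int (card WP) * (t * n) \<le> 0" by (simp add: sum.distrib)
    moreover have "card WP > 0" using iW fin unfolding WP_def by (auto simp: card_gt_0_iff)
    ultimately have "t \<le> 0" using n_pos by (simp add: mult_le_0_iff)
    then show ?thesis using t iW by simp
  qed
  moreover have "\<rho> \<in> extensional {1..n}" "\<phi> \<in> extensional {1..n}"
    using adm label_labeling unfolding admissible_cyclic_def is_labeling_def by auto
  ultimately show "\<rho> = \<phi>" by (intro extensionalityI) auto
qed

lemma cyclic_compass: "compass n E D = \<phi>"
  unfolding compass_def cyclic_compass_iff by simp

lemma gap_min_label: "(x, y) \<in> gaps \<Longrightarrow> min_label n E D (gap_walker x) = x + 1"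
  unfolding min_label_def cyclic_compass using gapsD(8)[of x y] by (simp add: gap_labels) (intro Min_eqI, auto)

lemma gap_max_label: "(x, y) \<in> gaps \<Longrightarrow> max_label n E D (gap_walker x) = y - 1"
  unfolding max_label_def cyclic_compass using gapsD(8)[of x y] by (simp add: gap_labels) (intro Max_eqI, auto)

lemma gap_walker_at:
  assumes "(x, y) \<in> gaps"
  shows "walker_at n E D (x + 1) = gap_walker x"
  unfolding walker_at_def
proof (rule the_equality)
  show "gap_walker x \<in> walkers n E D \<and> min_label n E D (gap_walker x) = x + 1"
    using gap_min_label[OF assms] assms unfolding walkers_gaps by force
  fix W assume W: "W \<in> walkers n E D \<and> min_label n E D W = x + 1"
  then obtain x' y' where g: "(x', y') \<in> gaps" "W = gap_walker x'" unfolding walkers_gaps by force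
  then have "x' = x" using gap_min_label W by auto
  then show "W = gap_walker x" using g by simp
qed

lemma gap_Sub:
  assumes "(x, y) \<in> gaps"
  shows "Sub_walker n E D (walker_at n E D (x + 1)) = Sub (x + 1) (y - 1) (restrict_arcs Lift (x + 1) (y - 1))"
proof -
  note g = gapsD[OF assms]
  have "walker_arcs E D (gap_walker x) = {(a, b) \<in> E. a \<notin> Cyc \<and> \<phi> a \<in> {x + 1..y - 1}}"
    using gap_walker_arcs[OF ne] gap_points[OF assms] E_sub unfolding walker_points_def by blast
  then have "label_arcs \<phi> (walker_arcs E D (gap_walker x)) = restrict_arcs Lift (x + 1) (y - 1)"
    using label_arcs_interval(1)[OF base1, of "x + 1" "y - 1"] gap_inner[OF assms] gap_closed[OF assms] g(4,5) by simp
  then show ?thesis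
    unfolding gap_walker_at[OF assms] Sub_walker_def cyclic_compass gap_min_label[OF assms] gap_max_label[OF assms]
    by simp
qed

text \<open>
  Within a gap the procedure sorts; a smaller gap precedes a larger one, because no path leaves its
  gap.
\<close>

lemma cyclic_W_wax:
  "set (W_wax n E D) = {base + 1..<base + 1 + n} - Cyc" "sorted_wrt strict (W_wax n E D)"
proof -
  define G where "G = (\<lambda>x. x + 1) ` fst ` gaps"
  define piece where "piece i = Sub_walker n E D (walker_at n E D i)" for i
  have "fst ` gaps \<subseteq> {0..<n}" unfolding gaps_def by auto
  then have finG: "finite G" unfolding G_def by (meson finite_atLeastLessThan_int finite_imageI finite_subset)
  have "min_label n E D ` walkers n E D = G"
    unfolding walkers_gaps G_def image_image using gap_min_label by (intro image_cong) auto
  then have W: "W_wax n E D = concat (map piece (sorted_list_of_set G))"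
    unfolding W_wax_def piece_def using ne has_cycle_iff by simp
  have piece: "set (piece (x + 1)) = {x + 1..y - 1}" "sorted_wrt strict (piece (x + 1))" if g: "(x, y) \<in> gaps" for x y
  proof -
    have "Sub_ok (x + 1) (y - 1)" using gap_closed[OF g] by (rule Sub_ok)
    then show "set (piece (x + 1)) = {x + 1..y - 1}" "sorted_wrt strict (piece (x + 1))"
      unfolding Sub_ok_def piece_def gap_Sub[OF g] by auto
  qed
  have "set (W_wax n E D) = (\<Union>i\<in>G. set (piece i))" unfolding W using finG by simp
  also have "\<dots> = {base + 1..<base + 1 + n} - Cyc"
  proof
    show "(\<Union>i\<in>G. set (piece i)) \<subseteq> {base + 1..<base + 1 + n} - Cyc"
      unfolding G_def using piece(1) gap_inner by fastforce
    show "{base + 1..<base + 1 + n} - Cyc \<subseteq> (\<Union>i\<in>G. set (piece i))"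
    proof
      fix u assume u: "u \<in> {base + 1..<base + 1 + n} - Cyc"
      obtain x y k where g: "(x, y) \<in> gaps" "x < u + k * n" "u + k * n < y" using gap_exists u by blast
      then have "u + k * n \<in> {base + 1..<base + 1 + n}" using gap_inner[OF g(1), of "u + k * n"] by simp
      then have "k = 0" using shifted_range_unique0[OF refl, of u k n "base + 1"] u by blast
      then have "u \<in> set (piece (x + 1))" using piece(1)[OF g(1)] g by simp
      then show "u \<in> (\<Union>i\<in>G. set (piece i))" unfolding G_def using g(1) by force
    qed
  qed
  finally show "set (W_wax n E D) = {base + 1..<base + 1 + n} - Cyc" .
  have across: "strict u v" if ij: "i \<in> G" "j \<in> G" "i < j" and uv: "u \<in> set (piece i)" "v \<in> set (piece j)" for i j u v
  proof -
    obtain x y where g: "(x, y) \<in> gaps" "i = x + 1" using ij(1) unfolding G_def by auto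
    obtain x' y' where g': "(x', y') \<in> gaps" "j = x' + 1" using ij(2) unfolding G_def by auto
    have "y \<le> x'" using Cyc_between[OF gapsD(1)[OF g(1)] gapsD(2)[OF g'(1)]] ij(3) g g' by simp
    moreover have u: "u \<in> {x + 1..y - 1}" and "v \<in> {x' + 1..y' - 1}" using piece(1) g g' uv by auto
    moreover have "\<not> over u y" using not_over_under[OF gapsD(1)[OF g(1)], of u] u by simp
    ultimately show ?thesis using strict_less[of u v] over_mono[of u v y] by auto
  qed
  have "sorted_wrt strict (concat (map piece is))" if "sorted_wrt (<) is" "set is \<subseteq> G" for "is"
    using that
  proof (induction "is")
    case (Cons i "is")
    have "i \<in> G" using Cons.prems(2) by simp
    then obtain x y where g: "(x, y) \<in> gaps" "i = x + 1" unfolding G_def by auto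
    then show ?case using Cons across[OF \<open>i \<in> G\<close>] piece(2)[OF g(1)] by (auto simp: sorted_wrt_append)
  qed simp
  then show "sorted_wrt strict (W_wax n E D)" unfolding W using finG by simp
qed

lemma cyclic_construction:
  shows "\<exists>!\<rho>. is_compass_labeling n E D \<rho>"
    and "constructed_windows n E D = windows_of (W_wax n E D) (rev (sorted_list_of_set (Cyc \<inter> {1..n})))"
    and "\<forall>x\<in>set (W_wax n E D). \<forall>y. over x y \<longrightarrow> y < base + 1 + n"
proof -
  show "\<exists>!\<rho>. is_compass_labeling n E D \<rho>" unfolding cyclic_compass_iff by simp
  have "\<phi> ` (Cyc \<inter> {1..n}) = Cyc \<inter> {1..n}" by (auto simp: label_def image_iff)
  then have Wan: "W_wan n E D = rev (sorted_list_of_set (Cyc \<inter> {1..n}))"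
    unfolding W_wan_def cyclic_compass Field_cycle_of[OF ne] by simp
  have "Cyc \<inter> {1..n} \<noteq> {}"
  proof -
    obtain k r where "base = r + k * n" "r \<in> {1..<1 + n}" using shift_into_range[OF n_pos] .
    then have "r \<in> Cyc \<inter> {1..n}" using base(1) Cyc_shift by auto
    then show ?thesis by blast
  qed
  then have "rev (sorted_list_of_set (Cyc \<inter> {1..n})) \<noteq> []" by simp
  then show "constructed_windows n E D = windows_of (W_wax n E D) (rev (sorted_list_of_set (Cyc \<inter> {1..n})))"
    unfolding constructed_windows_def windows_of_def Wan using ne has_cycle_iff by simp
  show "\<forall>x\<in>set (W_wax n E D). \<forall>y. over x y \<longrightarrow> y < base + 1 + n"
  proof (intro ballI allI impI)
    fix x y assume x: "x \<in> set (W_wax n E D)" and ov: "over x y"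
    have bn: "base + n \<in> Cyc" using base(1) Cyc_shift[of base 1] by simp
    have "x \<notin> Cyc" "x < base + 1 + n" using x cyclic_W_wax(1) by auto
    then have "x < base + n" using bn by (cases "x = base + n") auto
    then show "y < base + 1 + n"
      using over_gap[OF ne \<open>x \<notin> Cyc\<close> ov _ bn] by (cases "x < y") auto
  qed
qed

end

lemma construction_correct:
  shows "\<exists>!\<phi>. is_compass_labeling n E D \<phi>"
    and "\<not> has_cycle E \<Longrightarrow> \<exists>h. is_cut n E D (Min (compass n E D ` {1..n})) h"
    and "\<exists>!R. is_tito n R \<and> window_notation n R (constructed_windows n E D)"
    and "constructed_tito n E D = ord"
proof -
  obtain v m where v: "constructed_windows n E D = windows_of v (rev (sorted_list_of_set (Cyc \<inter> {1..n})))"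
    "sorted_wrt strict v" "set v = {m..<m + n} - Cyc" "\<forall>x\<in>set v. \<forall>y. over x y \<longrightarrow> y < m + n"
  proof (cases "Cyc = {}")
    case True
    then show ?thesis using acyclic_construction(3)[OF True] that by auto
  next
    case False
    show ?thesis by (rule that[OF cyclic_construction(2)[OF False] cyclic_W_wax(2,1)[OF False] cyclic_construction(3)[OF False]])
  qed
  show "\<exists>!\<phi>. is_compass_labeling n E D \<phi>"
    using acyclic_construction(1) cyclic_construction(1) by blast
  show "\<exists>h. is_cut n E D (Min (compass n E D ` {1..n})) h" if "\<not> has_cycle E"
    using acyclic_construction(2) that has_cycle_iff by blast
  note wn = ord_window_notation[OF v(2,3,4) refl]
  have ex: "is_tito n ord \<and> window_notation n ord (constructed_windows n E D)"
    using ord_tito wn(1) v(1) by simp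
  have uniq: "R = ord" if R: "is_tito n R \<and> window_notation n R (constructed_windows n E D)" for R
  proof (rule window_notation_unique[OF n_pos _ _ ord_tito wn(1)])
    show "is_tito n R" "window_notation n R (windows_of v (rev (sorted_list_of_set (Cyc \<inter> {1..n}))))"
      using R v(1) by simp_all
  qed (use wn(2,3) in blast)+
  show "\<exists>!R. is_tito n R \<and> window_notation n R (constructed_windows n E D)" using ex uniq by blast
  show "constructed_tito n E D = ord" unfolding constructed_tito_def using ex uniq by (rule the_equality)
qed

end

section \<open>The correspondence\<close>

theorem mainTheorem3:
  fixes n :: int
  assumes "n > 0"
  shows "(\<forall>E D. noncrossing_arc_diagram n E \<and> is_drawing n E D \<longrightarrow>
            (\<exists>!\<phi>. is_compass_labeling n E D \<phi>) \<and>
            (\<not> has_cycle E \<longrightarrow> (\<exists>h. is_cut n E D (Min (compass n E D ` {1..n})) h)) \<and>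
            (\<exists>!R. is_tito n R \<and> window_notation n R (constructed_windows n E D)) \<and>
            avoids_312 (constructed_tito n E D) \<and>
            arc_diagram n (constructed_tito n E D) = E) \<and>
         bij_betw (arc_diagram n) {R. is_tito n R \<and> avoids_312 R} {E. noncrossing_arc_diagram n E} \<and>
         (\<forall>E D. noncrossing_arc_diagram n E \<and> is_drawing n E D \<longrightarrow>
            constructed_tito n E D =
              the_inv_into {R. is_tito n R \<and> avoids_312 R} (arc_diagram n) E)"
proof -
  let ?T = "{R. is_tito n R \<and> avoids_312 R}"
  have main: "(\<exists>!\<phi>. is_compass_labeling n E D \<phi>) \<and>
      (\<not> has_cycle E \<longrightarrow> (\<exists>h. is_cut n E D (Min (compass n E D ` {1..n})) h)) \<and>
      (\<exists>!R. is_tito n R \<and> window_notation n R (constructed_windows n E D)) \<and>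
      constructed_tito n E D \<in> ?T \<and> arc_diagram n (constructed_tito n E D) = E"
    if "noncrossing_arc_diagram n E" "is_drawing n E D" for E D
  proof -
    interpret drawn_diagram n E D
      using drawing_diagram[OF assms that] that(2) by (simp add: drawn_diagram_def drawn_diagram_axioms_def)
    have "walls ord = lift n E" using lower_wall_ord unfolding walls_def by auto
    then have "arc_diagram n ord = E" using arc_diagram_walls E_sub by blast
    then show ?thesis using construction_correct ord_tito ord_avoids by simp
  qed
  have inj: "inj_on (arc_diagram n) ?T"
  proof (rule inj_onI)
    fix R R' assume R: "R \<in> ?T" and R': "R' \<in> ?T" and eq: "arc_diagram n R = arc_diagram n R'"
    have "walls R = walls R'" using lift_arc_diagram[OF assms] R R' eq by (metis mem_Collect_eq)
    then show "R = R'" using ord_walls[OF assms] R R' by (metis mem_Collect_eq)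
  qed
  have into: "noncrossing_arc_diagram n (arc_diagram n R)" if "R \<in> ?T" for R
  proof -
    have "arc_lift n (lift n (arc_diagram n R))"
      using walls_arc_lift[OF assms] lift_arc_diagram[OF assms] that by simp
    then have "diagram n (arc_diagram n R)"
      by (simp add: diagram_def diagram_axioms_def) (auto simp: arc_diagram_def)
    then show ?thesis by (rule diagram.noncrossing)
  qed
  have "E \<in> arc_diagram n ` ?T" if E: "noncrossing_arc_diagram n E" for E
  proof -
    obtain D where D: "is_drawing n E D" using E unfolding noncrossing_arc_diagram_def by blast
    note m = main[OF E D]
    show ?thesis by (rule image_eqI[of E "arc_diagram n" "constructed_tito n E D"]) (use m in simp_all)
  qed
  then have bij: "bij_betw (arc_diagram n) ?T {E. noncrossing_arc_diagram n E}"
    unfolding bij_betw_def using inj into by blast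
  moreover have "constructed_tito n E D = the_inv_into ?T (arc_diagram n) E"
    if "noncrossing_arc_diagram n E" "is_drawing n E D" for E D
  proof -
    note m = main[OF that]
    show ?thesis
      by (rule the_inv_into_f_eq[symmetric, OF inj]) (use m in simp_all)
  qed
  ultimately show ?thesis using main by blast
qed

end
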